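(* Let $K\ge1$. Suppose that $f(z)=h(z)+\overline{g(z)}=\sum_{n=0}^\infty a_nz^n+\overline{\sum_{n=1}^\infty b_nz^n}$ is a sense-preserving $K$-quasiconformal harmonic mapping in $\mathbb{D}$ and $h\prec\phi$, where $\phi$ is analytic and univalent in $\mathbb{D}$. Then $$|h(z)|+|h'(z)|r+\sum_{n=2}^\infty|a_n|r^n+\sum_{n=1}^\infty|b_n|r^n\le|\phi(0)|+d(\phi(0),\partial\phi(\mathbb{D}))\quad\text{for } |z|=r\le r_0,$$ where $r_0\in(0,1/3)$ is the unique positive root in $(0,1/3)$ of the equation $$(1-r)^3-4\left(r^2(2-r)+\left(\frac{2K}{K+1}\right)r\right)(1-r)-4r(1+r)=0.$$ The number $r_0$ is sharp: for given $K$ it cannot be replaced by any larger number for which the inequality holds for all such $f$ and $\phi$.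
   Context: $\mathbb{D}=\{z\in\mathbb{C}:|z|<1\}$. A harmonic mapping in $\mathbb{D}$ is written $f=h+\overline{g}$ with $h,g$ analytic in $\mathbb{D}$. It is locally univalent and sense-preserving if $h'\neq0$ in $\mathbb{D}$ and the dilatation $\omega=g'/h'$ satisfies $|\omega|<1$ in $\mathbb{D}$. Such an $f$ is called $K$-quasiconformal for $K\ge1$ if $|\omega(z)|\le k<1$ for all $z\in\mathbb{D}$, where $K=(1+k)/(1-k)$, i.e. $k=(K-1)/(K+1)$. For analytic $h,\phi$ in $\mathbb{D}$, $h\prec\phi$ (subordination) means $h=\phi\circ w$ for some analytic $w:\mathbb{D}\to\mathbb{D}$ with $w(0)=0$. Univalent means injective. $d(\phi(0),\partial\phi(\mathbb{D}))$ is the Euclidean distance from $\phi(0)$ to the boundary of $\phi(\mathbb{D})$. *)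

theory Defs
  imports "HOL-Complex_Analysis.Complex_Analysis"
begin

abbreviation unit_disc :: "complex set" where
  "unit_disc \<equiv> ball 0 1"

definition dilatation :: "(complex \<Rightarrow> complex) \<Rightarrow> (complex \<Rightarrow> complex) \<Rightarrow> complex \<Rightarrow> complex" where
  "dilatation h g z = deriv g z / deriv h z"

definition harmonic_decomposition ::
    "(complex \<Rightarrow> complex) \<Rightarrow> (complex \<Rightarrow> complex) \<Rightarrow> (complex \<Rightarrow> complex) \<Rightarrow> bool" where
  "harmonic_decomposition f h g \<longleftrightarrow>
     h holomorphic_on unit_disc \<and> g holomorphic_on unit_disc \<and>
     (\<forall>z\<in>unit_disc. f z = h z + cnj (g z))"

definition sense_preserving_harmonic ::
    "(complex \<Rightarrow> complex) \<Rightarrow> (complex \<Rightarrow> complex) \<Rightarrow> (complex \<Rightarrow> complex) \<Rightarrow> bool" where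
  "sense_preserving_harmonic f h g \<longleftrightarrow>
     harmonic_decomposition f h g \<and>
     (\<forall>z\<in>unit_disc. deriv h z \<noteq> 0 \<and> norm (dilatation h g z) < 1)"

text \<open>The dilatation bound k satisfies K = (1 + k) / (1 - k). No global injectivity of f is
  required.\<close>

definition quasiconformal_harmonic ::
    "real \<Rightarrow> (complex \<Rightarrow> complex) \<Rightarrow> (complex \<Rightarrow> complex) \<Rightarrow> (complex \<Rightarrow> complex) \<Rightarrow> bool" where
  "quasiconformal_harmonic K f h g \<longleftrightarrow>
     sense_preserving_harmonic f h g \<and>
     (\<forall>z\<in>unit_disc. norm (dilatation h g z) \<le> (K - 1) / (K + 1))"

definition subordinate :: "(complex \<Rightarrow> complex) \<Rightarrow> (complex \<Rightarrow> complex) \<Rightarrow> bool" where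
  "subordinate h \<phi> \<longleftrightarrow>
     (\<exists>w. w holomorphic_on unit_disc \<and> w ` unit_disc \<subseteq> unit_disc \<and> w 0 = 0 \<and>
          (\<forall>z\<in>unit_disc. h z = \<phi> (w z)))"

text \<open>The series of g starts at n = 1, so g 0 = 0 and the value b 0 is irrelevant.\<close>

definition admissible ::
    "real \<Rightarrow> (complex \<Rightarrow> complex) \<Rightarrow> (complex \<Rightarrow> complex) \<Rightarrow> (complex \<Rightarrow> complex) \<Rightarrow>
     (nat \<Rightarrow> complex) \<Rightarrow> (nat \<Rightarrow> complex) \<Rightarrow> (complex \<Rightarrow> complex) \<Rightarrow> bool" where
  "admissible K f h g a b \<phi> \<longleftrightarrow>
     quasiconformal_harmonic K f h g \<and>
     (\<forall>z\<in>unit_disc. (\<lambda>n. a n * z ^ n) sums h z) \<and>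
     (\<forall>z\<in>unit_disc. (\<lambda>n. b (n + 1) * z ^ (n + 1)) sums g z) \<and>
     \<phi> holomorphic_on unit_disc \<and> inj_on \<phi> unit_disc \<and>
     subordinate h \<phi>"

text \<open>Both series converge for z in the unit disc whenever a and b are the Taylor coefficients
  of functions analytic there.\<close>

definition bohr_sum ::
    "(complex \<Rightarrow> complex) \<Rightarrow> (nat \<Rightarrow> complex) \<Rightarrow> (nat \<Rightarrow> complex) \<Rightarrow> complex \<Rightarrow> real" where
  "bohr_sum h a b z =
     norm (h z) + norm (deriv h z) * norm z
       + (\<Sum>n. norm (a (n + 2)) * norm z ^ (n + 2))
       + (\<Sum>n. norm (b (n + 1)) * norm z ^ (n + 1))"

definition radius_poly :: "real \<Rightarrow> real \<Rightarrow> real" where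
  "radius_poly K r =
     (1 - r) ^ 3 - 4 * (r ^ 2 * (2 - r) + (2 * K / (K + 1)) * r) * (1 - r) - 4 * r * (1 + r)"

end

theory Submission
  imports Defs
begin

text \<open>
  Write \<open>k(r) = r / (1 - r)\<^sup>2\<close>. The heart of the matter is the bound \<open>\<Sum> |a\<^sub>n| r\<^sup>n \<le> |f'(0)| k(r)\<close> over \<open>n \<ge> 1\<close> for every
  univalent \<open>f\<close> and small \<open>r\<close>, a weighted form of the Bieberbach conjecture that avoids de Branges' theorem.
  Koebe's osculation algorithm writes a bounded univalent \<open>f\<close> as a composition of Blaschke products of degree two, all close
  to the identity, followed by a map whose derivative at 0 is almost 1; this is a discrete Loewner chain.
  If \<open>\<Sum> c\<^sub>k z\<^sup>k\<close> is the logarithm of the composition divided by \<open>z\<close>, then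
  \<open>\<Sum> (k |c\<^sub>k|\<^sup>2 - 4 / k) r\<^sup>k\<close>, with \<open>r\<close> moving along the Koebe flow, decreases at each step up to an error of second
  order in the step size, so it is non-positive in the limit. The positivity that requires the Askey-Gasper inequality for
  individual coefficients is trivial for this weighted sum. The Lebedev-Milin inequality and Cauchy-Schwarz then give the bound.

  Letting \<open>r\<close> tend to 0 yields \<open>|a\<^sub>2| \<le> 2 |f'(0)|\<close>, hence the Koebe quarter theorem and the distortion theorem.
  Bohr's inequality transfers the coefficient bound to subordinate functions and, through the dilatation, to \<open>g\<close>. If
  \<open>|w'(0)| < 1\<close>, the terms of index at least 2 can exceed those of \<open>\<phi>\<close>, but the loss is
  compensated by the gain in \<open>|h(z)|\<close>. Equality for the Koebe function gives sharpness.
\<close>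

section \<open>Taylor coefficients and Bohr's inequality\<close>

text \<open>The root of \<open>radius_poly\<close> lies below 1/10 for every K \<ge> 1, so the
  univalent bound is needed only for r \<le> 1/10. This slack pays for all crude constants: Cauchy
  bounds on the disc of radius 2/5 grow like (5/2)^k, and even their squares sum against r^k. The
  second-order errors are harmless because each osculation step multiplies the derivative at 0 by 1
  - \<delta>. A self-map with |derivative| D at 0 therefore admits at most (- ln D) / \<delta>
  steps, and the total error is of order \<delta>. This is why a general f is first dilated and
  rescaled to a self-map of the disc. The map left over when the algorithm stops need not be
  compared with a rotation: Bohr's inequality removes it from the majorant, and only the size of its
  derivative at 0 matters. The numbers 4 / k come from the Koebe function: the logarithm of its
  quotient by z is - 2 log (1 - z), with coefficients 2 / k. Passing through exp (C / 2) and
  squaring afterwards lets Cauchy-Schwarz turn the quadratic bound of Lebedev and Milin into a bound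
  for a sum of absolute values.\<close>

abbreviation taylor :: "(complex \<Rightarrow> complex) \<Rightarrow> nat \<Rightarrow> complex" where
  "taylor f n \<equiv> fps_nth (fps_expansion f 0) n"

definition majorant :: "(complex \<Rightarrow> complex) \<Rightarrow> real \<Rightarrow> real" where
  "majorant f r = (\<Sum>n. norm (taylor f n) * r ^ n)"

lemma taylor_0: "taylor f 0 = f 0"
  by (simp add: fps_expansion_def)

lemma taylor_1: "taylor f 1 = deriv f 0"
  by (simp add: fps_expansion_def)

lemma taylor_sums:
  assumes "f holomorphic_on ball 0 R" "norm z < R"
  shows "(\<lambda>n. taylor f n * z ^ n) sums f z"
  using holomorphic_power_series[of f 0 R z] assms by (simp add: fps_expansion_def)

lemma taylor_unique:
  assumes "R > 0" "\<And>z. norm z < R \<Longrightarrow> (\<lambda>n. a n * z ^ n) sums f z"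
  shows "taylor f n = a n"
proof -
  have "f has_fps_expansion Abs_fps a"
  proof (rule has_fps_expansionI)
    have "eventually (\<lambda>z::complex. z \<in> ball 0 R) (nhds 0)"
      using assms by (intro eventually_nhds_in_open) auto
    then show "eventually (\<lambda>u. (\<lambda>n. fps_nth (Abs_fps a) n * u ^ n) sums f u) (nhds 0)"
      by eventually_elim (use assms in auto)
  qed
  from fps_expansion_eqI[OF this] show ?thesis by simp
qed

lemma taylor_expansion:
  assumes "f holomorphic_on ball 0 R" "R > 0"
  shows "f has_fps_expansion fps_expansion f 0"
  using assms by (intro has_fps_expansion_fps_expansion[of "ball 0 R"]) auto

lemma taylor_cong:
  assumes "R > 0" "\<And>z. norm z < R \<Longrightarrow> f z = g z"
  shows "taylor f n = taylor g n"
proof -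
  have "eventually (\<lambda>z::complex. z \<in> ball 0 R) (nhds 0)"
    using assms by (intro eventually_nhds_in_open) auto
  then have "eventually (\<lambda>z. f z = g z) (nhds 0)"
    by eventually_elim (use assms in auto)
  from fps_expansion_cong[OF this] show ?thesis by simp
qed

text \<open>Cauchy's estimate on circles of radius \<open>r < R\<close>, followed by the limit
  \<open>r\<close> to \<open>R\<close>, since nothing is known on the boundary of the ball.\<close>

lemma taylor_bound:
  assumes hol: "f holomorphic_on ball 0 R" and R: "R > 0"
    and B: "\<And>z. norm z < R \<Longrightarrow> norm (f z) \<le> B"
  shows "norm (taylor f n) * R ^ n \<le> B"
proof (rule tendsto_upperbound)
  show "((\<lambda>r. norm (taylor f n) * r ^ n) \<longlongrightarrow> norm (taylor f n) * R ^ n) (at_left R)"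
    by (intro tendsto_intros)
  have "norm (taylor f n) * r ^ n \<le> B" if "r \<in> {0<..<R}" for r
  proof -
    have "norm ((deriv ^^ n) f 0) \<le> fact n * B / r ^ n"
    proof (rule Cauchy_inequality)
      show "f holomorphic_on ball 0 r" "continuous_on (cball 0 r) f"
        using that hol
        by (auto intro!: holomorphic_on_subset[OF hol] holomorphic_on_imp_continuous_on)
    qed (use that B in auto)
    then show ?thesis using that
      by (simp add: fps_expansion_def norm_divide field_simps)
  qed
  then show "eventually (\<lambda>r. norm (taylor f n) * r ^ n \<le> B) (at_left R)"
    using eventually_at_left_real[of 0 R] R by (auto elim!: eventually_mono)
qed simp

lemma taylor_abs_summable:
  assumes "f holomorphic_on ball 0 R" "0 \<le> r" "r < R"
  shows "summable (\<lambda>n. norm (taylor f n) * r ^ n)"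
proof -
  define x where "x = (r + R) / 2"
  have x: "r < x" "x < R" using assms by (auto simp: x_def)
  have "summable (\<lambda>n. taylor f n * (of_real x) ^ n)"
    using taylor_sums[OF assms(1), of "of_real x"] x assms by (auto simp: sums_iff)
  from powser_insidea[OF this, of "of_real r"] x assms show ?thesis
    by (simp add: norm_mult norm_power)
qed

lemma norm_le_majorant:
  assumes "f holomorphic_on ball 0 R" "norm z < R"
  shows "norm (f z) \<le> majorant f (norm z)"
proof -
  have s: "summable (\<lambda>n. norm (taylor f n * z ^ n))"
    using taylor_abs_summable[OF assms(1) _ assms(2)] by (simp add: norm_mult norm_power)
  have "f z = (\<Sum>n. taylor f n * z ^ n)"
    using taylor_sums[OF assms] by (simp add: sums_iff)
  also have "norm \<dots> \<le> (\<Sum>n. norm (taylor f n * z ^ n))" by (rule summable_norm[OF s])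
  finally show ?thesis by (simp add: majorant_def norm_mult norm_power)
qed

lemma taylor_cmult:
  assumes "f holomorphic_on ball 0 R" "R > 0"
  shows "taylor (\<lambda>z. c * f z) n = c * taylor f n"
  by (rule taylor_unique[of R])
     (use assms taylor_sums[OF assms(1)] sums_mult in \<open>auto simp: mult.assoc\<close>)

lemma taylor_scale:
  assumes "f holomorphic_on ball 0 R" "R > 0" "norm c \<le> 1"
  shows "taylor (\<lambda>z. f (c * z)) n = c ^ n * taylor f n"
proof (rule taylor_unique[of R])
  fix z :: complex assume "norm z < R"
  then have "norm (c * z) < R"
    using assms by (smt (verit) mult_left_le_one_le norm_ge_zero norm_mult)
  from taylor_sums[OF assms(1) this] show "(\<lambda>n. c ^ n * taylor f n * z ^ n) sums f (c * z)"
    by (simp add: power_mult_distrib mult_ac)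
qed (use assms in auto)

lemma taylor_diff:
  assumes "f holomorphic_on ball 0 R" "g holomorphic_on ball 0 R" "R > 0"
  shows "taylor (\<lambda>z. f z - g z) n = taylor f n - taylor g n"
proof (rule taylor_unique[of R])
  fix z :: complex assume z: "norm z < R"
  from sums_diff[OF taylor_sums[OF assms(1) z] taylor_sums[OF assms(2) z]]
  show "(\<lambda>n. (taylor f n - taylor g n) * z ^ n) sums (f z - g z)"
    by (simp add: left_diff_distrib)
qed (use assms in auto)

lemma taylor_add:
  assumes "f holomorphic_on ball 0 R" "g holomorphic_on ball 0 R" "R > 0"
  shows "taylor (\<lambda>z. f z + g z) n = taylor f n + taylor g n"
proof (rule taylor_unique[of R])
  fix z :: complex assume z: "norm z < R"
  from sums_add[OF taylor_sums[OF assms(1) z] taylor_sums[OF assms(2) z]]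
  show "(\<lambda>n. (taylor f n + taylor g n) * z ^ n) sums (f z + g z)"
    by (simp add: distrib_right)
qed (use assms in auto)

lemma taylor_mult:
  assumes "f holomorphic_on ball 0 R" "g holomorphic_on ball 0 R" "R > 0"
  shows "taylor (\<lambda>z. f z * g z) n = (\<Sum>i\<le>n. taylor f i * taylor g (n - i))"
proof -
  have "(\<lambda>z. f z * g z) has_fps_expansion fps_expansion f 0 * fps_expansion g 0"
    by (intro has_fps_expansion_mult taylor_expansion[OF assms(1,3)] taylor_expansion[OF assms(2,3)])
  from fps_expansion_eqI[OF this] show ?thesis
    by (simp add: fps_mult_nth atMost_atLeast0)
qed

lemma taylor_mult_left:
  assumes "f holomorphic_on ball 0 R" "R > 0"
  shows "taylor (\<lambda>z. z * f z) n = (if n = 0 then 0 else taylor f (n - 1))"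
proof -
  have "(\<lambda>z. z * f z) has_fps_expansion fps_X * fps_expansion f 0"
    by (intro fps_expansion_intros taylor_expansion[OF assms])
  from fps_expansion_eqI[OF this] show ?thesis by simp
qed

lemma taylor_deriv:
  assumes "f holomorphic_on ball 0 R" "R > 0"
  shows "taylor (deriv f) n = of_nat (Suc n) * taylor f (Suc n)"
proof -
  have "deriv f has_fps_expansion fps_deriv (fps_expansion f 0)"
    by (intro fps_expansion_intros taylor_expansion[OF assms])
  from fps_expansion_eqI[OF this] show ?thesis by simp
qed

text \<open>The sum stops at \<open>n\<close> because \<open>g 0 = 0\<close> makes the i-th power of
  \<open>g\<close> vanish to order i.\<close>

lemma taylor_compose:
  assumes "f holomorphic_on ball 0 R" "R > 0" "g holomorphic_on ball 0 S" "S > 0" "g 0 = 0"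
  shows "taylor (\<lambda>z. f (g z)) n = (\<Sum>i\<le>n. taylor f i * taylor (\<lambda>z. g z ^ i) n)"
proof -
  have "(f \<circ> g) has_fps_expansion (fps_expansion f 0 oo fps_expansion g 0)"
    by (intro has_fps_expansion_compose taylor_expansion[of _ R] taylor_expansion[of _ S] assms)
       (simp add: taylor_0 assms)
  from fps_expansion_eqI[OF this]
  have "taylor (f \<circ> g) n = (\<Sum>i\<le>n. taylor f i * fps_nth (fps_expansion g 0 ^ i) n)"
    by (simp add: fps_compose_nth atMost_atLeast0)
  moreover have "fps_expansion (\<lambda>z. g z ^ i) 0 = fps_expansion g 0 ^ i" for i
    by (rule fps_expansion_eqI) (intro fps_expansion_intros taylor_expansion[of _ S] assms)
  ultimately show ?thesis by (simp add: o_def)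
qed

text \<open>Cauchy's formula with the circle parametrised by {0..1}, so that Taylor coefficients
  become Fourier coefficients and conjugates and real parts can be taken under the integral.\<close>

lemma taylor_integral:
  assumes "f holomorphic_on ball 0 R" "0 < r" "r < R"
  shows "((\<lambda>t. f (of_real r * cis (2 * pi * t)) * cis (- (2 * pi * real n * t))) has_integral
           taylor f n * of_real r ^ n) {0..1}"
proof -
  have "((\<lambda>u. f u / (u - 0) ^ Suc n) has_contour_integral
       (2 * pi * \<i>) / (fact n) * (deriv ^^ n) f 0) (circlepath 0 r)"
  proof (rule Cauchy_has_contour_integral_higher_derivative_circlepath)
    show "continuous_on (cball 0 r) f" "f holomorphic_on ball 0 r"
      using assms
      by (auto intro!: holomorphic_on_subset[OF assms(1)] holomorphic_on_imp_continuous_on)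
  qed (use assms in auto)
  then have "((\<lambda>t. f (circlepath 0 r t) / circlepath 0 r t ^ Suc n *
        vector_derivative (circlepath 0 r) (at t within {0..1})) has_integral
        (2 * pi * \<i>) * taylor f n) {0..1}"
    by (simp add: has_contour_integral_def fps_expansion_def mult_ac)
  from has_integral_mult_right[OF this, of "of_real r ^ n / (2 * pi * \<i>)"]
  have *: "((\<lambda>t. of_real r ^ n / (2 * pi * \<i>) * (f (circlepath 0 r t) / circlepath 0 r t ^ Suc n *
        vector_derivative (circlepath 0 r) (at t within {0..1}))) has_integral
        taylor f n * of_real r ^ n) {0..1}" by (simp add: field_simps)
  show ?thesis
  proof (rule has_integral_eq[OF _ *])
    fix t :: real assume t: "t \<in> {0..1}"
    have c: "circlepath 0 r t = of_real r * cis (2 * pi * t)"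
      by (simp add: circlepath cis_conv_exp mult_ac)
    have v: "vector_derivative (circlepath 0 r) (at t within {0..1}) =
        2 * pi * \<i> * of_real r * cis (2 * pi * t)"
      using t by (simp add: vector_derivative_circlepath01 cis_conv_exp mult_ac)
    have "cis (2 * pi * t) ^ n = cis (2 * pi * real n * t)"
      by (simp add: Complex.DeMoivre mult_ac)
    then show "of_real r ^ n / (2 * pi * \<i>) * (f (circlepath 0 r t) / circlepath 0 r t ^ Suc n *
        vector_derivative (circlepath 0 r) (at t within {0..1})) =
        f (of_real r * cis (2 * pi * t)) * cis (- (2 * pi * real n * t))"
      unfolding c v using assms
      by (simp add: field_simps cis_inverse[symmetric] del: cis_inverse)
  qed
qed

text \<open>Adding the conjugate of the vanishing integral of \<open>f\<close> against the opposite character replaces \<open>f\<close> by \<open>2 Re f\<close>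
  in the integral for the coefficient.\<close>

lemma taylor_le_Re:
  assumes hol: "f holomorphic_on ball 0 1" and pos: "\<And>z. norm z < 1 \<Longrightarrow> 0 \<le> Re (f z)" and n: "n \<ge> 1"
  shows "norm (taylor f n) \<le> 2 * Re (f 0)"
proof (rule tendsto_upperbound)
  show "((\<lambda>r. norm (taylor f n) * r ^ n) \<longlongrightarrow> norm (taylor f n)) (at_left 1)"
    by (auto intro!: tendsto_eq_intros)
  have "norm (taylor f n) * r ^ n \<le> 2 * Re (f 0)" if r: "r \<in> {0<..<1}" for r
  proof -
    define e where "e = (\<lambda>t. of_real r * cis (2 * pi * t))"
    define k where "k = (\<lambda>t. cis (2 * pi * real n * t))"
    have "((\<lambda>t. f (e t) * e t ^ n * cis (- (2 * pi * real 0 * t))) has_integral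
            taylor (\<lambda>z. f z * z ^ n) 0 * of_real r ^ 0) {0..1}"
      unfolding e_def using r hol
      by (intro taylor_integral[of "\<lambda>z. f z * z ^ n" 1]) (auto intro!: holomorphic_intros)
    moreover have "taylor (\<lambda>z. f z * z ^ n) 0 = 0" using n by (simp only: taylor_0) simp
    ultimately have "((\<lambda>t. f (e t) * e t ^ n) has_integral 0) {0..1}" by simp
    from has_integral_mult_right[OF this, of "1 / of_real r ^ n"]
    have "((\<lambda>t. f (e t) * (e t ^ n / of_real r ^ n)) has_integral 0) {0..1}" by simp
    moreover have "e t ^ n / of_real r ^ n = k t" for t
      using r unfolding e_def k_def power_mult_distrib by (simp add: Complex.DeMoivre mult_ac)
    ultimately have "((\<lambda>t. f (e t) * k t) has_integral 0) {0..1}" by simp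
    then have 1: "((\<lambda>t. cnj (f (e t)) * cnj (k t)) has_integral 0) {0..1}"
      using has_integral_cnj[of "\<lambda>t. f (e t) * k t" 0] by (simp add: o_def)
    have "((\<lambda>t. f (e t) * cnj (k t)) has_integral taylor f n * of_real r ^ n) {0..1}"
      using taylor_integral[of f 1 r n] hol r by (simp add: e_def k_def cis_cnj)
    from has_integral_add[OF this 1]
    have 2: "((\<lambda>t. of_real (2 * Re (f (e t))) * cnj (k t)) has_integral taylor f n * of_real r ^ n) {0..1}"
      by (simp add: complex_add_cnj flip: distrib_right)
    have "((\<lambda>t. f (e t)) has_integral f 0) {0..1}"
      using taylor_integral[of f 1 r 0] hol r by (simp add: e_def taylor_0)
    from has_integral_mult_right[OF has_integral_Re[OF this], of 2]
    have 3: "((\<lambda>t. 2 * Re (f (e t))) has_integral 2 * Re (f 0)) {0..1}" by simp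
    have "norm (integral {0..1} (\<lambda>t. of_real (2 * Re (f (e t))) * cnj (k t)))
        \<le> integral {0..1} (\<lambda>t. 2 * Re (f (e t)))"
    proof (rule integral_norm_bound_integral)
      fix t :: real
      have "norm (e t) < 1" using r by (simp add: e_def norm_mult)
      from pos[OF this] show "norm (of_real (2 * Re (f (e t))) * cnj (k t)) \<le> 2 * Re (f (e t))"
        by (simp add: norm_mult k_def)
    qed (use 2 3 in \<open>auto simp: integrable_on_def simp del: of_real_mult\<close>)
    then show ?thesis
      using r unfolding integral_unique[OF 2] integral_unique[OF 3] by (simp add: norm_mult norm_power)
  qed
  then show "eventually (\<lambda>r. norm (taylor f n) * r ^ n \<le> 2 * Re (f 0)) (at_left 1)"
    using eventually_at_left_real[of 0 "1::real"] by (auto elim!: eventually_mono)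
qed simp

text \<open>Rotate so that the value at 0 is nonnegative; then \<open>B - u * f\<close> has
  nonnegative real part and the bound for such functions applies. It is weaker than the Schwarz-Pick
  coefficient bound, but linear in \<open>B - norm (f 0)\<close> and still strong enough for the
  Bohr radius 1/3.\<close>

lemma taylor_le_of_bounded:
  assumes hol: "f holomorphic_on ball 0 1" and B: "\<And>z. norm z < 1 \<Longrightarrow> norm (f z) \<le> B" and n: "n \<ge> 1"
  shows "norm (taylor f n) \<le> 2 * (B - norm (f 0))"
proof -
  define u where "u = cis (- Arg (f 0))"
  have u: "norm u = 1" by (simp add: u_def)
  have u0: "u * f 0 = of_real (norm (f 0))"
    using rcis_cmod_Arg[of "f 0"] unfolding u_def rcis_def
    by (metis cis_mult cis_zero add.left_inverse mult.commute mult.left_commute mult_1)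
  have "taylor (\<lambda>z. of_real B - u * f z) n = taylor (\<lambda>z. of_real B) n - taylor (\<lambda>z. u * f z) n"
    by (rule taylor_diff[of _ 1]) (auto intro!: holomorphic_intros hol)
  also have "taylor (\<lambda>z. of_real B) n = 0"
    using n by (simp add: fps_expansion_def higher_deriv_const)
  also have "taylor (\<lambda>z. u * f z) n = u * taylor f n"
    by (rule taylor_cmult[OF hol]) simp
  finally have "norm (taylor f n) = norm (taylor (\<lambda>z. of_real B - u * f z) n)"
    using u by (simp add: norm_mult)
  also have "\<dots> \<le> 2 * Re (of_real B - u * f 0)"
  proof (rule taylor_le_Re[OF _ _ n])
    fix z :: complex assume "norm z < 1"
    have "Re (u * f z) \<le> norm (u * f z)" by (rule complex_Re_le_cmod)
    also have "\<dots> \<le> B" using B \<open>norm z < 1\<close> u by (simp add: norm_mult)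
    finally show "0 \<le> Re (of_real B - u * f z)" by simp
  qed (intro holomorphic_intros hol)
  finally show ?thesis using u0 by simp
qed

text \<open>Kept apart from \<open>bohr\<close> for its factor \<open>B - norm (f 0)\<close>:
  applied to w(z) / z it measures how far a Schwarz function w is from a rotation.\<close>

lemma bohr_tail:
  assumes hol: "f holomorphic_on ball 0 1" and B: "\<And>z. norm z < 1 \<Longrightarrow> norm (f z) \<le> B"
    and r: "0 \<le> r" "r < 1"
  shows "(\<Sum>n. norm (taylor f (Suc n)) * r ^ Suc n) \<le> 2 * (B - norm (f 0)) * (r / (1 - r))"
proof -
  have s: "summable (\<lambda>n. norm (taylor f (Suc n)) * r ^ Suc n)"
    using taylor_abs_summable[OF hol r] by (subst summable_Suc_iff)
  have g: "(\<lambda>n. 2 * (B - norm (f 0)) * (r * r ^ n)) sums (2 * (B - norm (f 0)) * (r * (1 / (1 - r))))"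
    using r by (intro sums_mult geometric_sums) auto
  have "(\<Sum>n. norm (taylor f (Suc n)) * r ^ Suc n) \<le> (\<Sum>n. 2 * (B - norm (f 0)) * (r * r ^ n))"
    using taylor_le_of_bounded[OF hol B] r
    by (intro suminf_le s sums_summable[OF g]) (auto intro!: mult_right_mono)
  then show ?thesis using sums_unique[OF g] by simp
qed

lemma majorant_split:
  assumes hol: "f holomorphic_on ball 0 R" and r: "0 \<le> r" "r < R"
  shows "majorant f r = norm (f 0) + (\<Sum>n. norm (taylor f (Suc n)) * r ^ Suc n)"
  unfolding majorant_def using suminf_split_head[OF taylor_abs_summable[OF hol r]]
  by (simp add: taylor_0)

lemma bohr:
  assumes hol: "f holomorphic_on ball 0 1" and B: "\<And>z. norm z < 1 \<Longrightarrow> norm (f z) \<le> B"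
    and r: "0 \<le> r" "r \<le> 1 / 3"
  shows "majorant f r \<le> B"
proof -
  have "majorant f r \<le> norm (f 0) + 2 * (B - norm (f 0)) * (r / (1 - r))"
    using majorant_split[OF hol r(1)] bohr_tail[OF hol B r(1)] r by simp
  \<comment> \<open>\<open>r / (1 - r) \<le> 1 / 2\<close> is exactly the condition
    \<open>r \<le> 1 / 3\<close>.\<close>
  also have "\<dots> \<le> norm (f 0) + 2 * (B - norm (f 0)) * (1 / 2)"
    using B[of 0] r by (intro add_left_mono mult_left_mono) (auto simp: field_simps)
  finally show ?thesis by (simp add: algebra_simps)
qed

section \<open>Majorants of compositions with Schwarz functions\<close>

lemma schwarz_factor:
  assumes hol: "u holomorphic_on ball 0 1" and u0: "u 0 = 0"
    and u1: "\<And>z. norm z < 1 \<Longrightarrow> norm (u z) < 1"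
  obtains v where "v holomorphic_on ball 0 1" "\<And>z. norm z < 1 \<Longrightarrow> u z = z * v z"
    "v 0 = deriv u 0" "\<And>z. norm z < 1 \<Longrightarrow> norm (v z) \<le> 1"
proof -
  obtain v where v: "v holomorphic_on ball 0 1" "\<And>z. norm z < 1 \<Longrightarrow> u z = z * v z" "deriv u 0 = v 0"
    by (rule Schwarz3[OF hol]) (use u0 in auto)
  have "norm (v z) \<le> 1" if "norm z < 1" for z
  proof (cases "z = 0")
    case True
    then show ?thesis using Schwarz_Lemma(2)[OF hol u0 u1 that] v by simp
  next
    case False
    have "norm z * norm (v z) \<le> norm z * 1"
      using Schwarz_Lemma(1)[OF hol u0 u1 that] v(2)[OF that] by (simp add: norm_mult)
    then show ?thesis using False by simp
  qed
  then show thesis using that v by metis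
qed

lemma majorant_cong:
  assumes "R > 0" "\<And>z. norm z < R \<Longrightarrow> f z = g z"
  shows "majorant f r = majorant g r"
  using taylor_cong[OF assms] by (simp add: majorant_def)

lemma majorant_nonneg:
  assumes "f holomorphic_on ball 0 R" "0 \<le> r" "r < R"
  shows "0 \<le> majorant f r"
  unfolding majorant_def using assms taylor_abs_summable[OF assms] by (intro suminf_nonneg) auto

lemma majorant_mult_left:
  assumes hol: "g holomorphic_on ball 0 R" and r: "0 \<le> r" "r < R"
  shows "majorant (\<lambda>z. z * g z) r = r * majorant g r"
proof -
  have R: "R > 0" using r by simp
  have hol': "(\<lambda>z. z * g z) holomorphic_on ball 0 R" by (intro holomorphic_intros hol)
  have "majorant (\<lambda>z. z * g z) r = (\<Sum>n. norm (taylor (\<lambda>z. z * g z) (Suc n)) * r ^ Suc n)"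
    using majorant_split[OF hol' r] by simp
  also have "\<dots> = (\<Sum>n. r * (norm (taylor g n) * r ^ n))"
    by (simp add: taylor_mult_left[OF hol R] mult_ac)
  also have "\<dots> = r * majorant g r"
    unfolding majorant_def by (rule suminf_mult[OF taylor_abs_summable[OF hol r]])
  finally show ?thesis .
qed

lemma majorant_power_mult_left:
  assumes hol: "g holomorphic_on ball 0 R" and r: "0 \<le> r" "r < R"
  shows "majorant (\<lambda>z. z ^ i * g z) r = r ^ i * majorant g r"
proof (induction i)
  case (Suc i)
  have "majorant (\<lambda>z. z * (z ^ i * g z)) r = r * majorant (\<lambda>z. z ^ i * g z) r"
    by (rule majorant_mult_left) (auto intro!: holomorphic_intros hol r)
  then show ?case using Suc by (simp add: mult_ac)
qed simp

text \<open>Writing \<open>u = z * v\<close> by the Schwarz lemma, the factor z^j contributes r^j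
  and Bohr's inequality bounds the majorant of v^j by 1.\<close>

lemma majorant_schwarz_power:
  assumes hol: "u holomorphic_on ball 0 1" and u0: "u 0 = 0"
    and u1: "\<And>z. norm z < 1 \<Longrightarrow> norm (u z) < 1" and r: "0 \<le> r" "r \<le> 1 / 3"
  shows "majorant (\<lambda>z. u z ^ j) r \<le> r ^ j"
proof -
  obtain v where v: "v holomorphic_on ball 0 1" "\<And>z. norm z < 1 \<Longrightarrow> u z = z * v z"
    "\<And>z. norm z < 1 \<Longrightarrow> norm (v z) \<le> 1"
    using schwarz_factor[OF hol u0 u1] by metis
  have "majorant (\<lambda>z. u z ^ j) r = majorant (\<lambda>z. z ^ j * v z ^ j) r"
    by (rule majorant_cong[of 1]) (use v in \<open>auto simp: power_mult_distrib\<close>)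
  also have "\<dots> = r ^ j * majorant (\<lambda>z. v z ^ j) r"
    by (rule majorant_power_mult_left[of _ 1]) (use r v(1) in \<open>auto intro!: holomorphic_intros\<close>)
  also have "\<dots> \<le> r ^ j * 1"
    using r v by (intro mult_left_mono bohr) (auto intro!: holomorphic_intros simp: norm_power power_le_one)
  finally show ?thesis by simp
qed

lemma holomorphic_on_compose_disc:
  assumes "F holomorphic_on ball 0 1" "u holomorphic_on ball 0 1" "\<And>z. norm z < 1 \<Longrightarrow> norm (u z) < 1"
  shows "(\<lambda>z. F (u z)) holomorphic_on ball 0 1"
  using holomorphic_on_compose_gen[OF assms(2,1)] assms(3) by (force simp: o_def image_subset_iff)

text \<open>Expand \<open>F (u z)\<close> in powers of \<open>u\<close>: the j-th power has majorant
  at most r^j, as if \<open>u\<close> were the identity. Only finite square double sums over n, j <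
  N are interchanged, so no rearrangement of infinite series is needed.\<close>

lemma majorant_compose:
  assumes F: "F holomorphic_on ball 0 1" and hol: "u holomorphic_on ball 0 1" and u0: "u 0 = 0"
    and u1: "\<And>z. norm z < 1 \<Longrightarrow> norm (u z) < 1" and r: "0 \<le> r" "r \<le> 1 / 3"
  shows "majorant (\<lambda>z. F (u z)) r \<le> majorant F r"
proof -
  have Fu: "(\<lambda>z. F (u z)) holomorphic_on ball 0 1"
    by (rule holomorphic_on_compose_disc[OF F hol u1])
  define U where "U = (\<lambda>j n. norm (taylor (\<lambda>z. u z ^ j) n))"
  have U: "(\<Sum>n<N. U j n * r ^ n) \<le> r ^ j" for j N
  proof -
    have "(\<lambda>z. u z ^ j) holomorphic_on ball 0 1" by (intro holomorphic_intros hol)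
    from taylor_abs_summable[OF this r(1)] r have "summable (\<lambda>n. U j n * r ^ n)" by (simp add: U_def)
    then have "(\<Sum>n<N. U j n * r ^ n) \<le> majorant (\<lambda>z. u z ^ j) r"
      unfolding majorant_def U_def using r by (intro sum_le_suminf) auto
    also have "\<dots> \<le> r ^ j" by (rule majorant_schwarz_power[OF hol u0 u1 r])
    finally show ?thesis .
  qed
  have sF: "summable (\<lambda>n. norm (taylor F n) * r ^ n)" using taylor_abs_summable[OF F r(1)] r by simp
  show ?thesis unfolding majorant_def[of "\<lambda>z. F (u z)"]
  proof (rule suminf_le_const)
    show "summable (\<lambda>n. norm (taylor (\<lambda>z. F (u z)) n) * r ^ n)"
      using taylor_abs_summable[OF Fu r(1)] r by simp
    fix N
    have "(\<Sum>n<N. norm (taylor (\<lambda>z. F (u z)) n) * r ^ n) \<le> (\<Sum>n<N. (\<Sum>j<N. norm (taylor F j) * U j n) * r ^ n)"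
    proof (intro sum_mono mult_right_mono)
      fix n assume "n \<in> {..<N}"
      have "norm (taylor (\<lambda>z. F (u z)) n) \<le> (\<Sum>j\<le>n. norm (taylor F j * taylor (\<lambda>z. u z ^ j) n))"
        unfolding taylor_compose[OF F zero_less_one hol zero_less_one u0] by (rule norm_sum)
      also have "\<dots> \<le> (\<Sum>j<N. norm (taylor F j) * U j n)"
        unfolding U_def norm_mult using \<open>n \<in> {..<N}\<close> by (intro sum_mono2) auto
      finally show "norm (taylor (\<lambda>z. F (u z)) n) \<le> (\<Sum>j<N. norm (taylor F j) * U j n)" .
    qed (use r in auto)
    also have "\<dots> = (\<Sum>n<N. \<Sum>j<N. norm (taylor F j) * (U j n * r ^ n))"
      by (simp add: sum_distrib_right mult.assoc)
    also have "\<dots> = (\<Sum>j<N. norm (taylor F j) * (\<Sum>n<N. U j n * r ^ n))"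
      by (subst sum.swap) (simp add: sum_distrib_left)
    also have "\<dots> \<le> (\<Sum>j<N. norm (taylor F j) * r ^ j)"
      by (intro sum_mono mult_left_mono U) auto
    also have "\<dots> \<le> majorant F r" unfolding majorant_def using r by (intro sum_le_suminf sF) auto
    finally show "(\<Sum>n<N. norm (taylor (\<lambda>z. F (u z)) n) * r ^ n) \<le> majorant F r" .
  qed
qed

text \<open>As for \<open>majorant_compose\<close>, but with the terms of index 0 and 1 removed on
  both sides. Powers j \<ge> 2 of \<open>u\<close> are matched with the tail of \<open>F\<close>.
  The linear term of \<open>F\<close> also feeds the tail, through the coefficients of
  \<open>u\<close> of index at least 2; with \<open>u = z * v\<close> these are controlled by
  \<open>bohr_tail\<close> and vanish when |u'(0)| = 1.\<close>

lemma majorant_compose_tail: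
  assumes F: "F holomorphic_on ball 0 1" and hol: "u holomorphic_on ball 0 1" and u0: "u 0 = 0"
    and u1: "\<And>z. norm z < 1 \<Longrightarrow> norm (u z) < 1" and r: "0 \<le> r" "r \<le> 1 / 3"
  shows "(\<Sum>n. norm (taylor (\<lambda>z. F (u z)) (n + 2)) * r ^ (n + 2)) \<le>
    norm (deriv F 0) * (2 * (1 - norm (deriv u 0)) * (r\<^sup>2 / (1 - r)))
      + (\<Sum>n. norm (taylor F (n + 2)) * r ^ (n + 2))"
proof -
  have Fu: "(\<lambda>z. F (u z)) holomorphic_on ball 0 1"
    by (rule holomorphic_on_compose_disc[OF F hol u1])
  obtain v where v: "v holomorphic_on ball 0 1" "\<And>z. norm z < 1 \<Longrightarrow> u z = z * v z" "v 0 = deriv u 0"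
    "\<And>z. norm z < 1 \<Longrightarrow> norm (v z) \<le> 1"
    by (rule schwarz_factor[OF hol u0 u1]) auto
  have uv: "taylor u (n + 2) = taylor v (Suc n)" for n
    using taylor_cong[of 1 u "\<lambda>z. z * v z"] v taylor_mult_left[OF v(1)] by simp
  define U where "U = (\<lambda>j n. norm (taylor (\<lambda>z. u z ^ j) n))"
  have sU: "summable (\<lambda>n. U j n * r ^ n)" for j
  proof -
    have "(\<lambda>z. u z ^ j) holomorphic_on ball 0 1" by (intro holomorphic_intros hol)
    from taylor_abs_summable[OF this r(1)] r show ?thesis by (simp add: U_def)
  qed
  have U: "(\<Sum>n<N. U j (n + 2) * r ^ (n + 2)) \<le> r ^ j" for j N
  proof -
    have "(\<Sum>n<N. U j (n + 2) * r ^ (n + 2)) \<le> (\<Sum>n. U j (n + 2) * r ^ (n + 2))"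
      using r summable_ignore_initial_segment[OF sU[of j], of 2]
      by (intro sum_le_suminf) (auto simp: U_def)
    also have "\<dots> = (\<Sum>n. U j n * r ^ n) - (\<Sum>n<2. U j n * r ^ n)"
      by (rule suminf_minus_initial_segment[OF sU])
    also have "\<dots> \<le> (\<Sum>n. U j n * r ^ n)" using r by (simp add: U_def sum_nonneg)
    also have "\<dots> = majorant (\<lambda>z. u z ^ j) r" by (simp add: majorant_def U_def)
    also have "\<dots> \<le> r ^ j" by (rule majorant_schwarz_power[OF hol u0 u1 r])
    finally show ?thesis .
  qed
  have sF: "summable (\<lambda>n. norm (taylor F (n + 2)) * r ^ (n + 2))"
    using taylor_abs_summable[OF F r(1)] r by (subst summable_iff_shift) auto
  show ?thesis
  proof (rule suminf_le_const)
    show "summable (\<lambda>n. norm (taylor (\<lambda>z. F (u z)) (n + 2)) * r ^ (n + 2))"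
      using taylor_abs_summable[OF Fu r(1)] r by (subst summable_iff_shift) auto
    fix N
    have c: "norm (taylor (\<lambda>z. F (u z)) (n + 2)) \<le>
        norm (deriv F 0) * U 1 (n + 2) + (\<Sum>j<N. norm (taylor F (j + 2)) * U (j + 2) (n + 2))"
      if "n < N" for n
    proof -
      have "norm (taylor (\<lambda>z. F (u z)) (n + 2)) \<le> (\<Sum>j\<le>n+2. norm (taylor F j * taylor (\<lambda>z. u z ^ j) (n+2)))"
        unfolding taylor_compose[OF F zero_less_one hol zero_less_one u0] by (rule norm_sum)
      also have "\<dots> = (\<Sum>j\<le>Suc (Suc n). norm (taylor F j) * U j (n + 2))"
        by (simp add: U_def norm_mult)
      also have "\<dots> = norm (taylor F 0) * U 0 (n + 2) + (norm (taylor F 1) * U 1 (n + 2)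
          + (\<Sum>j\<le>n. norm (taylor F (Suc (Suc j))) * U (Suc (Suc j)) (n + 2)))"
        by (subst sum.atMost_Suc_shift, subst sum.atMost_Suc_shift) simp
      also have "U 0 (n + 2) = 0"
        by (simp add: U_def fps_expansion_def higher_deriv_const)
      also have "(\<Sum>j\<le>n. norm (taylor F (Suc (Suc j))) * U (Suc (Suc j)) (n + 2)) \<le>
          (\<Sum>j<N. norm (taylor F (Suc (Suc j))) * U (Suc (Suc j)) (n + 2))"
        using that by (intro sum_mono2) (auto simp: U_def)
      finally show ?thesis using taylor_1[of F] by simp
    qed
    have "(\<Sum>n<N. norm (taylor (\<lambda>z. F (u z)) (n + 2)) * r ^ (n + 2)) \<le>
       (\<Sum>n<N. (norm (deriv F 0) * U 1 (n + 2) + (\<Sum>j<N. norm (taylor F (j + 2)) * U (j + 2) (n + 2))) * r ^ (n + 2))"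
      using r by (intro sum_mono mult_right_mono c) auto
    also have "\<dots> = norm (deriv F 0) * (\<Sum>n<N. U 1 (n + 2) * r ^ (n + 2)) +
        (\<Sum>n<N. \<Sum>j<N. norm (taylor F (j + 2)) * (U (j + 2) (n + 2) * r ^ (n + 2)))"
      by (simp add: distrib_right sum.distrib sum_distrib_left sum_distrib_right mult.assoc)
    also have "(\<Sum>n<N. \<Sum>j<N. norm (taylor F (j + 2)) * (U (j + 2) (n + 2) * r ^ (n + 2))) =
        (\<Sum>j<N. norm (taylor F (j + 2)) * (\<Sum>n<N. U (j + 2) (n + 2) * r ^ (n + 2)))"
      by (subst sum.swap) (simp add: sum_distrib_left)
    also have "\<dots> \<le> (\<Sum>j<N. norm (taylor F (j + 2)) * r ^ (j + 2))"
      by (intro sum_mono mult_left_mono U) auto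
    also have "\<dots> \<le> (\<Sum>n. norm (taylor F (n + 2)) * r ^ (n + 2))"
      using r by (intro sum_le_suminf sF) auto
    also have "(\<Sum>n<N. U 1 (n + 2) * r ^ (n + 2)) = r * (\<Sum>n<N. norm (taylor v (Suc n)) * r ^ Suc n)"
      using uv by (simp add: U_def sum_distrib_left mult_ac)
    also have "\<dots> \<le> r * (\<Sum>n. norm (taylor v (Suc n)) * r ^ Suc n)"
      using r summable_ignore_initial_segment[OF taylor_abs_summable[OF v(1) r(1)], of 1]
      by (intro mult_left_mono sum_le_suminf) auto
    also have "\<dots> \<le> r * (2 * (1 - norm (v 0)) * (r / (1 - r)))"
      using r by (intro mult_left_mono bohr_tail v) auto
    also have "r * (2 * (1 - norm (v 0)) * (r / (1 - r))) = 2 * (1 - norm (deriv u 0)) * (r\<^sup>2 / (1 - r))"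
      by (simp add: v(3) power2_eq_square)
    finally show "(\<Sum>n<N. norm (taylor (\<lambda>z. F (u z)) (n + 2)) * r ^ (n + 2)) \<le>
      norm (deriv F 0) * (2 * (1 - norm (deriv u 0)) * (r\<^sup>2 / (1 - r)))
      + (\<Sum>n. norm (taylor F (n + 2)) * r ^ (n + 2))"
      by (simp add: mult_left_mono)
  qed
qed

section \<open>Koebe's osculation algorithm\<close>

text \<open>A Blaschke product of degree two with \<open>|\<kappa>| = 1\<close> and \<open>0 < s < 1\<close>; complex \<open>s\<close> only enters through Taylor
  expansion in \<open>s\<close> at 1, where \<open>osc 1 \<kappa>\<close> is the identity.\<close>

definition osc :: "complex \<Rightarrow> complex \<Rightarrow> complex \<Rightarrow> complex" where
  "osc s \<kappa> z = z * ((s + \<kappa> * z) / (1 + s * \<kappa> * z))"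

text \<open>The head of the list acts first, so consing a factor precomposes with it; the energy
  induction needs this order. The osculation algorithm instead peels off the outermost factor,
  whence \<open>osc_chain_snoc\<close>.\<close>

primrec osc_chain :: "complex \<Rightarrow> complex list \<Rightarrow> complex \<Rightarrow> complex" where
  "osc_chain s [] z = z"
| "osc_chain s (\<kappa> # \<kappa>s) z = osc_chain s \<kappa>s (osc s \<kappa> z)"

lemma osc_chain_snoc: "osc_chain s (\<kappa>s @ [\<kappa>]) z = osc s \<kappa> (osc_chain s \<kappa>s z)"
  by (induction \<kappa>s arbitrary: z) auto

definition univalent_self_map :: "(complex \<Rightarrow> complex) \<Rightarrow> bool" where
  "univalent_self_map b \<longleftrightarrow> b holomorphic_on ball 0 1 \<and> inj_on b (ball 0 1) \<and> b 0 = 0 \<and>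
     (\<forall>z. norm z < 1 \<longrightarrow> norm (b z) < 1)"

text \<open>The hyperbolic translation by \<open>d\<close> carries \<open>u\<close> to
  \<open>q\<close> and \<open>q\<close> to the left-hand side. Applying it twice is the translation
  by the hyperbolic double 2 d / (1 + |d|^2).\<close>

lemma moebius_numerator_identity:
  fixes d q u :: complex
  assumes x: "d * cnj d = of_real x" "x < 1" "x \<ge> 0" and q: "1 - cnj d * q \<noteq> 0" "1 + cnj d * q \<noteq> 0"
    and u: "u = (q - d) / (1 - cnj d * q)"
  shows "(q + d) / (1 + cnj d * q) = (u + 2 * d / (1 + of_real x)) / (1 + 2 * cnj d / (1 + of_real x) * u)"
proof -
  have x1: "(1 + of_real x :: complex) \<noteq> 0" "(1 - of_real x :: complex) \<noteq> 0"
    using x of_real_eq_iff[of x 1, where 'a=complex] of_real_eq_iff[of x "-1", where 'a=complex]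
    by (auto simp: add_eq_0_iff)
  define D where "D = (1 + of_real x) * (1 - cnj d * q)"
  have D: "D \<noteq> 0" using x1 q by (simp add: D_def)
  have 1: "u + 2 * d / (1 + of_real x) = ((1 + of_real x) * (q - d) + 2 * d * (1 - cnj d * q)) / D"
    unfolding u D_def using x1(1) q(1) by (simp add: add_frac_eq mult_ac)
  have 2: "1 + 2 * cnj d / (1 + of_real x) * u = (D + 2 * cnj d * (q - d)) / D"
    unfolding u D_def using x1(1) q(1) by (simp add: add_divide_distrib)
  have 3: "(1 + of_real x) * (q - d) + 2 * d * (1 - cnj d * q) = (1 - of_real x) * (q + d)"
    unfolding x(1)[symmetric] by algebra
  have 4: "D + 2 * cnj d * (q - d) = (1 - of_real x) * (1 + cnj d * q)"
    unfolding D_def x(1)[symmetric] by algebra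
  show ?thesis unfolding 1 2 3 4 using D x1 by simp
qed

lemma one_plus_nonzero: "norm (w::complex) < 1 \<Longrightarrow> 1 + w \<noteq> 0" "norm (w::complex) < 1 \<Longrightarrow> 1 - w \<noteq> 0"
  by (auto simp: add_eq_0_iff)

lemma norm_mult_lt_1: "norm (a::complex) < 1 \<Longrightarrow> norm b < 1 \<Longrightarrow> norm (a * b) < 1"
  by (metis mult_strict_mono' norm_ge_zero norm_mult mult_1)

text \<open>Koebe's square root step. A Moebius map moves the omitted value to 0, a holomorphic
  square root \<open>q\<close> is taken, and a second Moebius map returns q(0) = \<open>d\<close> to
  0. Undoing this expresses \<open>b\<close> as a Blaschke product of degree two in the new map with
  a zero at 0; the other zero has modulus \<open>s\<close> because |d|^2 = x.\<close>

lemma osc_factor: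
  assumes b: "univalent_self_map b" and c: "c \<notin> b ` ball 0 1" "norm c = x" and x: "0 < x" "x < 1"
    and s: "s = 2 * sqrt x / (1 + x)"
  obtains \<kappa> b1 where "norm \<kappa> = 1" "univalent_self_map b1" "\<And>z. norm z < 1 \<Longrightarrow> b z = osc s \<kappa> (b1 z)"
proof -
  have b: "b holomorphic_on ball 0 1" "inj_on b (ball 0 1)" "b 0 = 0" "\<And>z. norm z < 1 \<Longrightarrow> norm (b z) < 1"
    using b by (auto simp: univalent_self_map_def)
  have c1: "norm c < 1" using c x by simp
  define g where "g = (\<lambda>z. Moebius_function 0 c (b z))"
  have g: "g holomorphic_on ball 0 1" unfolding g_def
    by (rule holomorphic_on_compose_disc[OF Moebius_function_holomorphic[OF c1] b(1) b(4)])
  have g0: "g z \<noteq> 0" if "z \<in> ball 0 1" for z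
    using that c1 b(4)[of z] c(1) one_plus_nonzero(2)[OF norm_mult_lt_1[of "cnj c" "b z"]]
    by (auto simp: g_def Moebius_function_simple)
  have "simply_connected (ball (0::complex) 1)" by (simp add: convex_imp_simply_connected)
  then obtain q where q: "q holomorphic_on ball 0 1" "\<And>z. z \<in> ball 0 1 \<Longrightarrow> g z = (q z)\<^sup>2"
    using g g0 simply_connected_eq_holomorphic_sqrt[of "ball (0::complex) 1"] by auto
  have g1: "norm (g z) < 1" if "norm z < 1" for z
    unfolding g_def using that c1 b(4) by (intro Moebius_function_norm_lt_1)
  have q1: "norm (q z) < 1" if "norm z < 1" for z
    using g1[OF that] q(2)[of z] that by (simp add: norm_power power_less_one_iff)
  define d where "d = q 0"
  have d2: "d\<^sup>2 = - c" using q(2)[of 0] b(3) by (simp add: d_def g_def Moebius_function_simple)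
  have d1: "norm d < 1" using q1[of 0] by (simp add: d_def)
  have dx: "(norm d)\<^sup>2 = x" using d2 c(2) by (metis norm_minus_cancel norm_power)
  then have dx': "norm d = sqrt x" by (metis norm_ge_zero real_sqrt_abs abs_of_nonneg)
  define u where "u = (\<lambda>z. Moebius_function 0 d (q z))"
  have u: "u holomorphic_on ball 0 1" unfolding u_def
    by (rule holomorphic_on_compose_disc[OF Moebius_function_holomorphic[OF d1] q(1) q1])
  have u1: "norm (u z) < 1" if "norm z < 1" for z
    unfolding u_def using that d1 q1 by (intro Moebius_function_norm_lt_1)
  define \<sigma> where "\<sigma> = 2 * d / (1 + of_real x)"
  \<comment> \<open>The rotation by \<open>e\<close> makes the second Blaschke factor take the
    positive value \<open>s\<close> at 0; the remaining phase goes into \<kappa>, which is the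
    square of \<open>cnj e\<close>.\<close>
  define e where "e = \<sigma> / of_real s"
  have x1: "(1 + of_real x :: complex) \<noteq> 0" 
    using x of_real_eq_iff[of x "-1", where 'a=complex] by (auto simp: add_eq_0_iff)
  have s0: "s > 0" using x s by simp
  have "norm (1 + of_real x :: complex) = 1 + x"
    using x by (metis abs_of_pos add_pos_pos norm_of_real of_real_1 of_real_add zero_less_one)
  then have \<sigma>s: "norm \<sigma> = s" using s dx' by (simp add: \<sigma>_def norm_divide norm_mult)
  have e1: "norm e = 1" using \<sigma>s s0 by (simp add: e_def norm_divide)
  then have ee: "e * cnj e = 1" by (simp add: complex_norm_square[symmetric])
  have ee': "e * (cnj e * w) = w" for w using ee by (simp flip: mult.assoc)
  have \<sigma>e: "\<sigma> = of_real s * e" using s0 by (simp add: e_def)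
  have c\<sigma>: "cnj \<sigma> = 2 * cnj d / (1 + of_real x)" by (simp add: \<sigma>_def)
  have eq: "b z = osc s ((cnj e)\<^sup>2) (e * u z)" if z: "norm z < 1" for z
  proof -
    have n: "norm (cnj d * q z) < 1" using d1 q1[OF z] by (intro norm_mult_lt_1) auto
    have nz: "1 - cnj d * q z \<noteq> 0" "1 + cnj d * q z \<noteq> 0"
      using one_plus_nonzero[OF n] by auto
    have "b z = Moebius_function 0 (- c) (g z)"
      unfolding g_def using Moebius_function_compose[of "-c" c "b z"] c1 b(4)[OF z] by simp
    also have "\<dots> = ((q z)\<^sup>2 - d\<^sup>2) / (1 - (cnj d)\<^sup>2 * (q z)\<^sup>2)"
      using q(2)[of z] z d2 by (simp add: Moebius_function_simple flip: complex_cnj_power)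
    also have "\<dots> = ((q z - d) * (q z + d)) / ((1 - cnj d * q z) * (1 + cnj d * q z))"
      by (simp add: power2_eq_square algebra_simps)
    also have "\<dots> = u z * ((q z + d) / (1 + cnj d * q z))"
      by (simp add: u_def Moebius_function_simple)
    also have "(q z + d) / (1 + cnj d * q z) = (u z + \<sigma>) / (1 + cnj \<sigma> * u z)"
      unfolding \<sigma>_def c\<sigma>[unfolded \<sigma>_def]
      using dx x nz by (intro moebius_numerator_identity)
         (auto simp: u_def Moebius_function_simple complex_norm_square[symmetric])
    also have "u z * \<dots> = (e * u z) * (cnj e * (u z + \<sigma>) / (1 + cnj \<sigma> * u z))"
      by (simp add: mult_ac ee')
    also have "cnj e * (u z + \<sigma>) = of_real s + (cnj e)\<^sup>2 * (e * u z)"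
      unfolding \<sigma>e by (simp add: power2_eq_square algebra_simps ee')
    also have "cnj \<sigma> * u z = of_real s * (cnj e)\<^sup>2 * (e * u z)"
      unfolding \<sigma>e by (simp add: power2_eq_square algebra_simps ee')
    finally show ?thesis by (simp add: osc_def)
  qed
  show thesis
  proof
    show "norm ((cnj e)\<^sup>2) = 1" using e1 by (simp add: norm_power)
    show "univalent_self_map (\<lambda>z. e * u z)"
      unfolding univalent_self_map_def
    proof (intro conjI allI impI)
      show "inj_on (\<lambda>z. e * u z) (ball 0 1)"
      proof (rule inj_onI)
        fix z w assume zw: "z \<in> ball 0 1" "w \<in> ball 0 1" "e * u z = e * u w"
        \<comment> \<open>Injectivity need not be followed through the square root: \<open>b\<close>
          is a function of \<open>e * u\<close>.\<close>
        then have "b z = b w" using eq[of z] eq[of w] by (simp only: mem_ball_0)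
        then show "z = w" using b(2) zw by (auto dest: inj_onD)
      qed
    qed (use u u1 e1 in \<open>auto intro!: holomorphic_intros simp: norm_mult u_def d_def Moebius_function_eq_zero\<close>)
  qed (use eq in auto)
qed

lemma univalent_image_simply_connected:
  assumes "b holomorphic_on ball 0 1" "inj_on b (ball 0 1)"
  shows "open (b ` ball 0 1)" "simply_connected (b ` ball 0 1)"
proof -
  show op: "open (b ` ball 0 1)" using assms by (intro open_mapping_thm3) auto
  obtain g where g: "g holomorphic_on (b ` ball 0 1)" "\<And>z. z \<in> ball 0 1 \<Longrightarrow> g (b z) = z"
    using holomorphic_has_inverse[OF assms(1) open_ball assms(2)] by metis
  have "homeomorphism (ball 0 1) (b ` ball 0 1) b g"
    using assms(1) g by (intro homeomorphismI holomorphic_on_imp_continuous_on) auto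
  then have "ball (0::complex) 1 homeomorphic (b ` ball 0 1)" unfolding homeomorphic_def by blast
  then show "simply_connected (b ` ball 0 1)"
    using homeomorphic_simply_connected_eq convex_imp_simply_connected[of "ball (0::complex) 1"] by auto
qed

text \<open>This makes all steps of the osculation algorithm equally small: the omitted value can be chosen on a given circle.\<close>

lemma omitted_on_circle:
  assumes b: "univalent_self_map b" and c: "c \<notin> b ` ball 0 1" "norm c \<le> x" and x: "0 < x"
  shows "\<exists>c'. c' \<notin> b ` ball 0 1 \<and> norm c' = x"
proof (rule ccontr)
  assume no: "\<not> ?thesis"
  then have "sphere 0 x \<subseteq> b ` ball 0 1" by auto
  then have "inside (sphere 0 x) \<subseteq> b ` ball 0 1"
    using univalent_image_simply_connected[of b] b
    by (intro subset_simply_connected_imp_inside_subset) (auto simp: univalent_self_map_def)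
  moreover have "inside (sphere (0::complex) x) = ball 0 x"
    using inside_frontier_eq_interior[of "cball (0::complex) x"] x by simp
  moreover have "c \<in> ball 0 x" using c no by (cases "norm c = x") auto
  ultimately show False using c(1) by blast
qed

text \<open>The Schwarz lemma for the inverse map on the disc of radius \<open>x\<close>. It says
  what is known about the map at which the osculation algorithm stops.\<close>

lemma deriv_ge_of_covering:
  assumes b: "univalent_self_map b" and sub: "ball 0 x \<subseteq> b ` ball 0 1" and x: "0 < x"
  shows "x \<le> norm (deriv b 0)"
proof -
  have b: "b holomorphic_on ball 0 1" "inj_on b (ball 0 1)" "b 0 = 0"
    using b by (auto simp: univalent_self_map_def)
  obtain g where g: "g holomorphic_on (b ` ball 0 1)" "\<And>z. z \<in> ball 0 1 \<Longrightarrow> g (b z) = z"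
    "\<And>z. z \<in> ball 0 1 \<Longrightarrow> deriv b z * deriv g (b z) = 1"
    using holomorphic_has_inverse[OF b(1) open_ball b(2)] by metis
  have m: "of_real x * w \<in> b ` ball 0 1" if "norm w < 1" for w
    using that x by (intro subsetD[OF sub]) (auto simp: norm_mult)
  have "norm (deriv (\<lambda>w. g (of_real x * w)) 0) \<le> 1"
  proof (rule Schwarz_Lemma(2)[of _ 0])
    have "(g \<circ> (\<lambda>w. of_real x * w)) holomorphic_on ball 0 1"
      by (rule holomorphic_on_compose_gen[OF _ g(1)]) (use m in \<open>auto intro!: holomorphic_intros\<close>)
    then show "(\<lambda>w. g (of_real x * w)) holomorphic_on ball 0 1" by (simp add: o_def)
    show "g (of_real x * 0) = 0" using g(2)[of 0] b(3) by simp
    fix w :: complex assume "norm w < 1"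
    from m[OF this] g(2) show "norm (g (of_real x * w)) < 1" by auto
  qed simp
  moreover have "((\<lambda>w. g (of_real x * w)) has_field_derivative deriv g 0 * of_real x) (at 0)"
  proof -
    have "(g has_field_derivative deriv g 0) (at (of_real x * 0))"
      using holomorphic_derivI[OF g(1) univalent_image_simply_connected(1)[OF b(1,2)] m[of 0]] by simp
    from DERIV_chain2[where g = "\<lambda>w. of_real x * w", OF this]
    show ?thesis by (auto intro!: derivative_eq_intros)
  qed
  then have "deriv (\<lambda>w. g (of_real x * w)) 0 = deriv g 0 * of_real x" by (rule DERIV_imp_deriv)
  ultimately have "norm (deriv g 0) * x \<le> 1" using x by (simp add: norm_mult)
  moreover have "norm (deriv b 0) * norm (deriv g 0) = 1"
    using g(3)[of 0] b(3) by (metis centre_in_ball norm_mult norm_one zero_less_one)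
  ultimately show ?thesis
    by (smt (verit) mult.commute mult_left_mono norm_ge_zero mult_cancel_left1 mult_le_cancel_right zero_less_mult_iff)
qed

lemma deriv_osc_compose:
  assumes "u holomorphic_on ball 0 1" "u 0 = 0" "\<And>z. norm z < 1 \<Longrightarrow> b z = osc s \<kappa> (u z)"
  shows "deriv b 0 = s * deriv u 0"
proof -
  have "(u has_field_derivative deriv u 0) (at 0)"
    using holomorphic_derivI[OF assms(1)] by simp
  then have "((\<lambda>z. osc s \<kappa> (u z)) has_field_derivative s * deriv u 0) (at 0)"
    unfolding osc_def using assms(2) by (auto intro!: derivative_eq_intros)
  moreover have "eventually (\<lambda>z. b z = osc s \<kappa> (u z)) (nhds 0)"
    using eventually_nhds_in_open[of "ball 0 1" 0] assms(3) by (auto elim!: eventually_mono)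
  ultimately show ?thesis
    using DERIV_cong_ev[OF refl _ refl, of b "\<lambda>z. osc s \<kappa> (u z)" 0] DERIV_imp_deriv by blast
qed

text \<open>Each extracted factor divides the derivative at 0 by \<open>s\<close>, while the Schwarz
  lemma keeps its modulus at most 1. Hence at most \<open>N\<close> extractions are possible, and
  the base case is contradictory. The algorithm stops as soon as the image contains the disc of
  radius \<open>x\<close>.\<close>

lemma osc_chain_factorization:
  assumes x: "0 < x" "x < 1" and s: "s = 2 * sqrt x / (1 + x)"
  shows "univalent_self_map b \<Longrightarrow> s ^ N < norm (deriv b 0) \<Longrightarrow>
    \<exists>\<kappa>s u. (\<forall>\<kappa>\<in>set \<kappa>s. norm \<kappa> = 1) \<and> univalent_self_map u \<and> x \<le> norm (deriv u 0) \<and>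
      norm (deriv b 0) = s ^ length \<kappa>s * norm (deriv u 0) \<and>
      (\<forall>z. norm z < 1 \<longrightarrow> b z = osc_chain s \<kappa>s (u z))"
proof (induction N arbitrary: b)
  case 0
  then show ?case using Schwarz_Lemma(2)[of b 0] by (auto simp: univalent_self_map_def)
next
  case (Suc N)
  have s0: "s > 0" using x s by simp
  show ?case
  proof (cases "\<exists>c. c \<notin> b ` ball 0 1 \<and> norm c \<le> x")
    case False
    then have "ball 0 x \<subseteq> b ` ball 0 1" by fastforce
    from deriv_ge_of_covering[OF Suc.prems(1) this x(1)] Suc.prems(1) show ?thesis
      by (intro exI[of _ "[]"] exI[of _ b]) auto
  next
    case True
    then obtain c where "c \<notin> b ` ball 0 1" "norm c = x"
      using omitted_on_circle[OF Suc.prems(1) _ _ x(1)] by auto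
    then obtain \<kappa> b1 where b1: "norm \<kappa> = 1" "univalent_self_map b1" "\<And>z. norm z < 1 \<Longrightarrow> b z = osc s \<kappa> (b1 z)"
      using osc_factor[OF Suc.prems(1) _ _ x s] by metis
    have d: "deriv b 0 = s * deriv b1 0"
      using b1 by (intro deriv_osc_compose[of _ _ _ \<kappa>]) (auto simp: univalent_self_map_def)
    have "s * s ^ N < s * norm (deriv b1 0)" using Suc.prems(2) s0 by (simp add: d norm_mult)
    then have "s ^ N < norm (deriv b1 0)" using s0 by simp
    from Suc.IH[OF b1(2) this] obtain \<kappa>s u where u: "\<forall>\<kappa>\<in>set \<kappa>s. norm \<kappa> = 1" "univalent_self_map u"
      "x \<le> norm (deriv u 0)" "norm (deriv b1 0) = s ^ length \<kappa>s * norm (deriv u 0)"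
      "\<forall>z. norm z < 1 \<longrightarrow> b1 z = osc_chain s \<kappa>s (u z)" by blast
    show ?thesis
      by (intro exI[of _ "\<kappa>s @ [\<kappa>]"] exI[of _ u])
         (use u b1 s0 in \<open>auto simp: osc_chain_snoc d norm_mult\<close>)
  qed
qed

section \<open>The logarithm of an osculation chain\<close>

text \<open>Defined over any field because it serves both as a real majorant and as the complex
  extremal map.\<close>

definition koebe :: "'a::field \<Rightarrow> 'a" where
  "koebe x = x / (1 - x)\<^sup>2"

section \<open>Size and contraction of a single osculation map\<close>

lemma koebe_mono:
  assumes "0 \<le> x" "x \<le> y" "y < (1::real)"
  shows "koebe x \<le> koebe y"
  unfolding koebe_def using assms by (intro frac_le power_mono) auto

lemma le_koebe:
  assumes "0 \<le> x" "x < (1::real)"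
  shows "x \<le> koebe x"
proof -
  have "(1 - x)\<^sup>2 \<le> 1" using assms by (simp add: power_le_one)
  then have "x * (1 - x)\<^sup>2 \<le> x * 1" using assms by (intro mult_left_mono) auto
  then show ?thesis using assms by (simp add: koebe_def field_simps)
qed

lemma norm_blaschke_le:
  fixes s :: real and w :: complex
  assumes s: "0 \<le> s" "s \<le> 1" and w: "norm w < 1"
  shows "norm ((of_real s + w) / (1 + of_real s * w)) \<le> (s + norm w) / (1 + s * norm w)"
proof -
  define x where "x = norm w"
  have x: "0 \<le> x" "x < 1" using w by (auto simp: x_def)
  have xx: "x\<^sup>2 = (Re w)\<^sup>2 + (Im w)\<^sup>2" by (simp add: x_def cmod_power2)
  have Re: "Re w \<le> x" by (simp add: x_def complex_Re_le_cmod)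
  have "s * x \<le> 1 * x" using s x by (intro mult_right_mono) auto
  then have sx: "s * x < 1" using x by simp
  then have n: "norm (of_real s * w) < 1" using s by (simp add: norm_mult x_def)
  have A: "norm (of_real s + w) ^ 2 = s\<^sup>2 + 2 * s * Re w + x\<^sup>2"
    unfolding xx cmod_power2 by (simp add: power2_eq_square algebra_simps)
  have B: "norm (1 + of_real s * w) ^ 2 = 1 + 2 * s * Re w + s\<^sup>2 * x\<^sup>2"
    unfolding xx cmod_power2 by (simp add: power2_eq_square algebra_simps)
  have "(1 - s) * (1 - x) \<ge> 0" using s x by simp
  then have "s + x \<le> 1 + s * x" by (simp add: algebra_simps)
  then have "(s + x)\<^sup>2 \<le> (1 + s * x)\<^sup>2" using s x by (intro power_mono) auto
  \<comment> \<open>After clearing denominators and squaring, the difference of the two sides is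
    this product: the quotient is largest where \<open>Re w\<close> equals
    \<open>norm w\<close>.\<close>
  then have "0 \<le> (2 * s * (x - Re w)) * ((1 + s * x)\<^sup>2 - (s + x)\<^sup>2)"
    using s Re by (intro mult_nonneg_nonneg) auto
  also have "\<dots> = (s + x)\<^sup>2 * (1 + 2 * s * Re w + s\<^sup>2 * x\<^sup>2) - (s\<^sup>2 + 2 * s * Re w + x\<^sup>2) * (1 + s * x)\<^sup>2"
    by (simp add: power2_eq_square algebra_simps)
  finally have "(norm (of_real s + w) * (1 + s * x))\<^sup>2 \<le> ((s + x) * norm (1 + of_real s * w))\<^sup>2"
    by (simp add: power_mult_distrib A B)
  then have "norm (of_real s + w) * (1 + s * x) \<le> (s + x) * norm (1 + of_real s * w)"
    by (rule power2_le_imp_le) (use s x in auto)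
  moreover have "0 < norm (1 + of_real s * w)" using one_plus_nonzero(1)[OF n] by simp
  moreover have "0 < 1 + s * x" using s x by (intro add_pos_nonneg) auto
  ultimately show ?thesis by (simp add: norm_divide field_simps flip: x_def)
qed

lemma norm_osc_le:
  fixes s :: real
  assumes s: "0 \<le> s" "s < 1" and \<kappa>: "norm \<kappa> = 1" and z: "norm z < 1"
  defines "x \<equiv> norm z"
  shows "norm (osc s \<kappa> z) \<le> x * ((s + x) / (1 + s * x))"
  unfolding osc_def norm_mult x_def
  using norm_blaschke_le[of s "\<kappa> * z"] assms
  by (intro mult_left_mono) (auto simp: norm_mult mult.assoc)

lemma blaschke_real_le_1:
  fixes s x :: real
  assumes "0 \<le> s" "s < 1" "0 \<le> x" "x < 1"
  shows "(s + x) / (1 + s * x) \<le> 1"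
proof -
  have "0 \<le> (1 - s) * (1 - x)" using assms by simp
  moreover have "0 < 1 + s * x" using assms by (intro add_pos_nonneg) auto
  ultimately show ?thesis by (simp add: algebra_simps)
qed

lemma norm_osc_le_self:
  fixes s :: real
  assumes s: "0 \<le> s" "s < 1" and \<kappa>: "norm \<kappa> = 1" and z: "norm z < 1"
  shows "norm (osc s \<kappa> z) \<le> norm z"
proof -
  have "norm z * ((s + norm z) / (1 + s * norm z)) \<le> norm z * 1"
    using blaschke_real_le_1[of s "norm z"] assms by (intro mult_left_mono) auto
  then show ?thesis using norm_osc_le[OF assms] by simp
qed

text \<open>For positive \<open>\<kappa> * z\<close> the Koebe function of the image is exactly that
  of |z| times (s + x) (1 + s x) / (1 + x)^2. With \<open>s = 1 - \<delta>\<close> it shrinks by a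
  factor 1 - \<delta> up to second order, so it decays geometrically along an orbit.\<close>

lemma koebe_osc_le:
  fixes s :: real
  assumes s: "0 \<le> s" "s < 1" and \<kappa>: "norm \<kappa> = 1" and z: "norm z < 1"
  shows "koebe (norm (osc s \<kappa> z)) \<le> (s + (1 - s)\<^sup>2 / 4) * koebe (norm z)"
proof -
  define x where "x = norm z"
  define y where "y = x * ((s + x) / (1 + s * x))"
  have x: "0 \<le> x" "x < 1" using z by (auto simp: x_def)
  have d: "0 < 1 + s * x" using s x by (intro add_pos_nonneg) auto
  have "y \<le> x * 1" unfolding y_def using x s blaschke_real_le_1[of s x] by (intro mult_left_mono) auto
  then have y: "y < 1" using x by simp
  have "koebe (norm (osc s \<kappa> z)) \<le> koebe y"
    using norm_osc_le[OF assms] y by (intro koebe_mono) (auto simp: y_def x_def)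
  also have "koebe y = koebe x * ((s + x) * (1 + s * x) / (1 + x)\<^sup>2)"
  proof -
    have "1 - y = (1 - x) * (1 + x) / (1 + s * x)"
      unfolding y_def using d by (simp add: field_simps)
    then show ?thesis unfolding koebe_def y_def using d x
      by (simp add: power_divide power_mult_distrib divide_simps) (simp add: power2_eq_square mult_ac)
  qed
  also have "(s + x) * (1 + s * x) = s * (1 + x)\<^sup>2 + (1 - s)\<^sup>2 * x"
    by (simp add: power2_eq_square algebra_simps)
  also have "(s * (1 + x)\<^sup>2 + (1 - s)\<^sup>2 * x) / (1 + x)\<^sup>2 = s + (1 - s)\<^sup>2 * (x / (1 + x)\<^sup>2)"
    using x by (simp add: add_divide_distrib)
  also have "x / (1 + x)\<^sup>2 \<le> 1 / 4"
  proof -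
    have "0 \<le> (1 - x)\<^sup>2" by simp
    then have "4 * x \<le> (1 + x)\<^sup>2" by (simp add: power2_eq_square algebra_simps)
    then show ?thesis using x by (simp add: field_simps)
  qed
  finally show ?thesis using x s koebe_mono[of 0 x]
    by (simp add: x_def mult_ac mult_left_mono koebe_def[of 0])
qed

text \<open>Complex \<open>s\<close> near 1 is allowed because the dependence on \<open>s\<close> is
  later expanded at \<open>s = 1\<close> with Cauchy estimates on a disc of radius 1/10. The factor
  \<open>norm z\<close> in the last bound makes the logarithms summable along an orbit.\<close>

lemma osc_bounds:
  fixes s \<kappa> z :: complex
  assumes \<kappa>: "norm \<kappa> = 1" and z: "norm z \<le> 1 / 2" and s: "norm (s - 1) \<le> 1 / 10"
  shows "s \<noteq> 0" "9 / 20 \<le> norm (1 + s * \<kappa> * z)"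
    "norm ((s + \<kappa> * z) / (1 + s * \<kappa> * z) - 1) \<le> 4 * norm (s - 1)"
    "norm ((s + \<kappa> * z) / (s * (1 + s * \<kappa> * z)) - 1) \<le> 11 / 2 * norm (s - 1) * norm z"
proof -
  have s1: "9 / 10 \<le> norm s" "norm s \<le> 11 / 10"
    using s norm_triangle_ineq2[of 1 s] norm_triangle_ineq2[of s 1] by (auto simp: norm_minus_commute)
  then show s0: "s \<noteq> 0" by auto
  have n: "norm (s * \<kappa> * z) \<le> 11 / 10 * (1 / 2)"
    unfolding norm_mult \<kappa> using s1 z by (intro mult_mono) auto
  have "1 - norm (s * \<kappa> * z) \<le> norm (1 + s * \<kappa> * z)"
    using norm_triangle_ineq2[of 1 "- (s * \<kappa> * z)"] by simp
  then show D: "9 / 20 \<le> norm (1 + s * \<kappa> * z)" using n by simp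
  then have D0: "1 + s * \<kappa> * z \<noteq> 0" by auto
  have "(s + \<kappa> * z) / (1 + s * \<kappa> * z) - 1 = (s - 1) * (1 - \<kappa> * z) / (1 + s * \<kappa> * z)"
    using D0 by (simp add: field_simps)
  also have "norm \<dots> = norm (s - 1) * (norm (1 - \<kappa> * z) / norm (1 + s * \<kappa> * z))"
    by (simp add: norm_mult norm_divide)
  also have "\<dots> \<le> norm (s - 1) * ((3 / 2) / (9 / 20))"
    using D norm_triangle_ineq4[of 1 "\<kappa> * z"] \<kappa> z
    by (intro mult_left_mono frac_le) (auto simp: norm_mult)
  also have "\<dots> \<le> norm (s - 1) * 4" by (intro mult_left_mono) auto
  finally show "norm ((s + \<kappa> * z) / (1 + s * \<kappa> * z) - 1) \<le> 4 * norm (s - 1)" by simp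
  have "(s + \<kappa> * z) - s * (1 + s * \<kappa> * z) = \<kappa> * z * (1 - s) * (1 + s)"
    by (simp add: algebra_simps)
  then have "(s + \<kappa> * z) / (s * (1 + s * \<kappa> * z)) - 1 = \<kappa> * z * (1 - s) * (1 + s) / (s * (1 + s * \<kappa> * z))"
    using D0 s0 by (metis diff_divide_distrib divide_self mult_eq_0_iff)
  also have "norm \<dots> = (norm (s - 1) * norm z) * (norm (1 + s) / (norm s * norm (1 + s * \<kappa> * z)))"
    by (simp add: norm_mult norm_divide \<kappa> norm_minus_commute)
  also have "\<dots> \<le> (norm (s - 1) * norm z) * ((21 / 10) / ((9 / 10) * (9 / 20)))"
    using D s1 norm_triangle_ineq[of 1 s]
    by (intro mult_left_mono frac_le mult_mono) auto
  also have "\<dots> \<le> (norm (s - 1) * norm z) * (11 / 2)" by (intro mult_left_mono) auto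
  finally show "norm ((s + \<kappa> * z) / (s * (1 + s * \<kappa> * z)) - 1) \<le> 11 / 2 * norm (s - 1) * norm z"
    by (simp add: mult_ac)
qed

text \<open>The logarithm of \<open>osc s \<kappa> z / (s * z)\<close>; dividing by the linear term
  makes it vanish at 0.\<close>

abbreviation osc_log :: "complex \<Rightarrow> complex \<Rightarrow> complex \<Rightarrow> complex" where
  "osc_log s \<kappa> z \<equiv> Ln ((s + \<kappa> * z) / (s * (1 + s * \<kappa> * z)))"

lemma osc_log_bounds:
  fixes s \<kappa> z :: complex
  assumes \<kappa>: "norm \<kappa> = 1" and z: "norm z \<le> 1 / 2" and s: "norm (s - 1) \<le> 1 / 10"
  shows "(s + \<kappa> * z) / (s * (1 + s * \<kappa> * z)) \<notin> \<real>\<^sub>\<le>\<^sub>0" "s * (1 + s * \<kappa> * z) \<noteq> 0"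
    "norm (osc_log s \<kappa> z) \<le> 11 * norm (s - 1) * norm z"
proof -
  define w where "w = (s + \<kappa> * z) / (s * (1 + s * \<kappa> * z)) - 1"
  have w: "norm w \<le> 11 / 2 * norm (s - 1) * norm z" unfolding w_def by (rule osc_bounds(4)[OF assms])
  also have "\<dots> \<le> 11 / 2 * (1 / 10) * (1 / 2)" using s z by (intro mult_mono) auto
  finally have w2: "norm w < 1 / 2" by simp
  have "Re (1 + w) > 0" using w2 abs_Re_le_cmod[of w] by simp
  then have "1 + w \<notin> \<real>\<^sub>\<le>\<^sub>0" by (auto simp: complex_nonpos_Reals_iff)
  then show "(s + \<kappa> * z) / (s * (1 + s * \<kappa> * z)) \<notin> \<real>\<^sub>\<le>\<^sub>0" by (simp add: w_def)
  show "s * (1 + s * \<kappa> * z) \<noteq> 0" using osc_bounds(1,2)[OF assms] by auto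
  have "norm (Ln (1 + w)) \<le> 2 * norm w" using w2 by (intro norm_Ln_le) auto
  then show "norm (osc_log s \<kappa> z) \<le> 11 * norm (s - 1) * norm z" using w by (simp add: w_def)
qed

text \<open>A sum of principal logarithms along the orbit instead of one \<open>Ln\<close> of the
  whole quotient, so that no estimate for the argument of a long product is needed.\<close>

primrec chain_log :: "complex \<Rightarrow> complex list \<Rightarrow> complex \<Rightarrow> complex" where
  "chain_log s [] z = 0"
| "chain_log s (\<kappa> # \<kappa>s) z = chain_log s \<kappa>s (osc s \<kappa> z) + osc_log s \<kappa> z"

context
  fixes \<delta> :: real and s :: complex
  assumes \<delta>: "0 < \<delta>" "\<delta> \<le> 1 / 20" and s: "s = of_real (1 - \<delta>)"
begin

lemma norm_s: "norm (s - 1) = \<delta>" "norm (s - 1) \<le> 1 / 10"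
  using \<delta> by (auto simp: s)

text \<open>A bound independent of the number of factors: one step costs at most 11 \<delta> |z|,
  while \<open>koebe\<close> drops by a proportion of about \<delta>, which releases 22 \<delta>
  \<open>koebe (norm z)\<close>. Half of that covers the cost, and the other half absorbs the
  second-order term.\<close>

lemma chain_log_bound:
  assumes "\<forall>\<kappa>\<in>set \<kappa>s. norm \<kappa> = 1" "norm z \<le> 1 / 2"
  shows "norm (chain_log s \<kappa>s z) \<le> 22 * koebe (norm z)"
  using assms
proof (induction \<kappa>s arbitrary: z)
  case (Cons \<kappa> \<kappa>s)
  have \<kappa>: "norm \<kappa> = 1" using Cons.prems by simp
  have o: "norm (osc s \<kappa> z) \<le> norm z" unfolding s
    using \<delta> \<kappa> Cons.prems by (intro norm_osc_le_self) auto
  have k0: "0 \<le> koebe (norm z)" by (simp add: koebe_def)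
  have "norm (chain_log s (\<kappa> # \<kappa>s) z) \<le> norm (chain_log s \<kappa>s (osc s \<kappa> z)) + norm (osc_log s \<kappa> z)"
    by (simp add: norm_triangle_ineq)
  also have "\<dots> \<le> 22 * koebe (norm (osc s \<kappa> z)) + 11 * \<delta> * norm z"
    using Cons.IH[of "osc s \<kappa> z"] Cons.prems o osc_log_bounds(3)[OF \<kappa> _ norm_s(2), of z] norm_s(1)
    by (intro add_mono) auto
  also have "\<dots> \<le> 22 * (((1 - \<delta>) + \<delta>\<^sup>2 / 4) * koebe (norm z)) + 11 * \<delta> * koebe (norm z)"
    using koebe_osc_le[of "1 - \<delta>" \<kappa> z] \<kappa> \<delta> Cons.prems le_koebe[of "norm z"]
    by (intro add_mono mult_left_mono) (auto simp: s)
  also have "\<dots> = (22 - (11 * \<delta>) * (1 - \<delta> / 2)) * koebe (norm z)"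
    by (simp add: algebra_simps power2_eq_square)
  also have "\<dots> \<le> 22 * koebe (norm z)"
    using \<delta> k0 by (intro mult_right_mono) auto
  finally show ?case .
qed (simp add: koebe_def)

lemma chain_log_bound':
  assumes "\<forall>\<kappa>\<in>set \<kappa>s. norm \<kappa> = 1" "norm z \<le> 1 / 2"
  shows "norm (chain_log s \<kappa>s z) \<le> 44"
proof -
  \<comment> \<open>\<open>koebe (1 / 2) = 2\<close>, hence the constant 44.\<close>
  have "koebe (norm z) \<le> koebe (1 / 2)" using assms by (intro koebe_mono) auto
  then show ?thesis using chain_log_bound[OF assms] by (simp add: koebe_def power2_eq_square)
qed

lemma chain_log_holomorphic:
  assumes "\<forall>\<kappa>\<in>set \<kappa>s. norm \<kappa> = 1"
  shows "chain_log s \<kappa>s holomorphic_on ball 0 (1 / 2)"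
  using assms
proof (induction \<kappa>s)
  case Nil
  have "chain_log s [] = (\<lambda>_. 0)" by auto
  then show ?case by simp
next
  case (Cons \<kappa> \<kappa>s)
  have \<kappa>: "norm \<kappa> = 1" using Cons.prems by simp
  have nz: "s * (1 + s * \<kappa> * z) \<noteq> 0" if "norm z < 1 / 2" for z
    using osc_log_bounds(2)[OF \<kappa> _ norm_s(2), of z] that by simp
  have "osc s \<kappa> holomorphic_on ball 0 (1 / 2)"
    unfolding osc_def using nz by (intro holomorphic_intros) auto
  moreover have "osc s \<kappa> ` ball 0 (1/2) \<subseteq> ball 0 (1/2)"
  proof safe
    fix z :: complex assume "z \<in> ball 0 (1/2)"
    then show "osc s \<kappa> z \<in> ball 0 (1/2)"
      using norm_osc_le_self[of "1 - \<delta>" \<kappa> z] \<kappa> \<delta> by (simp add: s)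
  qed
  ultimately have "(chain_log s \<kappa>s \<circ> osc s \<kappa>) holomorphic_on ball 0 (1 / 2)"
    using Cons by (intro holomorphic_on_compose_gen) auto
  moreover have "osc_log s \<kappa> holomorphic_on ball 0 (1/2)"
    using nz osc_log_bounds(1)[OF \<kappa> _ norm_s(2)]
    by (intro holomorphic_intros) auto
  ultimately have "(\<lambda>z. chain_log s \<kappa>s (osc s \<kappa> z) + osc_log s \<kappa> z) holomorphic_on ball 0 (1/2)"
    by (auto intro!: holomorphic_on_add simp: o_def)
  also have "(\<lambda>z. chain_log s \<kappa>s (osc s \<kappa> z) + osc_log s \<kappa> z) = chain_log s (\<kappa> # \<kappa>s)" by auto
  finally show ?case .
qed

lemma chain_log_0: "chain_log s \<kappa>s 0 = 0"
proof (induction \<kappa>s)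
  case (Cons \<kappa> \<kappa>s)
  have "s \<noteq> 0" using \<delta> by (simp add: s flip: of_real_diff)
  then show ?case using Cons by (simp add: osc_def)
qed simp

lemma osc_chain_eq_exp:
  assumes "\<forall>\<kappa>\<in>set \<kappa>s. norm \<kappa> = 1" "norm z \<le> 1 / 2"
  shows "osc_chain s \<kappa>s z = s ^ length \<kappa>s * (z * exp (chain_log s \<kappa>s z))"
  using assms
proof (induction \<kappa>s arbitrary: z)
  case (Cons \<kappa> \<kappa>s)
  have \<kappa>: "norm \<kappa> = 1" using Cons.prems by simp
  have o: "norm (osc s \<kappa> z) \<le> norm z" unfolding s
    using \<delta> \<kappa> Cons.prems by (intro norm_osc_le_self) auto
  have nz: "s * (1 + s * \<kappa> * z) \<noteq> 0"
    using osc_log_bounds(2)[OF \<kappa> _ norm_s(2), of z] Cons.prems by simp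
  have "(s + \<kappa> * z) / (s * (1 + s * \<kappa> * z)) \<noteq> 0"
    using osc_log_bounds(1)[OF \<kappa> _ norm_s(2), of z] Cons.prems by auto
  then have "osc s \<kappa> z = s * z * exp (osc_log s \<kappa> z)"
    using nz by (simp add: osc_def)
  moreover have "osc_chain s \<kappa>s (osc s \<kappa> z) =
      s ^ length \<kappa>s * (osc s \<kappa> z * exp (chain_log s \<kappa>s (osc s \<kappa> z)))"
    using Cons.prems o by (intro Cons.IH) auto
  ultimately show ?case by (simp add: exp_add mult_ac)
qed simp

end

section \<open>Monotonicity of the logarithmic energy\<close>

text \<open>Cauchy bounds the terms from index 2 on by a geometric series of ratio |t| / R \<le>
  1/2, which sums to at most twice its first term.\<close>

lemma second_order_remainder:
  assumes hol: "f holomorphic_on ball 0 R" and R: "R > 0"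
    and B: "\<And>t. norm t < R \<Longrightarrow> norm (f t) \<le> B" and t: "norm t \<le> R / 2"
  shows "norm (f t - f 0 - t * deriv f 0) \<le> 2 * B * (norm t / R)\<^sup>2"
proof -
  define x where "x = norm t / R"
  have x: "0 \<le> x" "x \<le> 1 / 2" using t R by (auto simp: x_def field_simps)
  have B0: "0 \<le> B" using order_trans[OF norm_ge_zero B, of 0] R by simp
  have tR: "norm t < R" using t R by linarith
  from sums_split_initial_segment[OF taylor_sums[OF hol tR], of 2]
  have S: "(\<lambda>n. taylor f (n + 2) * t ^ (n + 2)) sums (f t - f 0 - t * deriv f 0)"
    using taylor_1[of f] by (simp add: numeral_2_eq_2 taylor_0 algebra_simps)
  have G: "(\<lambda>n. B * x\<^sup>2 * x ^ n) sums (B * x\<^sup>2 * (1 / (1 - x)))"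
    using x by (intro sums_mult geometric_sums) auto
  have le: "norm (taylor f (n + 2) * t ^ (n + 2)) \<le> B * x\<^sup>2 * x ^ n" for n
  proof -
    have "norm (taylor f (n + 2)) * R ^ (n + 2) * x ^ (n + 2) \<le> B * x ^ (n + 2)"
      using x by (intro mult_right_mono taylor_bound[OF hol R B]) auto
    then show ?thesis using R by (simp add: x_def norm_mult norm_power power_divide power_add power2_eq_square mult_ac)
  qed
  have "norm (f t - f 0 - t * deriv f 0) \<le> (\<Sum>n. B * x\<^sup>2 * x ^ n)"
    using norm_suminf_le[of "\<lambda>n. taylor f (n + 2) * t ^ (n + 2)", OF le sums_summable[OF G]]
    unfolding sums_unique[OF S, symmetric] .
  also have "\<dots> = B * x\<^sup>2 * (1 / (1 - x))" using G by (simp add: sums_iff)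
  also have "\<dots> \<le> B * x\<^sup>2 * 2" using x B0 by (intro mult_left_mono) (auto simp: field_simps)
  finally show ?thesis by (simp add: x_def)
qed

lemma norm_mult_bound: "norm (c::complex) * (2 / 5) ^ k \<le> B \<Longrightarrow> norm c \<le> B * (5 / 2) ^ k"
  by (simp add: power_divide field_simps)

text \<open>Here \<open>y\<close> and \<open>y'\<close> stand for consecutive coefficients of an
  auxiliary function. The first-order change of |c|^2 brings in k Re (cnj c h) = |y|^2 - |y'|^2.
  Lowering the weight from W to W (1 - \<delta> \<tau>) costs, by Bernoulli, \<delta> \<tau> k^2
  |c|^2 W^k, and k^2 |c|^2 is at most 2 |y|^2 + 2 |y'|^2. The value of \<tau> is the one for which
  the resulting coefficients of |y|^2 and |y'|^2 are in the ratio - W, as telescoping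
  requires.\<close>

lemma lyapunov_term:
  fixes c h q y y' \<kappa> :: complex and k :: nat and \<delta> W :: real
  assumes \<kappa>: "norm \<kappa> = 1" and \<delta>: "0 < \<delta>" "\<delta> \<le> 1 / 20" and W: "0 \<le> W" "W \<le> 1 / 10"
    and c: "of_nat k * c = y + \<kappa> * y'" and h: "h = y - \<kappa> * y'" and k: "k \<ge> 1"
    and bc: "norm c * (2 / 5) ^ k \<le> 44" and bh: "norm h * (2 / 5) ^ k \<le> 450"
    and bq: "norm q * (2 / 5) ^ k \<le> 9000 * \<delta>\<^sup>2"
  defines "\<tau> \<equiv> (1 - W) / (1 + W)"
  shows "k * norm (c - \<delta> * h + q) ^ 2 * W ^ k \<le> k * norm c ^ 2 * (W * (1 - \<delta> * \<tau>)) ^ k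
     + 4 * \<delta> / (1 + W) * (norm y' ^ 2 * W ^ k - norm y ^ 2 * W ^ Suc k) + 2000000 * \<delta>\<^sup>2 * (k * (5 / 8) ^ k)"
proof -
  define \<rho> where "\<rho> = (5 / 2 :: real) ^ k"
  have \<rho>: "\<rho> > 0" by (simp add: \<rho>_def)
  have bc: "norm c \<le> 44 * \<rho>" and bh: "norm h \<le> 450 * \<rho>" and bq: "norm q \<le> 9000 * \<delta>\<^sup>2 * \<rho>"
    unfolding \<rho>_def by (intro norm_mult_bound bc bh bq)+
  have bdh: "norm (of_real \<delta> * h) \<le> 450 * \<delta> * \<rho>"
    using mult_left_mono[OF bh, of \<delta>] \<delta> by (simp add: norm_mult mult_ac)
  have "450 * \<delta> * \<rho> \<le> (45 / 2) * \<rho>" using \<delta> \<rho> by (intro mult_right_mono) auto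
  then have bcd: "norm (c - \<delta> * h) \<le> 67 * \<rho>"
    using norm_triangle_ineq4[of c "\<delta> * h"] bc bdh \<rho> by linarith
  have "norm (c - \<delta> * h + q) ^ 2 \<le> (norm (c - \<delta> * h) + norm q) ^ 2"
    by (intro power_mono norm_triangle_ineq) auto
  also have "\<dots> = norm (c - \<delta> * h) ^ 2 + (2 * norm (c - \<delta> * h) * norm q + norm q ^ 2)"
    by (simp add: power2_eq_square algebra_simps)
  also have "norm (c - \<delta> * h) ^ 2 = norm c ^ 2 - 2 * \<delta> * Re (cnj c * h) + norm (\<delta> * h) ^ 2"
    by (simp only: cmod_power2) (simp add: power2_eq_square algebra_simps)
  finally have 1: "norm (c - \<delta> * h + q) ^ 2 \<le> norm c ^ 2 - 2 * \<delta> * Re (cnj c * h)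
    + (norm (\<delta> * h) ^ 2 + 2 * norm (c - \<delta> * h) * norm q + norm q ^ 2)" by simp
  have "norm (\<delta> * h) ^ 2 + 2 * norm (c - \<delta> * h) * norm q + norm q ^ 2 \<le>
      (450 * \<delta> * \<rho>) ^ 2 + 2 * (67 * \<rho>) * (9000 * \<delta>\<^sup>2 * \<rho>) + (9000 * \<delta>\<^sup>2 * \<rho>) ^ 2"
    using bdh bcd bq \<rho> by (intro add_mono power_mono mult_mono) auto
  \<comment> \<open>With \<delta> \<le> 1/20 the bracket is at most 202500 + 1206000 + 202500, below
    2000000.\<close>
  also have "\<dots> = \<delta>\<^sup>2 * \<rho>\<^sup>2 * (202500 + 1206000 + 81000000 * \<delta>\<^sup>2)"
    by (simp add: power2_eq_square algebra_simps)
  also have "\<delta>\<^sup>2 \<le> (1 / 20)\<^sup>2" using \<delta> by (intro power_mono) auto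
  then have "\<delta>\<^sup>2 * \<rho>\<^sup>2 * (202500 + 1206000 + 81000000 * \<delta>\<^sup>2) \<le> \<delta>\<^sup>2 * \<rho>\<^sup>2 * 2000000"
    by (intro mult_left_mono) (auto simp: power2_eq_square)
  finally have 2: "norm (c - \<delta> * h + q) ^ 2 \<le> norm c ^ 2 - 2 * \<delta> * Re (cnj c * h) + 2000000 * \<delta>\<^sup>2 * \<rho>\<^sup>2"
    using 1 by simp
  have kc: "k * Re (cnj c * h) = norm y ^ 2 - norm y' ^ 2"
  proof -
    have "k * Re (cnj c * h) = Re (cnj (of_nat k * c) * h)" by (simp add: algebra_simps)
    also have "\<dots> = norm y ^ 2 - norm (\<kappa> * y') ^ 2"
      unfolding c h by (simp only: cmod_power2) (simp add: power2_eq_square algebra_simps)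
    finally show ?thesis using \<kappa> by (simp add: norm_mult)
  qed
  have k2: "(k * norm c) ^ 2 \<le> 2 * norm y ^ 2 + 2 * norm y' ^ 2"
  proof -
    have "(k * norm c) ^ 2 = norm (y + \<kappa> * y') ^ 2" unfolding c[symmetric] by (simp add: norm_mult)
    also have "\<dots> \<le> (norm y + norm y') ^ 2"
      using norm_triangle_ineq[of y "\<kappa> * y'"] \<kappa> by (intro power_mono) (auto simp: norm_mult)
    also have "\<dots> \<le> 2 * norm y ^ 2 + 2 * norm y' ^ 2"
      using sum_squares_bound[of "norm y" "norm y'"] by (simp add: power2_eq_square algebra_simps)
    finally show ?thesis .
  qed
  have \<tau>: "0 \<le> \<tau>" "\<tau> \<le> 1" using W by (auto simp: \<tau>_def field_simps)
  have "\<delta> * \<tau> \<le> 1 * 1" using \<delta> \<tau> by (intro mult_mono) auto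
  then have "1 + real k * (- (\<delta> * \<tau>)) \<le> (1 + - (\<delta> * \<tau>)) ^ k" by (intro Bernoulli_inequality) auto
  then have bern: "1 - k * \<delta> * \<tau> \<le> (1 - \<delta> * \<tau>) ^ k" by (simp add: mult_ac)
  \<comment> \<open>The squared Cauchy growth (25/4)^k is beaten by W^k because W \<le>
    1/10.\<close>
  have "(\<rho>\<^sup>2 * W ^ k) = (25 / 4 * W) ^ k" by (simp add: \<rho>_def power_mult_distrib power_divide flip: power_mult) (simp add: power_mult mult.commute[of k])
  also have "\<dots> \<le> (5 / 8) ^ k" using W by (intro power_mono) auto
  finally have \<rho>W: "\<rho>\<^sup>2 * W ^ k \<le> (5 / 8) ^ k" .
  have "k * norm (c - \<delta> * h + q) ^ 2 * W ^ k \<le>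
      k * (norm c ^ 2 - 2 * \<delta> * Re (cnj c * h) + 2000000 * \<delta>\<^sup>2 * \<rho>\<^sup>2) * W ^ k"
    using W by (intro mult_left_mono mult_right_mono 2) auto
  also have "\<dots> = k * norm c ^ 2 * W ^ k - 2 * \<delta> * (k * Re (cnj c * h)) * W ^ k
      + 2000000 * \<delta>\<^sup>2 * (k * (\<rho>\<^sup>2 * W ^ k))"
    by (simp add: algebra_simps)
  also have "\<dots> \<le> k * norm c ^ 2 * W ^ k - 2 * \<delta> * (k * Re (cnj c * h)) * W ^ k
      + 2000000 * \<delta>\<^sup>2 * (k * (5 / 8) ^ k)"
    by (intro add_left_mono mult_left_mono \<rho>W) auto
  also have "k * norm c ^ 2 * W ^ k = k * norm c ^ 2 * W ^ k * (1 - k * \<delta> * \<tau>) + \<delta> * \<tau> * (k * norm c) ^ 2 * W ^ k"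
    by (simp add: algebra_simps power2_eq_square)
  also have "\<dots> \<le> k * norm c ^ 2 * W ^ k * (1 - \<delta> * \<tau>) ^ k + \<delta> * \<tau> * (2 * norm y ^ 2 + 2 * norm y' ^ 2) * W ^ k"
    using W \<delta> \<tau> by (intro add_mono mult_left_mono mult_right_mono bern k2) auto
  finally have "k * norm (c - \<delta> * h + q) ^ 2 * W ^ k \<le> k * norm c ^ 2 * (W ^ k * (1 - \<delta> * \<tau>) ^ k)
     + (\<delta> * \<tau> * (2 * norm y ^ 2 + 2 * norm y' ^ 2) - 2 * \<delta> * (norm y ^ 2 - norm y' ^ 2)) * W ^ k
     + 2000000 * \<delta>\<^sup>2 * (k * (5 / 8) ^ k)"
    unfolding kc by (simp add: algebra_simps)
  also have "\<delta> * \<tau> * (2 * norm y ^ 2 + 2 * norm y' ^ 2) - 2 * \<delta> * (norm y ^ 2 - norm y' ^ 2) =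
      4 * \<delta> / (1 + W) * (norm y' ^ 2 - norm y ^ 2 * W)"
  proof -
    have "(\<tau> + 1) * (1 + W) = 2" "(\<tau> - 1) * (1 + W) = - 2 * W"
      using W by (auto simp: \<tau>_def field_simps)
    then have \<tau>1: "\<tau> + 1 = 2 / (1 + W)" "\<tau> - 1 = - 2 * W / (1 + W)" using W by (auto simp: field_simps)
    have "\<delta> * \<tau> * (2 * norm y ^ 2 + 2 * norm y' ^ 2) - 2 * \<delta> * (norm y ^ 2 - norm y' ^ 2) =
       2 * \<delta> * ((\<tau> + 1) * norm y' ^ 2 + (\<tau> - 1) * norm y ^ 2)" by (simp add: algebra_simps)
    also have "\<dots> = 4 * \<delta> / (1 + W) * (norm y' ^ 2 - norm y ^ 2 * W)"
      unfolding \<tau>1 by (simp add: algebra_simps diff_divide_distrib)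
    finally show ?thesis .
  qed
  finally show ?thesis
    unfolding power_mult_distrib[of W "1 - \<delta> * \<tau>"] by (simp add: algebra_simps)
qed

lemma sum_telescope_Suc:
  fixes a :: "nat \<Rightarrow> real"
  shows "(\<Sum>k=1..N. a (k - 1) - a k) = a 0 - a N"
  by (induction N) auto

text \<open>The whole series equals \<open>koebe (5 / 8)\<close> = 40/9; the closed form of its
  partial sums goes through by induction.\<close>

lemma sum_nat_five_eighths: "(\<Sum>k=1..N. real k * (5 / 8) ^ k) \<le> 5"
proof -
  have "(\<Sum>k=1..N. real k * (5 / 8) ^ k) = 40 / 9 - (real N * (5 / 3) + 40 / 9) * (5 / 8) ^ N"
    by (induction N) (simp_all add: algebra_simps add_divide_distrib)
  also have "\<dots> \<le> 40 / 9" by simp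
  finally show ?thesis by simp
qed

text \<open>For the Koebe function (\<open>taylor C k\<close> = 2 / k) the sum over all k is - 4 ln
  (1 - W), the value against which every chain is compared. Truncation at \<open>N\<close> keeps all
  estimates finite and is uniform in the bounds.\<close>

definition log_energy :: "nat \<Rightarrow> (complex \<Rightarrow> complex) \<Rightarrow> real \<Rightarrow> real" where
  "log_energy N C W = (\<Sum>k=1..N. k * norm (taylor C k) ^ 2 * W ^ k)"

text \<open>With \<open>Y = (1 + z C') / (1 + \<kappa> z)\<close>, the first-order change of \<open>C\<close> is \<open>- \<delta> (Y (1 - \<kappa> z) - 1)\<close>, while
  \<open>z C' = Y (1 + \<kappa> z) - 1\<close>. Hence the \<open>k\<close>-th term of the energy changes by a difference of squares of consecutive
  coefficients of \<open>Y\<close>, and the sum telescopes.\<close>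

lemma log_energy_step:
  fixes C :: "complex \<Rightarrow> complex" and \<delta> W :: real
  assumes \<kappa>: "norm \<kappa> = 1" and \<delta>: "0 < \<delta>" "\<delta> \<le> 1 / 20" and W: "0 \<le> W" "W \<le> 1 / 10"
    and C: "C holomorphic_on ball 0 (1 / 2)" "\<And>z. norm z < 1 / 2 \<Longrightarrow> norm (C z) \<le> 44"
    and Cn: "Cn holomorphic_on ball 0 (1 / 2)"
    and Cn_eq: "\<And>z. norm z < 1 / 2 \<Longrightarrow> Cn z = C (osc (1 - \<delta>) \<kappa> z) + osc_log (1 - \<delta>) \<kappa> z"
  shows "log_energy N Cn W \<le> log_energy N C (W * (1 - \<delta> * ((1 - W) / (1 + W))))
    + 4 * \<delta> * W / (1 + W) + 10000000 * \<delta>\<^sup>2"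
proof -
  define Y where "Y = (\<lambda>z. (1 + z * deriv C z) / (1 + \<kappa> * z))"
  define H where "H = (\<lambda>z. Y z * (1 - \<kappa> * z) - 1)"
  \<comment> \<open>The second-order remainder of the step; the sign of \<open>H\<close> is positive
    because \<open>s\<close> moves from 1 to 1 - \<delta>.\<close>
  define Q where "Q = (\<lambda>z. Cn z - C z + of_real \<delta> * H z)"
  have nz: "1 + \<kappa> * z \<noteq> 0" if "norm z < 1 / 2" for z
    using that \<kappa> by (intro one_plus_nonzero) (simp add: norm_mult)
  have C': "deriv C holomorphic_on ball 0 (1 / 2)" using C(1) by (intro holomorphic_deriv) auto
  have Y: "Y holomorphic_on ball 0 (1 / 2)" unfolding Y_def
    using nz C(1) by (intro holomorphic_intros) auto
  have H: "H holomorphic_on ball 0 (1 / 2)" unfolding H_def by (intro holomorphic_intros Y)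
  have Q: "Q holomorphic_on ball 0 (1 / 2)" unfolding Q_def by (intro holomorphic_intros Cn C H)
  \<comment> \<open>For fixed z the new logarithm is a holomorphic function \<open>g\<close> of t =
    s - 1, bounded by 45 on |t| < 1/10. Cauchy gives |g'(0)| \<le> 45 * 10 and the remainder 2 * 45
    * (10 \<delta>)^2.\<close>
  have HQ: "norm (H z) \<le> 450 \<and> norm (Q z) \<le> 9000 * \<delta>\<^sup>2" if z: "norm z < 2 / 5" for z
  proof -
    define g where "g = (\<lambda>t. C (osc (1 + t) \<kappa> z) + osc_log (1 + t) \<kappa> z)"
    have nz': "1 + (1 + t) * \<kappa> * z \<noteq> 0" "(1 + t) * (1 + (1 + t) * \<kappa> * z) \<noteq> 0" if "norm t < 1 / 10" for t
      using osc_log_bounds(2)[OF \<kappa>, of z "1 + t"] that z by auto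
    have o: "norm (osc (1 + t) \<kappa> z) < 1 / 2" if t: "norm t < 1 / 10" for t
    proof -
      have "((1 + t) + \<kappa> * z) / (1 + (1 + t) * \<kappa> * z) - 1 = t * (1 - \<kappa> * z) / (1 + (1 + t) * \<kappa> * z)"
        using nz'(1)[OF t] by (simp add: field_simps)
      also have "norm \<dots> = norm t * (norm (1 - \<kappa> * z) / norm (1 + (1 + t) * \<kappa> * z))"
        by (simp add: norm_mult norm_divide)
      \<comment> \<open>The value is 1/4, so the image has modulus at most 5/4 times |z|. This is
        the reason for |z| < 2/5: the image then stays in the disc of radius 1/2 where
        \<open>C\<close> is controlled.\<close>
      also have "\<dots> \<le> (1 / 10) * ((7 / 5) / (14 / 25))"
      proof (intro mult_mono frac_le)
        show "norm (1 - \<kappa> * z) \<le> 7 / 5"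
          using norm_triangle_ineq4[of 1 "\<kappa> * z"] \<kappa> z by (simp add: norm_mult)
        have "norm ((1 + t) * \<kappa> * z) \<le> 11 / 10 * (2 / 5)"
          unfolding norm_mult \<kappa> using norm_triangle_ineq[of 1 t] t z by (intro mult_mono) auto
        then show "14 / 25 \<le> norm (1 + (1 + t) * \<kappa> * z)"
          using norm_triangle_ineq2[of 1 "- ((1 + t) * \<kappa> * z)"] by simp
      qed (use t in auto)
      finally have "norm (((1 + t) + \<kappa> * z) / (1 + (1 + t) * \<kappa> * z)) \<le> 5 / 4"
        using norm_triangle_ineq2[of "((1 + t) + \<kappa> * z) / (1 + (1 + t) * \<kappa> * z)" 1] by simp
      then have "norm (osc (1 + t) \<kappa> z) \<le> norm z * (5 / 4)"
        unfolding osc_def norm_mult by (intro mult_left_mono) auto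
      then show ?thesis using z by simp
    qed
    have ghol: "g holomorphic_on ball 0 (1 / 10)"
    proof -
      have "(\<lambda>t. osc (1 + t) \<kappa> z) holomorphic_on ball 0 (1 / 10)"
        unfolding osc_def using nz' by (intro holomorphic_intros) auto
      then have "(C \<circ> (\<lambda>t. osc (1 + t) \<kappa> z)) holomorphic_on ball 0 (1 / 10)"
        by (rule holomorphic_on_compose_gen[OF _ C(1)]) (use o in auto)
      moreover have "(\<lambda>t. osc_log (1 + t) \<kappa> z) holomorphic_on ball 0 (1 / 10)"
        using nz' osc_log_bounds(1)[OF \<kappa>, of z] z by (intro holomorphic_intros) auto
      ultimately show ?thesis unfolding g_def o_def by (intro holomorphic_on_add)
    qed
    have gB: "norm (g t) \<le> 45" if t: "norm t < 1 / 10" for t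
    proof -
      have "norm (osc_log (1 + t) \<kappa> z) \<le> 11 * norm t * norm z"
        using osc_log_bounds(3)[OF \<kappa>, of z "1 + t"] t z by simp
      also have "\<dots> \<le> 11 * (1 / 10) * (1 / 2)" using t z by (intro mult_mono) auto
      finally have "norm (osc_log (1 + t) \<kappa> z) \<le> 1" by simp
      then show ?thesis unfolding g_def
        using C(2)[OF o[OF t]] norm_triangle_ineq[of "C (osc (1 + t) \<kappa> z)" "osc_log (1 + t) \<kappa> z"] by linarith
    qed
    have nzz: "1 + \<kappa> * z \<noteq> 0" using nz z by simp
    have osc1: "osc 1 \<kappa> z = z" using nzz by (simp add: osc_def)
    have g0: "g 0 = C z" using nzz by (simp add: g_def osc1)
    have dg: "deriv g 0 = H z"
    proof (rule DERIV_imp_deriv)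
      have d1: "((\<lambda>t. osc (1 + t) \<kappa> z) has_field_derivative z * (1 - \<kappa> * z) / (1 + \<kappa> * z)) (at 0)"
      proof -
        have "((\<lambda>t. osc (1 + t) \<kappa> z) has_field_derivative
            z * (((1 + \<kappa> * z) - (1 + \<kappa> * z) * (\<kappa> * z)) / ((1 + \<kappa> * z) * (1 + \<kappa> * z)))) (at 0)"
          unfolding osc_def using nzz by (auto intro!: derivative_eq_intros simp: algebra_simps)
        also have "(1 + \<kappa> * z) - (1 + \<kappa> * z) * (\<kappa> * z) = (1 + \<kappa> * z) * (1 - \<kappa> * z)"
          by (simp add: algebra_simps)
        finally show ?thesis using nzz by simp
      qed
      have d2: "((\<lambda>t. osc_log (1 + t) \<kappa> z) has_field_derivative (1 - \<kappa> * z) / (1 + \<kappa> * z) - 1) (at 0)"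
      proof -
        define w where "w = \<kappa> * z"
        have w: "1 + w \<noteq> 0" using nzz by (simp add: w_def)
        have "((\<lambda>t. (1 + t + w) / ((1 + t) * (1 + (1 + t) * w))) has_field_derivative
            ((1 + w) - (1 + w) * (1 + w + w)) / ((1 + w) * (1 + w))) (at 0)"
          using w by (auto intro!: derivative_eq_intros)
        also have "((1 + w) - (1 + w) * (1 + w + w)) / ((1 + w) * (1 + w)) = (1 - w) / (1 + w) - 1"
          using w by (simp add: divide_simps) (simp add: algebra_simps)
        finally have "((\<lambda>t. (1 + t + w) / ((1 + t) * (1 + (1 + t) * w))) has_field_derivative
            (1 - w) / (1 + w) - 1) (at 0)" .
        moreover have "(Ln has_field_derivative 1) (at ((1 + 0 + w) / ((1 + 0) * (1 + (1 + 0) * w))))"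
          using w has_field_derivative_Ln[of 1] by simp
        ultimately have "((\<lambda>t. Ln ((1 + t + w) / ((1 + t) * (1 + (1 + t) * w)))) has_field_derivative
            1 * ((1 - w) / (1 + w) - 1)) (at 0)" by (intro DERIV_chain2)
        then show ?thesis by (simp add: w_def mult.assoc)
      qed
      have "(C has_field_derivative deriv C z) (at (osc (1 + 0) \<kappa> z))"
        using holomorphic_derivI[OF C(1), of z] z osc1 by simp
      from DERIV_chain2[where g = "\<lambda>t. osc (1 + t) \<kappa> z", OF this d1]
      have "(g has_field_derivative deriv C z * (z * (1 - \<kappa> * z) / (1 + \<kappa> * z)) + ((1 - \<kappa> * z) / (1 + \<kappa> * z) - 1)) (at 0)"
        unfolding g_def by (intro DERIV_add d2)
      also have "deriv C z * (z * (1 - \<kappa> * z) / (1 + \<kappa> * z)) + ((1 - \<kappa> * z) / (1 + \<kappa> * z) - 1) = H z"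
        unfolding H_def Y_def by (simp add: distrib_left distrib_right add_divide_distrib mult_ac)
      finally show "(g has_field_derivative H z) (at 0)" .
    qed
    have "norm (H z) \<le> 450"
      using taylor_bound[OF ghol _ gB, of 1] taylor_1[of g] by (simp add: dg)
    moreover have "norm (g (- of_real \<delta>) - g 0 - (- of_real \<delta>) * deriv g 0) \<le> 2 * 45 * (norm (- of_real \<delta> :: complex) / (1 / 10))\<^sup>2"
      using \<delta> by (intro second_order_remainder[OF ghol _ gB]) auto
    moreover have "g (- of_real \<delta>) = Cn z" unfolding g_def using Cn_eq[of z] z by simp
    ultimately show ?thesis
      using \<delta> by (simp add: Q_def g0 dg power_mult_distrib)
  qed
  have sub: "f holomorphic_on ball 0 (2 / 5)" if "f holomorphic_on ball 0 (1 / 2)" for f :: "complex \<Rightarrow> complex"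
    by (rule holomorphic_on_subset[OF that]) auto
  \<comment> \<open>With the exponent \<open>Suc k\<close>, both squares from
    \<open>lyapunov_term\<close> are values of \<open>P\<close>, at k - 1 and at k.\<close>
  define P where "P = (\<lambda>k. norm (taylor Y k) ^ 2 * W ^ Suc k)"
  define W' where "W' = W * (1 - \<delta> * ((1 - W) / (1 + W)))"
  have term_le: "k * norm (taylor Cn k) ^ 2 * W ^ k \<le> k * norm (taylor C k) ^ 2 * W' ^ k
     + 4 * \<delta> / (1 + W) * (P (k - 1) - P k) + 2000000 * \<delta>\<^sup>2 * (k * (5 / 8) ^ k)" if k: "k \<in> {1..N}" for k
  proof -
    have k1: "k \<ge> 1" using k by simp
    have half: "(0::real) < 1 / 2" by simp
    have \<kappa>Y: "taylor (\<lambda>z. \<kappa> * (z * Y z)) k = \<kappa> * taylor Y (k - 1)"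
    proof -
      have "(\<lambda>z. z * Y z) holomorphic_on ball 0 (1 / 2)" by (intro holomorphic_intros Y)
      from taylor_cmult[OF this half, of \<kappa> k] taylor_mult_left[OF Y half, of k] k1
      show ?thesis by simp
    qed
    have one: "taylor (\<lambda>z. 1) k = 0" using k1 by (simp add: fps_expansion_def higher_deriv_const)
    have "taylor (\<lambda>z. z * deriv C z) k = of_nat k * taylor C k"
      using k1 taylor_mult_left[OF C' half, of k] taylor_deriv[OF C(1) half, of "k - 1"] by simp
    also have "taylor (\<lambda>z. z * deriv C z) k = taylor (\<lambda>z. (Y z + \<kappa> * (z * Y z)) - 1) k"
    proof (rule taylor_cong[OF half])
      fix z :: complex assume z: "norm z < 1 / 2"
      have "Y z + \<kappa> * (z * Y z) = Y z * (1 + \<kappa> * z)" by (simp add: algebra_simps)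
      also have "\<dots> = 1 + z * deriv C z" using nz[OF z] by (simp add: Y_def)
      finally show "z * deriv C z = (Y z + \<kappa> * (z * Y z)) - 1" by simp
    qed
    also have "\<dots> = taylor (\<lambda>z. Y z + \<kappa> * (z * Y z)) k - taylor (\<lambda>z. 1) k"
      by (rule taylor_diff[OF _ _ half]) (intro holomorphic_intros Y)+
    also have "taylor (\<lambda>z. Y z + \<kappa> * (z * Y z)) k = taylor Y k + \<kappa> * taylor Y (k - 1)"
      unfolding \<kappa>Y[symmetric] by (rule taylor_add[OF Y _ half]) (intro holomorphic_intros Y)
    finally have c: "of_nat k * taylor C k = taylor Y k + \<kappa> * taylor Y (k - 1)" using one by simp
    have "taylor H k = taylor (\<lambda>z. (Y z - \<kappa> * (z * Y z)) - 1) k"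
      by (rule taylor_cong[OF half]) (simp add: H_def algebra_simps)
    also have "\<dots> = taylor (\<lambda>z. Y z - \<kappa> * (z * Y z)) k - taylor (\<lambda>z. 1) k"
      by (rule taylor_diff[OF _ _ half]) (intro holomorphic_intros Y)+
    also have "taylor (\<lambda>z. Y z - \<kappa> * (z * Y z)) k = taylor Y k - \<kappa> * taylor Y (k - 1)"
      unfolding \<kappa>Y[symmetric] by (rule taylor_diff[OF Y _ half]) (intro holomorphic_intros Y)
    finally have h: "taylor H k = taylor Y k - \<kappa> * taylor Y (k - 1)" using one by simp
    have "taylor Cn k = taylor (\<lambda>z. (C z - of_real \<delta> * H z) + Q z) k"
      by (rule taylor_cong[OF half]) (simp add: Q_def)
    also have "\<dots> = taylor (\<lambda>z. C z - of_real \<delta> * H z) k + taylor Q k"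
      by (rule taylor_add[OF _ Q half]) (intro holomorphic_intros C H)
    also have "taylor (\<lambda>z. C z - of_real \<delta> * H z) k = taylor C k - taylor (\<lambda>z. of_real \<delta> * H z) k"
      by (rule taylor_diff[OF C(1) _ half]) (intro holomorphic_intros H)
    also have "taylor (\<lambda>z. of_real \<delta> * H z) k = of_real \<delta> * taylor H k"
      by (rule taylor_cmult[OF H half])
    finally have cn: "taylor Cn k = taylor C k - of_real \<delta> * taylor H k + taylor Q k" .
    have "norm (taylor C k) * (2 / 5) ^ k \<le> 44" "norm (taylor H k) * (2 / 5) ^ k \<le> 450"
      "norm (taylor Q k) * (2 / 5) ^ k \<le> 9000 * \<delta>\<^sup>2"
      using HQ C(2) by (auto intro!: taylor_bound sub C H Q)
    from lyapunov_term[OF \<kappa> \<delta> W c h k1 this]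
    moreover have "Suc (k - 1) = k" using k1 by simp
    ultimately show ?thesis unfolding cn P_def W'_def by (simp only:)
  qed
  have "log_energy N Cn W \<le> (\<Sum>k=1..N. k * norm (taylor C k) ^ 2 * W' ^ k
     + 4 * \<delta> / (1 + W) * (P (k - 1) - P k) + 2000000 * \<delta>\<^sup>2 * (k * (5 / 8) ^ k))"
    unfolding log_energy_def by (intro sum_mono term_le)
  also have "\<dots> = log_energy N C W' + 4 * \<delta> / (1 + W) * (P 0 - P N)
      + 2000000 * \<delta>\<^sup>2 * (\<Sum>k=1..N. k * (5 / 8) ^ k)"
    unfolding log_energy_def
    by (simp only: sum.distrib sum_distrib_left[symmetric] sum_telescope_Suc)
  also have "\<dots> \<le> log_energy N C W' + 4 * \<delta> / (1 + W) * W + 2000000 * \<delta>\<^sup>2 * 5"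
  proof (intro add_mono mult_left_mono sum_nat_five_eighths)
    \<comment> \<open>\<open>Y 0 = 1\<close>, so the lower end of the telescoping sum is the only
      gain of energy.\<close>
    have "P 0 = W" by (simp add: P_def taylor_0 Y_def)
    moreover have "P N \<ge> 0" using W by (simp add: P_def)
    ultimately show "P 0 - P N \<le> W" by simp
  qed (use \<delta> W in auto)
  finally show ?thesis by (simp add: W'_def)
qed

text \<open>The empty chain has energy 0, below - 4 ln (1 - W). Each further factor adds 4 y to the
  energy at the moved weight, and the comparison function makes room for it up to 4 y^2 \<le> 4
  \<delta>^2; the 10000000 of the single step thus becomes 10000004.\<close>

lemma log_energy_chain_log:
  fixes \<delta> W :: real
  assumes \<delta>: "0 < \<delta>" "\<delta> \<le> 1 / 20"
  shows "\<forall>\<kappa>\<in>set \<kappa>s. norm \<kappa> = 1 \<Longrightarrow> 0 \<le> W \<Longrightarrow> W \<le> 1 / 10 \<Longrightarrow>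
    log_energy N (chain_log (of_real (1 - \<delta>)) \<kappa>s) W \<le> - 4 * ln (1 - W) + length \<kappa>s * 10000004 * \<delta>\<^sup>2"
proof (induction \<kappa>s arbitrary: W)
  case Nil
  have "log_energy N (\<lambda>_. 0) W = 0"
    by (simp add: log_energy_def fps_expansion_def higher_deriv_const)
  moreover have "ln (1 - W) \<le> 0" using Nil by simp
  moreover have "chain_log (of_real (1 - \<delta>)) [] = (\<lambda>_. 0)" by auto
  ultimately show ?case by (simp only:) simp
next
  case (Cons \<kappa> \<kappa>s)
  define \<tau> where "\<tau> = (1 - W) / (1 + W)"
  define W' where "W' = W * (1 - \<delta> * \<tau>)"
  have \<tau>: "0 \<le> \<tau>" "\<tau> \<le> 1" using Cons.prems by (auto simp: \<tau>_def field_simps)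
  have "\<delta> * \<tau> \<le> 1 * 1" using \<delta> \<tau> by (intro mult_mono) auto
  then have "0 \<le> W'" "W' \<le> W * 1" unfolding W'_def
    using Cons.prems \<delta> \<tau> by (intro mult_nonneg_nonneg mult_left_mono; simp)+
  then have W': "0 \<le> W'" "W' \<le> 1 / 10" using Cons.prems by auto
  have \<kappa>: "norm \<kappa> = 1" "\<forall>\<kappa>\<in>set \<kappa>s. norm \<kappa> = 1" using Cons.prems by auto
  define y where "y = \<delta> * W / (1 + W)"
  have y: "0 \<le> y" "y \<le> \<delta>"
    using Cons.prems \<delta> mult_left_mono[of W "1 + W" \<delta>] by (auto simp: y_def field_simps)
  \<comment> \<open>The motion of the weight turns 1 - W into a product, so ln (1 - W) changes by ln
    (1 + y), which agrees with y to first order.\<close>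
  have yW: "1 - W' = (1 - W) * (1 + y)"
    using Cons.prems unfolding W'_def \<tau>_def y_def by (simp add: field_simps)
  have "y - y\<^sup>2 \<le> ln (1 + y)" using y \<delta> by (intro ln_one_plus_pos_lower_bound) auto
  also have "ln (1 + y) = ln (1 - W') - ln (1 - W)"
    unfolding yW using y Cons.prems by (subst ln_mult) auto
  finally have ln: "4 * y - 4 * ln (1 - W') \<le> - 4 * ln (1 - W) + 4 * y\<^sup>2" by simp
  have y2: "y\<^sup>2 \<le> \<delta>\<^sup>2" using y by (intro power_mono) auto
  have "log_energy N (chain_log (of_real (1 - \<delta>)) (\<kappa> # \<kappa>s)) W \<le>
      log_energy N (chain_log (of_real (1 - \<delta>)) \<kappa>s) W' + 4 * \<delta> * W / (1 + W) + 10000000 * \<delta>\<^sup>2"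
    unfolding W'_def \<tau>_def
  proof (rule log_energy_step[OF \<kappa>(1) \<delta> Cons.prems(2,3)])
    show "chain_log (of_real (1 - \<delta>)) \<kappa>s holomorphic_on ball 0 (1 / 2)"
      "chain_log (of_real (1 - \<delta>)) (\<kappa> # \<kappa>s) holomorphic_on ball 0 (1 / 2)"
      using chain_log_holomorphic[OF \<delta> refl] Cons.prems by auto
    show "norm (chain_log (of_real (1 - \<delta>)) \<kappa>s z) \<le> 44" if "norm z < 1 / 2" for z
      using chain_log_bound'[OF \<delta> refl \<kappa>(2)] that by simp
  qed simp
  also have "\<dots> \<le> (- 4 * ln (1 - W') + length \<kappa>s * 10000004 * \<delta>\<^sup>2) + 4 * y + 10000000 * \<delta>\<^sup>2"
    using Cons.IH[OF \<kappa>(2) W'] by (simp add: y_def)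
  also have "\<dots> \<le> - 4 * ln (1 - W) + length (\<kappa> # \<kappa>s) * 10000004 * \<delta>\<^sup>2"
    using ln y2 by (simp add: algebra_simps)
  finally show ?case .
qed

section \<open>The weighted coefficient bound\<close>

text \<open>Comparison of coefficients in E' = G' E for E = exp G.\<close>

lemma taylor_exp_rec:
  assumes G: "G holomorphic_on ball 0 R" and R: "R > 0"
  shows "of_nat (Suc n) * taylor (\<lambda>z. exp (G z)) (Suc n) =
    (\<Sum>i\<le>n. of_nat (Suc i) * taylor G (Suc i) * taylor (\<lambda>z. exp (G z)) (n - i))"
proof -
  have E: "(\<lambda>z. exp (G z)) holomorphic_on ball 0 R" by (intro holomorphic_intros G)
  have G': "deriv G holomorphic_on ball 0 R" using G by (intro holomorphic_deriv) auto
  have "of_nat (Suc n) * taylor (\<lambda>z. exp (G z)) (Suc n) = taylor (deriv (\<lambda>z. exp (G z))) n"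
    by (rule taylor_deriv[OF E R, symmetric])
  also have "\<dots> = taylor (\<lambda>z. deriv G z * exp (G z)) n"
  proof (rule taylor_cong[OF R])
    fix z :: complex assume "norm z < R"
    then have "(G has_field_derivative deriv G z) (at z)"
      using holomorphic_derivI[OF G] by simp
    then have "((\<lambda>z. exp (G z)) has_field_derivative deriv G z * exp (G z)) (at z)"
      by (auto intro!: derivative_eq_intros)
    then show "deriv (\<lambda>z. exp (G z)) z = deriv G z * exp (G z)" by (rule DERIV_imp_deriv)
  qed
  also have "\<dots> = (\<Sum>i\<le>n. taylor (deriv G) i * taylor (\<lambda>z. exp (G z)) (n - i))"
    by (rule taylor_mult[OF G' E R])
  finally show ?thesis by (simp only: taylor_deriv[OF G R])
qed

text \<open>The recursions of \<open>taylor_exp_rec\<close> for \<open>exp (C / 2)\<close> and for the exponential of \<open>\<Sum> k |c\<^sub>k|\<^sup>2 z\<^sup>k / 4\<close> are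
  compared by Cauchy-Schwarz.\<close>

lemma lebedev_milin:
  assumes C: "C holomorphic_on ball 0 R" and R: "R > 0" and C0: "C 0 = 0" and W: "0 \<le> W"
  shows "(\<Sum>n\<le>N. norm (taylor (\<lambda>z. exp (C z / 2)) n) ^ 2 * W ^ n) \<le> exp (log_energy N C W / 4)"
proof -
  define b where "b = taylor (\<lambda>z. exp (C z / 2))"
  \<comment> \<open>Cutting off beyond \<open>N\<close> makes \<open>p\<close> a polynomial, so its
    exponential is entire and can be evaluated at any W.\<close>
  define A where "A = (\<lambda>k. if k \<le> N then k * norm (taylor C k) ^ 2 / 4 else 0)"
  define p where "p = (\<lambda>z::complex. \<Sum>k\<le>N. of_real (A k) * z ^ k)"
  define e where "e = taylor (\<lambda>z. exp (p z))"
  have A0: "A k \<ge> 0" for k by (simp add: A_def)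
  have p: "p holomorphic_on ball 0 x" for x unfolding p_def by (intro holomorphic_intros)
  have tp: "taylor p k = of_real (A k)" for k
  proof (rule taylor_unique[of 1])
    fix z :: complex
    have "(\<lambda>k. of_real (A k) * z ^ k) sums (\<Sum>k\<in>{..N}. of_real (A k) * z ^ k)"
      by (rule sums_finite) (auto simp: A_def)
    then show "(\<lambda>n. of_real (A n) * z ^ n) sums p z" by (simp add: p_def)
  qed simp
  have C2: "(\<lambda>z. C z / 2) holomorphic_on ball 0 R" by (intro holomorphic_intros C) auto
  have tC: "taylor (\<lambda>z. C z / 2) k = taylor C k / 2" for k
    using taylor_cmult[OF C R, of "1/2" k] by simp
  have erec: "of_nat (Suc n) * e (Suc n) = (\<Sum>i\<le>n. of_nat (Suc i) * of_real (A (Suc i)) * e (n - i))" for n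
    using taylor_exp_rec[OF p zero_less_one, of n] unfolding e_def tp .
  have brec: "of_nat (Suc n) * b (Suc n) = (\<Sum>i\<le>n. of_nat (Suc i) * (taylor C (Suc i) / 2) * b (n - i))" for n
    using taylor_exp_rec[OF C2 R, of n] unfolding b_def tC .
  have key: "e n = of_real (Re (e n)) \<and> 0 \<le> Re (e n) \<and> (n \<le> N \<longrightarrow> norm (b n) ^ 2 \<le> Re (e n))" for n
  proof (induction n rule: less_induct)
    case (less m)
    show ?case
    proof (cases m)
      case 0
      have "p 0 = of_real (A 0)"
        unfolding p_def by (subst sum.atMost_shift) (simp add: power_0_left)
      then have "p 0 = 0" by (simp add: A_def)
      then have "e 0 = 1" by (simp add: e_def taylor_0)
      moreover have "b 0 = 1" by (simp add: b_def taylor_0 C0)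
      ultimately show ?thesis using 0 by simp
    next
      case (Suc n)
      have IH: "e (n - i) = of_real (Re (e (n - i)))" "0 \<le> Re (e (n - i))"
        "n - i \<le> N \<Longrightarrow> norm (b (n - i)) ^ 2 \<le> Re (e (n - i))" for i
        using less[of "n - i"] Suc by auto
      define S where "S = (\<Sum>i\<le>n. real (Suc i) * A (Suc i) * Re (e (n - i)))"
      have "of_nat (Suc n) * e (Suc n) = of_real S"
        unfolding erec S_def of_real_sum using IH(1)
        by (intro sum.cong refl) (metis of_real_mult of_real_of_nat_eq)
      then have e: "e (Suc n) = of_real (S / real (Suc n))"
        by (simp add: field_simps del: of_nat_Suc)
      have S0: "S \<ge> 0" unfolding S_def using IH A0 by (intro sum_nonneg) auto
      have "norm (b (Suc n)) ^ 2 \<le> S / real (Suc n)" if "Suc n \<le> N"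
      proof -
        define t where "t = (\<lambda>i. norm (of_nat (Suc i) * (taylor C (Suc i) / 2) * b (n - i)))"
        have "(real (Suc n) * norm (b (Suc n))) ^ 2 = norm (of_nat (Suc n) * b (Suc n)) ^ 2"
          by (simp add: norm_mult del: of_nat_Suc)
        also have "\<dots> \<le> (\<Sum>i\<le>n. 1 * t i) ^ 2"
          unfolding brec t_def mult_1_left by (intro power_mono norm_sum norm_ge_zero)
        \<comment> \<open>The sum of ones is n + 1 and cancels one of the two factors n + 1 on the
          left. In the other sum one factor i + 1 of the square goes into \<open>A\<close>, which
          explains its quarter.\<close>
        also have "\<dots> \<le> (\<Sum>i\<le>n. 1\<^sup>2) * (\<Sum>i\<le>n. (t i)\<^sup>2)" by (rule Cauchy_Schwarz_ineq_sum)
        also have "\<dots> = real (Suc n) * (\<Sum>i\<le>n. (t i)\<^sup>2)" by simp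
        also have "(\<Sum>i\<le>n. (t i)\<^sup>2) \<le> S" unfolding S_def
        proof (rule sum_mono)
          fix i assume "i \<in> {..n}"
          then have "i \<le> n" by simp
          then have "(t i)\<^sup>2 = real (Suc i) * A (Suc i) * norm (b (n - i)) ^ 2"
            using that unfolding t_def A_def
            by (simp add: norm_mult norm_divide power_mult_distrib power_divide power2_eq_square[of "real (Suc i)"] del: of_nat_Suc)
          also have "\<dots> \<le> real (Suc i) * A (Suc i) * Re (e (n - i))"
            using IH(3)[of i] that A0[of "Suc i"] by (intro mult_left_mono) auto
          finally show "(t i)\<^sup>2 \<le> real (Suc i) * A (Suc i) * Re (e (n - i))" .
        qed
        finally have "real (Suc n) * (real (Suc n) * norm (b (Suc n)) ^ 2) \<le> real (Suc n) * S"
          by (simp add: power_mult_distrib power2_eq_square[of "real (Suc n)"] mult.assoc del: of_nat_Suc)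
        then have "real (Suc n) * norm (b (Suc n)) ^ 2 \<le> S"
          by (simp del: of_nat_Suc)
        then show ?thesis by (simp add: field_simps del: of_nat_Suc)
      qed
      then show ?thesis unfolding Suc e using S0 by simp
    qed
  qed
  have "(\<lambda>n. e n * of_real W ^ n) sums exp (p W)"
    unfolding e_def by (rule taylor_sums[of _ "W + 1"]) (use W in \<open>auto intro!: holomorphic_intros p\<close>)
  from sums_Re[OF this] have s: "(\<lambda>n. Re (e n) * W ^ n) sums Re (exp (p W))"
    by (simp flip: of_real_power)
  have "p W = of_real (\<Sum>k\<le>N. A k * W ^ k)" by (simp add: p_def)
  then have "Re (exp (p W)) = exp (\<Sum>k\<le>N. A k * W ^ k)"
    by (simp only: exp_of_real Re_complex_of_real)
  also have "(\<Sum>k\<le>N. A k * W ^ k) = (\<Sum>k=1..N. A k * W ^ k)"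
    by (intro sum.mono_neutral_right) (auto simp: A_def Suc_le_eq)
  also have "\<dots> = log_energy N C W / 4"
    unfolding log_energy_def sum_divide_distrib by (intro sum.cong) (auto simp: A_def)
  finally have s': "(\<Sum>n. Re (e n) * W ^ n) = exp (log_energy N C W / 4)" using s by (simp add: sums_iff)
  have "(\<Sum>n\<le>N. norm (b n) ^ 2 * W ^ n) \<le> (\<Sum>n\<le>N. Re (e n) * W ^ n)"
    using key W by (intro sum_mono mult_right_mono) auto
  also have "\<dots> \<le> (\<Sum>n. Re (e n) * W ^ n)"
    using key W by (intro sum_le_suminf sums_summable[OF s]) auto
  finally show ?thesis by (simp add: s' b_def)
qed

lemma majorant_mult:
  assumes f: "f holomorphic_on ball 0 R" and g: "g holomorphic_on ball 0 R" and r: "0 \<le> r" "r < R"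
  shows "majorant (\<lambda>z. f z * g z) r \<le> majorant f r * majorant g r"
proof -
  have R: "R > 0" using r by simp
  have fg: "(\<lambda>z. f z * g z) holomorphic_on ball 0 R" by (intro holomorphic_intros f g)
  have s: "summable (\<lambda>k. norm (norm (taylor f k) * r ^ k))" "summable (\<lambda>k. norm (norm (taylor g k) * r ^ k))"
    using taylor_abs_summable[OF f r] taylor_abs_summable[OF g r] r by auto
  have "majorant (\<lambda>z. f z * g z) r \<le> (\<Sum>k. \<Sum>i\<le>k. norm (taylor f i) * r ^ i * (norm (taylor g (k - i)) * r ^ (k - i)))"
    unfolding majorant_def
  proof (rule suminf_le)
    fix n
    have "norm (taylor (\<lambda>z. f z * g z) n) * r ^ n \<le> (\<Sum>i\<le>n. norm (taylor f i * taylor g (n - i))) * r ^ n"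
      unfolding taylor_mult[OF f g R] using r by (intro mult_right_mono norm_sum) auto
    also have "\<dots> = (\<Sum>i\<le>n. norm (taylor f i) * r ^ i * (norm (taylor g (n - i)) * r ^ (n - i)))"
      unfolding sum_distrib_right
      by (intro sum.cong refl) (auto simp: norm_mult mult_ac power_add[symmetric])
    finally show "norm (taylor (\<lambda>z. f z * g z) n) * r ^ n \<le>
      (\<Sum>i\<le>n. norm (taylor f i) * r ^ i * (norm (taylor g (n - i)) * r ^ (n - i)))" .
  qed (use taylor_abs_summable[OF fg r] summable_Cauchy_product[OF s] in auto)
  also have "\<dots> = majorant f r * majorant g r"
    unfolding majorant_def by (rule Cauchy_product[OF s, symmetric])
  finally show ?thesis .
qed

text \<open>The weight W^n is split evenly between the coefficients and a geometric series, which
  contributes 1 / (1 - W).\<close>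

lemma majorant_cauchy_schwarz:
  assumes f: "f holomorphic_on ball 0 R" and W: "0 \<le> W" "W < R" "W < 1"
    and K: "\<And>N. (\<Sum>n\<le>N. norm (taylor f n) ^ 2 * W ^ n) \<le> K"
  shows "(majorant f W)\<^sup>2 \<le> K / (1 - W)"
proof -
  have K0: "0 \<le> K" using K[of 0] by (auto intro: order_trans[rotated])
  have "majorant f W \<le> sqrt (K / (1 - W))" unfolding majorant_def
  proof (rule suminf_le_const[OF taylor_abs_summable[OF f W(1,2)]])
    fix N
    define w where "w = sqrt W"
    have w: "w ^ n * w ^ n = W ^ n" for n using W by (simp add: w_def flip: power_mult_distrib)
    have "(\<Sum>n<N. norm (taylor f n) * W ^ n)\<^sup>2 = (\<Sum>n<N. (norm (taylor f n) * w ^ n) * w ^ n)\<^sup>2"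
      by (simp add: w mult.assoc)
    also have "\<dots> \<le> (\<Sum>n<N. (norm (taylor f n) * w ^ n)\<^sup>2) * (\<Sum>n<N. (w ^ n)\<^sup>2)"
      by (rule Cauchy_Schwarz_ineq_sum)
    also have "\<dots> = (\<Sum>n<N. norm (taylor f n) ^ 2 * W ^ n) * (\<Sum>n<N. W ^ n)"
      by (simp add: power_mult_distrib power2_eq_square[of "w ^ _"] w)
    also have "\<dots> \<le> K * (1 / (1 - W))"
    proof (rule mult_mono)
      have "(\<Sum>n<N. norm (taylor f n) ^ 2 * W ^ n) \<le> (\<Sum>n\<le>N. norm (taylor f n) ^ 2 * W ^ n)"
        using W by (intro sum_mono2) auto
      then show "(\<Sum>n<N. norm (taylor f n) ^ 2 * W ^ n) \<le> K" using K[of N] by linarith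
      have "(\<Sum>n<N. W ^ n) \<le> (\<Sum>n. W ^ n)" using W by (intro sum_le_suminf) auto
      then show "(\<Sum>n<N. W ^ n) \<le> 1 / (1 - W)" using W by (simp add: suminf_geometric)
    qed (use W K0 in \<open>auto intro!: sum_nonneg\<close>)
    finally show "(\<Sum>n<N. norm (taylor f n) * W ^ n) \<le> sqrt (K / (1 - W))"
      by (simp add: real_le_rsqrt)
  qed
  then have "(majorant f W)\<^sup>2 \<le> (sqrt (K / (1 - W)))\<^sup>2"
    using majorant_nonneg[OF f W(1,2)] by (intro power_mono) auto
  then show ?thesis using K0 W by simp
qed

section \<open>From osculation chains to all univalent functions\<close>

lemma osc_holomorphic:
  fixes s :: real
  assumes s: "0 \<le> s" "s < 1" and \<kappa>: "norm \<kappa> = 1"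
  shows "osc s \<kappa> holomorphic_on ball 0 1"
proof -
  have "1 + of_real s * \<kappa> * z \<noteq> 0" if "norm z < 1" for z
  proof (rule one_plus_nonzero)
    show "norm (of_real s * \<kappa> * z) < 1"
      using norm_mult_lt_1[of "of_real s * \<kappa>" z] that s \<kappa> by (simp add: norm_mult)
  qed
  then show ?thesis unfolding osc_def by (intro holomorphic_intros) auto
qed

lemma osc_chain_holomorphic:
  fixes s :: real
  assumes s: "0 \<le> s" "s < 1"
  shows "\<forall>\<kappa>\<in>set \<kappa>s. norm \<kappa> = 1 \<Longrightarrow> osc_chain s \<kappa>s holomorphic_on ball 0 1"
proof (induction \<kappa>s)
  case Nil
  have "osc_chain s [] = (\<lambda>z. z)" by auto
  then show ?case by simp
next
  case (Cons \<kappa> \<kappa>s)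
  have "(\<lambda>z. osc_chain s \<kappa>s (osc s \<kappa> z)) holomorphic_on ball 0 1"
  proof (rule holomorphic_on_compose_disc[where u = "osc s \<kappa>"])
    show "norm (osc s \<kappa> z) < 1" if "norm z < 1" for z
      using norm_osc_le_self[of s \<kappa> z] that s Cons.prems by simp
  qed (use Cons s osc_holomorphic in auto)
  also have "(\<lambda>z. osc_chain s \<kappa>s (osc s \<kappa> z)) = osc_chain s (\<kappa> # \<kappa>s)" by auto
  finally show ?case .
qed

text \<open>The chain is z times the square of exp (C / 2), up to its derivative at 0. One factor 1
  / (1 - W) comes from the energy bound, whose - 4 ln (1 - W) is divided by 4 in Lebedev-Milin, the
  other from Cauchy-Schwarz; with the leading z they form \<open>koebe W\<close>. The error constant
  2500001 is a quarter of 10000004.\<close>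

lemma majorant_osc_chain:
  fixes \<delta> W :: real
  assumes \<delta>: "0 < \<delta>" "\<delta> \<le> 1 / 20" and \<kappa>s: "\<forall>\<kappa>\<in>set \<kappa>s. norm \<kappa> = 1" and W: "0 \<le> W" "W \<le> 1 / 10"
  shows "majorant (osc_chain (of_real (1 - \<delta>)) \<kappa>s) W \<le>
    (1 - \<delta>) ^ length \<kappa>s * koebe W * exp (length \<kappa>s * 2500001 * \<delta>\<^sup>2)"
proof -
  define s :: complex where "s = of_real (1 - \<delta>)"
  define C where "C = chain_log s \<kappa>s"
  define \<beta> where "\<beta> = (\<lambda>z. exp (C z / 2))"
  define K where "K = exp (length \<kappa>s * 2500001 * \<delta>\<^sup>2) / (1 - W)"
  have C: "C holomorphic_on ball 0 (1/2)" unfolding C_def by (rule chain_log_holomorphic[OF \<delta> s_def \<kappa>s])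
  have C0: "C 0 = 0" unfolding C_def by (rule chain_log_0[OF \<delta> s_def])
  have \<beta>: "\<beta> holomorphic_on ball 0 (1/2)" unfolding \<beta>_def by (intro holomorphic_intros C) auto
  have K: "(\<Sum>n\<le>N. norm (taylor \<beta> n) ^ 2 * W ^ n) \<le> K" for N
  proof -
    have "(\<Sum>n\<le>N. norm (taylor \<beta> n) ^ 2 * W ^ n) \<le> exp (log_energy N C W / 4)"
      unfolding \<beta>_def by (rule lebedev_milin[OF C _ C0 W(1)]) simp
    also have "\<dots> \<le> exp (length \<kappa>s * 2500001 * \<delta>\<^sup>2 - ln (1 - W))"
      using log_energy_chain_log[OF \<delta> \<kappa>s W, of N] by (simp add: C_def s_def)
    also have "\<dots> = K" using W by (simp add: K_def exp_diff)
    finally show "(\<Sum>n\<le>N. norm (taylor \<beta> n) ^ 2 * W ^ n) \<le> K" .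
  qed
  have "majorant (osc_chain s \<kappa>s) W = majorant (\<lambda>z. z * (s ^ length \<kappa>s * (\<beta> z * \<beta> z))) W"
  proof (rule majorant_cong[of "1/2"])
    fix z :: complex assume "norm z < 1 / 2"
    then show "osc_chain s \<kappa>s z = z * (s ^ length \<kappa>s * (\<beta> z * \<beta> z))"
      using osc_chain_eq_exp[OF \<delta> s_def \<kappa>s, of z] by (simp add: \<beta>_def C_def mult_ac flip: exp_add)
  qed simp
  also have "\<dots> = W * majorant (\<lambda>z. s ^ length \<kappa>s * (\<beta> z * \<beta> z)) W"
    by (rule majorant_mult_left[of _ "1/2"]) (use W in \<open>auto intro!: holomorphic_intros \<beta>\<close>)
  also have "majorant (\<lambda>z. s ^ length \<kappa>s * (\<beta> z * \<beta> z)) W = (1 - \<delta>) ^ length \<kappa>s * majorant (\<lambda>z. \<beta> z * \<beta> z) W"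
  proof -
    have \<beta>\<beta>: "(\<lambda>z. \<beta> z * \<beta> z) holomorphic_on ball 0 (1/2)" by (intro holomorphic_intros \<beta>)
    have "norm s = 1 - \<delta>" using \<delta> unfolding s_def norm_of_real by simp
    then have "majorant (\<lambda>z. s ^ length \<kappa>s * (\<beta> z * \<beta> z)) W = (\<Sum>n. (1 - \<delta>) ^ length \<kappa>s * (norm (taylor (\<lambda>z. \<beta> z * \<beta> z) n) * W ^ n))"
      unfolding majorant_def using taylor_cmult[OF \<beta>\<beta>] by (simp add: norm_mult norm_power mult.assoc)
    also have "\<dots> = (1 - \<delta>) ^ length \<kappa>s * majorant (\<lambda>z. \<beta> z * \<beta> z) W"
      unfolding majorant_def using W by (intro suminf_mult taylor_abs_summable[OF \<beta>\<beta>]) auto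
    finally show ?thesis .
  qed
  also have "majorant (\<lambda>z. \<beta> z * \<beta> z) W \<le> majorant \<beta> W * majorant \<beta> W"
    using W by (intro majorant_mult[OF \<beta> \<beta>]) auto
  also have "\<dots> \<le> K / (1 - W)"
    using majorant_cauchy_schwarz[OF \<beta> W(1) _ _ K] W by (simp add: power2_eq_square)
  finally have "majorant (osc_chain s \<kappa>s) W \<le> W * ((1 - \<delta>) ^ length \<kappa>s * (K / (1 - W)))"
    using W \<delta> by (simp add: mult_left_mono)
  also have "\<dots> = (1 - \<delta>) ^ length \<kappa>s * koebe W * exp (length \<kappa>s * 2500001 * \<delta>\<^sup>2)"
    by (simp add: K_def koebe_def power2_eq_square)
  finally show ?thesis by (simp add: s_def)
qed

text \<open>Factor \<open>b\<close> into small osculation steps with x = y^2 and let y tend to 1.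
  Taking y as parameter removes the square root: the step size 1 - 2 y / (1 + y^2) is
  \<open>d y\<close>.\<close>

lemma majorant_univalent_self_map:
  assumes b: "univalent_self_map b" and r: "0 \<le> r" "r \<le> 1 / 10"
  shows "majorant b r \<le> norm (deriv b 0) * koebe r"
proof -
  define D where "D = norm (deriv b 0)"
  define d where "d = (\<lambda>y::real. (1 - y)\<^sup>2 / (1 + y\<^sup>2))"
  have "deriv b 0 \<noteq> 0"
    using b holomorphic_injective_imp_regular[of b "ball 0 1" 0] by (auto simp: univalent_self_map_def)
  then have D: "D > 0" by (simp add: D_def)
  have "majorant b r \<le> D / y\<^sup>2 * koebe r * exp (- ln D * 2500001 * d y)" if y: "3 / 4 < y" "y < 1" for y
  proof -
    define \<delta> where "\<delta> = d y"
    have y2: "9 / 16 < y\<^sup>2" using y power_strict_mono[of "3/4" y 2] by (simp add: power2_eq_square)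
    have "(1 - y)\<^sup>2 \<le> (1 / 4)\<^sup>2" using y by (intro power_mono) auto
    then have \<delta>: "0 < \<delta>" "\<delta> \<le> 1 / 20" using y y2 unfolding \<delta>_def d_def
      by (auto simp: field_simps power2_eq_square[of "1/4"] intro!: divide_pos_pos add_pos_pos)
    have s: "1 - \<delta> = 2 * sqrt (y\<^sup>2) / (1 + y\<^sup>2)"
      using y y2 unfolding \<delta>_def d_def by (simp add: field_simps) (simp add: power2_eq_square algebra_simps)
    obtain N where N: "(1 - \<delta>) ^ N < D" using real_arch_pow_inv[of D "1 - \<delta>"] D \<delta> by auto
    obtain \<kappa>s u where u: "\<forall>\<kappa>\<in>set \<kappa>s. norm \<kappa> = 1" "univalent_self_map u" "y\<^sup>2 \<le> norm (deriv u 0)"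
      "D = (1 - \<delta>) ^ length \<kappa>s * norm (deriv u 0)"
      "\<And>z. norm z < 1 \<Longrightarrow> b z = osc_chain (of_real (1 - \<delta>)) \<kappa>s (u z)"
      using osc_chain_factorization[of "y\<^sup>2" "1 - \<delta>" b N] y b N s
      by (auto simp: D_def power_less_one_iff)
    define n where "n = length \<kappa>s"
    have u': "norm (deriv u 0) \<le> 1" using Schwarz_Lemma(2)[of u 0] u(2) by (auto simp: univalent_self_map_def)
    \<comment> \<open>Bounds the number of steps: n \<delta> \<le> - ln D, so an error of order n
      \<delta>^2 tends to 0 with \<delta>.\<close>
    have "D \<le> (1 - \<delta>) ^ n * 1" unfolding u(4) n_def using \<delta> u' by (intro mult_left_mono) auto
    then have "ln D \<le> ln ((1 - \<delta>) ^ n)" using D by simp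
    also have "\<dots> = n * ln (1 - \<delta>)" using \<delta> by (simp add: ln_realpow)
    also have "\<dots> \<le> n * (- \<delta>)" using ln_add_one_self_le_self2[of "- \<delta>"] \<delta> by (intro mult_left_mono) auto
    finally have n\<delta>: "n * \<delta> \<le> - ln D" by simp
    have "majorant b r = majorant (\<lambda>z. osc_chain (of_real (1 - \<delta>)) \<kappa>s (u z)) r"
      by (rule majorant_cong[of 1]) (use u in auto)
    \<comment> \<open>The leftover \<open>u\<close> disappears here by Bohr's inequality; the price
      is the factor 1 / y^2 coming from |u'(0)| \<ge> y^2.\<close>
    also have "\<dots> \<le> majorant (osc_chain (of_real (1 - \<delta>)) \<kappa>s) r"
      using u(2) \<delta> r osc_chain_holomorphic[OF _ _ u(1), of "1 - \<delta>"]
      by (intro majorant_compose) (auto simp: univalent_self_map_def)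
    also have "\<dots> \<le> (1 - \<delta>) ^ n * koebe r * exp (n * 2500001 * \<delta>\<^sup>2)"
      unfolding n_def by (rule majorant_osc_chain[OF \<delta> u(1) r])
    also have "\<dots> \<le> (D / y\<^sup>2) * koebe r * exp (- ln D * 2500001 * \<delta>)"
    proof (intro mult_mono)
      have "(1 - \<delta>) ^ n * y\<^sup>2 \<le> D" unfolding u(4) n_def using \<delta> u(3) by (intro mult_left_mono) auto
      then show "(1 - \<delta>) ^ n \<le> D / y\<^sup>2" using y by (simp add: field_simps)
      have "n * \<delta> * (2500001 * \<delta>) \<le> - ln D * (2500001 * \<delta>)" using n\<delta> \<delta> by (intro mult_right_mono) auto
      then show "exp (n * 2500001 * \<delta>\<^sup>2) \<le> exp (- ln D * 2500001 * \<delta>)"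
        by (simp add: power2_eq_square mult_ac)
    qed (use r D in \<open>auto simp: koebe_def intro!: divide_nonneg_nonneg mult_nonneg_nonneg\<close>)
    finally show ?thesis by (simp add: \<delta>_def)
  qed
  then have "eventually (\<lambda>y. majorant b r \<le> D / y\<^sup>2 * koebe r * exp (- ln D * 2500001 * d y)) (at_left 1)"
    using eventually_at_left_real[of "3/4" "1::real"] by (auto elim!: eventually_mono)
  moreover have "((\<lambda>y. D / y\<^sup>2 * koebe r * exp (- ln D * 2500001 * d y)) \<longlongrightarrow>
      D / 1\<^sup>2 * koebe r * exp (- ln D * 2500001 * ((1 - 1)\<^sup>2 / (1 + 1\<^sup>2)))) (at_left 1)"
    unfolding d_def by (intro tendsto_intros) auto
  ultimately have "majorant b r \<le> D / 1\<^sup>2 * koebe r * exp (- ln D * 2500001 * ((1 - 1)\<^sup>2 / (1 + 1\<^sup>2)))"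
    by (intro tendsto_lowerbound) auto
  then show ?thesis by (simp add: D_def)
qed

text \<open>On the disc of radius \<rho> < 1 the function is bounded and can be rescaled to a
  univalent self-map; the bound is homogeneous in f. Partial sums are finite, so \<rho> can tend to
  1 term by term.\<close>

theorem majorant_univalent:
  assumes hol: "f holomorphic_on ball 0 1" and inj: "inj_on f (ball 0 1)" and r: "0 \<le> r" "r \<le> 1 / 10"
  shows "majorant (\<lambda>z. f z - f 0) r \<le> norm (deriv f 0) * koebe r"
proof -
  define g where "g = (\<lambda>z. f z - f 0)"
  have g: "g holomorphic_on ball 0 1" unfolding g_def by (intro holomorphic_intros hol)
  have "(f has_field_derivative deriv f 0) (at 0)" using holomorphic_derivI[OF hol] by simp
  then have g': "(g has_field_derivative deriv f 0) (at 0)"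
    unfolding g_def by (auto intro!: derivative_eq_intros)
  have dg: "deriv g 0 = deriv f 0" using g' by (rule DERIV_imp_deriv)
  have main: "(\<Sum>n<N. norm (taylor g n) * (\<rho> * r) ^ n) \<le> \<rho> * norm (deriv f 0) * koebe r"
    if \<rho>: "0 < \<rho>" "\<rho> < 1" for \<rho> N
  proof -
    have "compact (g ` cball 0 \<rho>)" using g \<rho>
      by (intro compact_continuous_image holomorphic_on_imp_continuous_on) (auto intro: holomorphic_on_subset)
    then obtain M where M: "M > 0" "\<And>z. norm z \<le> \<rho> \<Longrightarrow> norm (g z) \<le> M"
      using compact_imp_bounded[of "g ` cball 0 \<rho>"] by (auto simp: bounded_pos)
    have \<rho>z: "norm (of_real \<rho> * z) < 1" if "norm z < 1" for z :: complex
      using norm_mult_lt_1[of "of_real \<rho>" z] that \<rho> by simp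
    have gr: "(\<lambda>z. g (of_real \<rho> * z)) holomorphic_on ball 0 1"
      by (rule holomorphic_on_compose_disc[OF g _ \<rho>z]) (auto intro!: holomorphic_intros)
    \<comment> \<open>The factor 2 turns the bound \<open>M\<close> into the strict inequality
      demanded of a self-map.\<close>
    define b where "b = (\<lambda>z. of_real (1 / (2 * M)) * g (of_real \<rho> * z))"
    have tb: "taylor b n = of_real (1 / (2 * M)) * (of_real \<rho> ^ n * taylor g n)" for n
      unfolding b_def taylor_cmult[OF gr zero_less_one]
      using taylor_scale[OF g zero_less_one, of "of_real \<rho>"] \<rho> by simp
    have b: "univalent_self_map b" unfolding univalent_self_map_def
    proof (intro conjI allI impI)
      show "b holomorphic_on ball 0 1" unfolding b_def by (intro holomorphic_intros gr)
      show "inj_on b (ball 0 1)"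
      proof (rule inj_onI)
        fix z w :: complex assume "z \<in> ball 0 1" "w \<in> ball 0 1" "b z = b w"
        then have "f (of_real \<rho> * z) = f (of_real \<rho> * w)" using M(1) by (simp add: b_def g_def)
        then have "of_real \<rho> * z = of_real \<rho> * w"
          using \<rho>z[of z] \<rho>z[of w] \<open>z \<in> _\<close> \<open>w \<in> _\<close> inj by (auto dest!: inj_onD)
        then show "z = w" using \<rho> by simp
      qed
      show "b 0 = 0" by (simp add: b_def g_def)
      fix z :: complex assume "norm z < 1"
      then have "norm (g (of_real \<rho> * z)) \<le> M" using \<rho> by (intro M) (simp add: norm_mult mult_left_le)
      then show "norm (b z) < 1" using M(1) by (simp add: b_def norm_mult norm_divide field_simps)
    qed
    have "(\<Sum>n<N. norm (taylor b n) * r ^ n) \<le> majorant b r"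
      unfolding majorant_def using b r taylor_abs_summable[of b 1 r]
      by (intro sum_le_suminf) (auto simp: univalent_self_map_def)
    also have "\<dots> \<le> norm (deriv b 0) * koebe r" by (rule majorant_univalent_self_map[OF b r])
    also have "deriv b 0 = of_real (1 / (2 * M)) * (of_real \<rho> * deriv f 0)"
      using tb[of 1] taylor_1[of b] taylor_1[of g] by (simp add: dg)
    also have "(\<Sum>n<N. norm (taylor b n) * r ^ n) = (1 / (2 * M)) * (\<Sum>n<N. norm (taylor g n) * (\<rho> * r) ^ n)"
      using M(1) \<rho> by (simp add: tb norm_mult norm_divide norm_power sum_divide_distrib power_mult_distrib mult_ac)
    finally show ?thesis using M(1) \<rho> by (simp add: norm_mult norm_divide field_simps)
  qed
  show ?thesis unfolding majorant_def g_def[symmetric]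
  proof (rule suminf_le_const)
    show "summable (\<lambda>n. norm (taylor g n) * r ^ n)" using taylor_abs_summable[OF g] r by simp
    fix N
    have 1: "((\<lambda>\<rho>. (\<Sum>n<N. norm (taylor g n) * (\<rho> * r) ^ n)) \<longlongrightarrow> (\<Sum>n<N. norm (taylor g n) * (1 * r) ^ n)) (at_left 1)"
      "((\<lambda>\<rho>. \<rho> * norm (deriv f 0) * koebe r) \<longlongrightarrow> 1 * norm (deriv f 0) * koebe r) (at_left 1)"
      by (intro tendsto_intros)+
    have "eventually (\<lambda>\<rho>. (\<Sum>n<N. norm (taylor g n) * (\<rho> * r) ^ n) \<le> \<rho> * norm (deriv f 0) * koebe r) (at_left 1)"
      using eventually_at_left_real[of 0 "1::real"] main by (auto elim!: eventually_mono)
    from tendsto_le[OF _ 1(2,1) this]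
    show "(\<Sum>n<N. norm (taylor g n) * r ^ n) \<le> norm (deriv f 0) * koebe r" by simp
  qed
qed

text \<open>The linear terms of \<open>majorant_univalent\<close> agree on both sides; what is left
  of the first terms can be divided by r^2 before r tends to 0.\<close>

lemma bieberbach_second_coefficient:
  assumes hol: "f holomorphic_on ball 0 1" and inj: "inj_on f (ball 0 1)"
  shows "norm (taylor f 2) \<le> 2 * norm (deriv f 0)"
proof -
  define g where "g = (\<lambda>z. f z - f 0)"
  define D where "D = norm (deriv f 0)"
  have g: "g holomorphic_on ball 0 1" unfolding g_def by (intro holomorphic_intros hol)
  have tg: "taylor g n = taylor f n" if "n > 0" for n
    unfolding g_def using taylor_diff[OF hol, of "\<lambda>_. f 0" n] that
    by (simp add: fps_expansion_def higher_deriv_const)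
  have "norm (taylor f 2) \<le> D * (2 - r) / (1 - r)\<^sup>2" if r: "0 < r" "r < 1 / 10" for r
  proof -
    have "(\<Sum>n<3. norm (taylor g n) * r ^ n) \<le> majorant g r"
      unfolding majorant_def using r taylor_abs_summable[OF g, of r] by (intro sum_le_suminf) auto
    also have "\<dots> \<le> D * koebe r"
      unfolding g_def D_def using r by (intro majorant_univalent hol inj) auto
    finally have "D * r + norm (taylor f 2) * r\<^sup>2 \<le> D * koebe r"
      using tg[of 1] tg[of 2] taylor_1[of f] by (simp add: eval_nat_numeral taylor_0 g_def D_def)
    moreover have "D * koebe r - D * r = (D * (2 - r) / (1 - r)\<^sup>2) * r\<^sup>2"
      using r by (simp add: koebe_def field_simps) (simp add: power2_eq_square algebra_simps)
    ultimately have "norm (taylor f 2) * r\<^sup>2 \<le> (D * (2 - r) / (1 - r)\<^sup>2) * r\<^sup>2" by linarith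
    then show ?thesis using r by (simp only: mult_le_cancel_right_pos zero_less_power)
  qed
  then have "eventually (\<lambda>r. norm (taylor f 2) \<le> D * (2 - r) / (1 - r)\<^sup>2) (at_right 0)"
    using eventually_at_right_real[of 0 "1/10::real"] by (auto elim!: eventually_mono)
  moreover have "((\<lambda>r. D * (2 - r) / (1 - r)\<^sup>2) \<longlongrightarrow> D * (2 - 0) / (1 - 0)\<^sup>2) (at_right 0)"
    by (intro tendsto_intros) auto
  ultimately have "norm (taylor f 2) \<le> D * (2 - 0) / (1 - 0)\<^sup>2"
    by (intro tendsto_lowerbound) auto
  then show ?thesis by (simp add: D_def)
qed

section \<open>The quarter theorem and the distortion theorem\<close>

lemma moebius_nonzero:
  assumes "norm w < 1" "norm z < (1::real)"
  shows "1 + cnj w * z \<noteq> 0" "1 - cnj w * z \<noteq> 0"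
  using one_plus_nonzero[OF norm_mult_lt_1[of "cnj w" z]] assms by auto

lemma moebius_deriv:
  assumes "norm w < 1" "norm z < 1"
  shows "(Moebius_function 0 w has_field_derivative (1 - (norm w)\<^sup>2) / (1 - cnj w * z)\<^sup>2) (at z)"
proof -
  have "((\<lambda>z. (z - w) / (1 - cnj w * z)) has_field_derivative
      ((1 - cnj w * z) - (z - w) * (- cnj w)) / ((1 - cnj w * z) * (1 - cnj w * z))) (at z)"
    using moebius_nonzero(2)[OF assms] by (auto intro!: derivative_eq_intros)
  also have "(1 - cnj w * z) - (z - w) * (- cnj w) = of_real (1 - (norm w)\<^sup>2)"
    by (simp only: of_real_diff of_real_1 complex_norm_square) (simp add: algebra_simps)
  finally show ?thesis
    by (simp add: Moebius_function_simple[abs_def] power2_eq_square[of "1 - _"])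
qed

lemma one_minus_norm_sq:
  assumes "norm (w::complex) < 1"
  shows "norm (1 - (norm w)\<^sup>2 :: complex) = 1 - (norm w)\<^sup>2" "0 < 1 - (norm w)\<^sup>2"
proof -
  show p: "0 < 1 - (norm w)\<^sup>2" using assms by (simp add: power_less_one_iff)
  have "(1 - (norm w)\<^sup>2 :: complex) = of_real (1 - (norm w)\<^sup>2)" by simp
  then show "norm (1 - (norm w)\<^sup>2 :: complex) = 1 - (norm w)\<^sup>2" using p by (simp only: norm_of_real abs_of_pos)
qed

text \<open>The Schwarz lemma for \<open>w\<close> conjugated by the Moebius maps that move z and
  w(z) to 0. The real quantities \<open>p\<close> and \<open>q\<close> are kept as complex numbers
  for the derivative computation.\<close>

lemma schwarz_pick_deriv:
  assumes hol: "w holomorphic_on ball 0 1" and w1: "\<And>z. norm z < 1 \<Longrightarrow> norm (w z) < 1" and z: "norm z < 1"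
  shows "norm (deriv w z) * (1 - (norm z)\<^sup>2) \<le> 1 - (norm (w z))\<^sup>2"
proof -
  define F where "F = (\<lambda>\<zeta>. Moebius_function 0 (w z) (w (Moebius_function 0 (- z) \<zeta>)))"
  have m1: "norm (Moebius_function 0 (- z) \<zeta>) < 1" if "norm \<zeta> < 1" for \<zeta>
    using that z by (intro Moebius_function_norm_lt_1) auto
  have M0: "Moebius_function 0 (- z) 0 = z" by (simp add: Moebius_function_simple)
  have "(\<lambda>\<zeta>. w (Moebius_function 0 (- z) \<zeta>)) holomorphic_on ball 0 1"
    by (rule holomorphic_on_compose_disc[OF hol Moebius_function_holomorphic m1]) (use z in auto)
  then have F: "F holomorphic_on ball 0 1" unfolding F_def
    by (rule holomorphic_on_compose_disc[OF Moebius_function_holomorphic[OF w1[OF z]]]) (use m1 w1 in auto)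
  have F1: "norm (deriv F 0) \<le> 1"
    using w1 z m1 by (intro Schwarz_Lemma(2)[OF F, of 0])
      (auto simp: F_def M0 Moebius_function_eq_zero intro!: Moebius_function_norm_lt_1)
  define p :: complex where "p = of_real (1 - (norm (w z))\<^sup>2)"
  define q :: complex where "q = of_real (1 - (norm z)\<^sup>2)"
  have p: "1 - cnj (w z) * w z = p"
    unfolding p_def of_real_diff complex_norm_square by (simp add: mult.commute)
  have "(F has_field_derivative p / p\<^sup>2 * (deriv w z * q)) (at 0)"
  proof -
    have "(Moebius_function 0 (- z) has_field_derivative q) (at 0)"
      using moebius_deriv[of "- z" 0] z by (simp add: q_def)
    moreover have "(w has_field_derivative deriv w z) (at (Moebius_function 0 (- z) 0))"
      using holomorphic_derivI[OF hol, of z] z by (simp add: M0)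
    ultimately have d1: "((\<lambda>\<zeta>. w (Moebius_function 0 (- z) \<zeta>)) has_field_derivative deriv w z * q) (at 0)"
      by (intro DERIV_chain2)
    have d2: "(Moebius_function 0 (w z) has_field_derivative p / p\<^sup>2) (at (w (Moebius_function 0 (- z) 0)))"
      using moebius_deriv[of "w z" "w z"] w1[OF z] unfolding p M0 by (simp add: p_def)
    from DERIV_chain2[OF d2 d1] show ?thesis unfolding F_def .
  qed
  then have "deriv F 0 = p / p\<^sup>2 * (deriv w z * q)" by (rule DERIV_imp_deriv)
  then have F2: "norm (deriv F 0) = norm p / (norm p)\<^sup>2 * (norm (deriv w z) * norm q)"
    by (simp only: norm_mult norm_divide norm_power)
  have "0 < 1 - (norm (w z))\<^sup>2" "0 < 1 - (norm z)\<^sup>2"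
    using one_minus_norm_sq(2) w1[OF z] z by auto
  then have pq: "norm p = 1 - (norm (w z))\<^sup>2" "norm q = 1 - (norm z)\<^sup>2" "0 < norm p"
    unfolding p_def q_def norm_of_real by auto
  have "norm p / (norm p)\<^sup>2 * (norm (deriv w z) * norm q) = (norm (deriv w z) * norm q) / norm p"
    using pq(3) by (simp add: power2_eq_square)
  then have "(norm (deriv w z) * norm q) / norm p \<le> 1" using F1 F2 by simp
  then show ?thesis using pq by (simp add: divide_le_eq)
qed

lemma univalent_deriv_nonzero:
  assumes "f holomorphic_on ball 0 1" "inj_on f (ball 0 1)" "norm z < 1"
  shows "deriv f z \<noteq> 0"
  using holomorphic_injective_imp_regular[OF assms(1) open_ball assms(2), of z] assms(3) by simp

lemma taylor_const: "taylor (\<lambda>_. c) n = (if n = 0 then c else 0)"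
  by (simp add: fps_expansion_def higher_deriv_const)

text \<open>As f omits \<open>w\<close>, the map \<open>F\<close> = c g / (c - g) is again univalent
  with the same derivative at 0, and its second coefficient exceeds that of f by the square of f'(0)
  over c. Bieberbach's bound for both gives |f'(0)|^2 / |c| \<le> 4 |f'(0)|.\<close>

lemma koebe_quarter:
  assumes hol: "f holomorphic_on ball 0 1" and inj: "inj_on f (ball 0 1)" and w: "w \<notin> f ` ball 0 1"
  shows "norm (deriv f 0) / 4 \<le> dist (f 0) w"
proof -
  define c where "c = w - f 0"
  define g where "g = (\<lambda>z. f z - f 0)"
  define F where "F = (\<lambda>z. c * g z / (c - g z))"
  have c0: "c \<noteq> 0" using w by (auto simp: c_def image_iff dest: bspec[of _ _ 0])
  have gc: "c - g z \<noteq> 0" if "norm z < 1" for z using w that by (auto simp: c_def g_def)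
  have g: "g holomorphic_on ball 0 1" unfolding g_def by (intro holomorphic_intros hol)
  have F: "F holomorphic_on ball 0 1" unfolding F_def using gc by (intro holomorphic_intros g) auto
  have tg: "taylor g n = (if n = 0 then 0 else taylor f n)" for n
    unfolding g_def using taylor_diff[OF hol, of "\<lambda>_. f 0" n]
    by (simp add: taylor_const taylor_0)
  have inj': "inj_on F (ball 0 1)"
  proof (rule inj_onI)
    fix x y :: complex assume xy: "x \<in> ball 0 1" "y \<in> ball 0 1" "F x = F y"
    then have "c * g x * (c - g y) = c * g y * (c - g x)"
      using gc[of x] gc[of y] by (simp add: F_def frac_eq_eq)
    then have "c * c * (g x - g y) = 0" by (simp add: algebra_simps)
    then have "f x = f y" using c0 by (simp add: g_def)
    then show "x = y" using inj xy by (auto dest: inj_onD)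
  qed
  have h: "(\<lambda>z. c - g z) holomorphic_on ball 0 1" by (intro holomorphic_intros g)
  have th: "taylor (\<lambda>z. c - g z) n = (if n = 0 then c else - taylor f n)" for n
    using taylor_diff[OF _ g, of "\<lambda>_. c" n] by (simp add: taylor_const tg)
  have e: "taylor (\<lambda>z. F z * (c - g z)) n = c * taylor g n" for n
    unfolding taylor_cmult[OF g zero_less_one, symmetric]
    by (rule taylor_cong[of 1]) (use gc in \<open>auto simp: F_def\<close>)
  have F0: "taylor F 0 = 0" by (simp add: taylor_0 F_def g_def)
  have "taylor F 1 * c = c * taylor f 1"
    using e[of 1] unfolding taylor_mult[OF F h zero_less_one] by (simp add: th tg F0)
  then have F1: "taylor F 1 = taylor f 1" using c0 by simp
  have "taylor F 1 * (- taylor f 1) + taylor F 2 * c = c * taylor f 2"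
    using e[of 2] unfolding taylor_mult[OF F h zero_less_one] by (simp add: th tg F0 numeral_2_eq_2)
  then have F2: "taylor F 2 = taylor f 2 + (taylor f 1)\<^sup>2 / c"
    using c0 by (simp add: F1[unfolded One_nat_def] field_simps power2_eq_square)
  define D where "D = norm (deriv f 0)"
  have D0: "D > 0" using univalent_deriv_nonzero[OF hol inj, of 0] by (simp add: D_def)
  have "deriv F 0 = deriv f 0" using F1 taylor_1[of F] taylor_1[of f] by simp
  then have "norm (taylor F 2) \<le> 2 * D"
    using bieberbach_second_coefficient[OF F inj'] by (simp add: D_def)
  moreover have "norm (taylor f 2) \<le> 2 * D"
    using bieberbach_second_coefficient[OF hol inj] by (simp add: D_def)
  ultimately have "norm ((taylor f 1)\<^sup>2 / c) \<le> 4 * D"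
    using norm_triangle_ineq4[of "taylor F 2" "taylor f 2"] by (simp add: F2)
  then have "D * D \<le> D * (4 * norm c)"
    using c0 taylor_1[of f] by (simp add: norm_divide norm_mult D_def field_simps power2_eq_square)
  then have "D \<le> 4 * norm c" using D0 by simp
  then show ?thesis by (simp add: D_def c_def dist_norm norm_minus_commute)
qed

text \<open>Bieberbach's bound for the Koebe transform of \<open>f\<close> at \<open>z\<close>.\<close>

lemma koebe_transform_bound:
  assumes hol: "f holomorphic_on ball 0 1" and inj: "inj_on f (ball 0 1)" and z: "norm z < 1"
  shows "norm (deriv (deriv f) z * (1 - (norm z)\<^sup>2) - 2 * cnj z * deriv f z) \<le> 4 * norm (deriv f z)"
proof -
  define M where "M = Moebius_function 0 (- z)"
  define F where "F = (\<lambda>\<zeta>. f (M \<zeta>))"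
  define q :: complex where "q = 1 - (norm z)\<^sup>2"
  have q: "norm q = 1 - (norm z)\<^sup>2" "0 < 1 - (norm z)\<^sup>2"
    unfolding q_def using one_minus_norm_sq[OF z] by auto
  have m1: "norm (M \<zeta>) < 1" if "norm \<zeta> < 1" for \<zeta>
    unfolding M_def using that z by (intro Moebius_function_norm_lt_1) auto
  have M0: "M 0 = z" by (simp add: M_def Moebius_function_simple)
  have M: "M holomorphic_on ball 0 1" unfolding M_def using z by (intro Moebius_function_holomorphic) auto
  have F: "F holomorphic_on ball 0 1" unfolding F_def by (rule holomorphic_on_compose_disc[OF hol M m1])
  have inj': "inj_on F (ball 0 1)"
  proof (rule inj_onI)
    fix x y :: complex assume xy: "x \<in> ball 0 1" "y \<in> ball 0 1" "F x = F y"
    then have "M x = M y" using inj m1 by (auto simp: F_def dest: inj_onD)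
    then have "Moebius_function 0 z (M x) = Moebius_function 0 z (M y)" by simp
    then show "x = y" unfolding M_def using xy z Moebius_function_compose[of z "- z"] by simp
  qed
  have M': "(M has_field_derivative q / (1 + cnj z * \<zeta>)\<^sup>2) (at \<zeta>)" if "norm \<zeta> < 1" for \<zeta>
    unfolding M_def q_def using moebius_deriv[of "- z" \<zeta>] z that by simp
  have F': "deriv F \<zeta> = deriv f (M \<zeta>) * (q / (1 + cnj z * \<zeta>)\<^sup>2)" if "norm \<zeta> < 1" for \<zeta>
  proof (rule DERIV_imp_deriv)
    have "(f has_field_derivative deriv f (M \<zeta>)) (at (M \<zeta>))"
      using holomorphic_derivI[OF hol, of "M \<zeta>"] m1[OF that] by simp
    from DERIV_chain2[OF this M'[OF that]]
    show "(F has_field_derivative deriv f (M \<zeta>) * (q / (1 + cnj z * \<zeta>)\<^sup>2)) (at \<zeta>)" by (simp add: F_def)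
  qed
  have "(deriv f has_field_derivative deriv (deriv f) z) (at (M 0))"
    using holomorphic_derivI[OF holomorphic_deriv[OF hol], of z] z by (simp add: M0)
  from DERIV_chain2[OF this M'[of 0]]
  have d: "((\<lambda>\<zeta>. deriv f (M \<zeta>)) has_field_derivative deriv (deriv f) z * q) (at 0)" by simp
  have "((\<lambda>\<zeta>. q / (1 + cnj z * \<zeta>)\<^sup>2) has_field_derivative - 2 * cnj z * q) (at 0)"
    by (auto intro!: derivative_eq_intros)
  from DERIV_mult[OF d this]
  have d2: "((\<lambda>\<zeta>. deriv f (M \<zeta>) * (q / (1 + cnj z * \<zeta>)\<^sup>2)) has_field_derivative
     deriv (deriv f) z * q * q - 2 * cnj z * q * deriv f z) (at 0)"
    by (simp add: M0)
  have ev: "eventually (\<lambda>\<zeta>. deriv F \<zeta> = deriv f (M \<zeta>) * (q / (1 + cnj z * \<zeta>)\<^sup>2)) (nhds 0)"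
    using eventually_nhds_in_open[of "ball 0 1" 0] F' by (auto elim!: eventually_mono)
  have "deriv (deriv F) 0 = deriv (deriv f) z * q * q - 2 * cnj z * q * deriv f z"
    unfolding deriv_cong_ev[OF ev refl] by (rule DERIV_imp_deriv[OF d2])
  moreover have "deriv (deriv F) 0 = 2 * taylor F 2"
    using taylor_1[of "deriv F"] taylor_deriv[OF F, of 1] by (simp add: numeral_2_eq_2)
  ultimately have "2 * taylor F 2 = q * (deriv (deriv f) z * q - 2 * cnj z * deriv f z)"
    by (simp add: algebra_simps)
  from arg_cong[OF this, of norm]
  have "2 * norm (taylor F 2) = norm (q * (deriv (deriv f) z * q - 2 * cnj z * deriv f z))"
    by (simp only: norm_mult) simp
  moreover have "norm (deriv F 0) = norm q * norm (deriv f z)"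
    using F'[of 0] by (simp add: M0 norm_mult)
  ultimately have "norm q * norm (deriv (deriv f) z * q - 2 * cnj z * deriv f z) \<le> norm q * (4 * norm (deriv f z))"
    using bieberbach_second_coefficient[OF F inj'] by (simp add: norm_mult)
  then show ?thesis using q by (simp add: q_def)
qed

text \<open>Along the radius through z, \<open>koebe_transform_bound\<close> bounds the derivative
  of log |f'| by (4 + 2 t) / (1 - t^2) = 3 / (1 - t) + 1 / (1 + t), the derivative of ln ((1 + t) /
  (1 - t)^3). Hence the difference \<open>v\<close> does not increase.\<close>

lemma koebe_distortion:
  assumes hol: "f holomorphic_on ball 0 1" and inj: "inj_on f (ball 0 1)" and z: "norm z < 1"
  shows "norm (deriv f z) \<le> norm (deriv f 0) * ((1 + norm z) / (1 - norm z) ^ 3)"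
proof (cases "z = 0")
  case False
  define r where "r = norm z"
  define e where "e = z / of_real r"
  have r: "0 < r" "r < 1" using z False by (auto simp: r_def)
  have e: "norm e = 1" "z = of_real r * e" using r by (auto simp: e_def r_def norm_divide)
  have ee: "e * cnj e = 1" using e(1) by (simp add: complex_norm_square[symmetric])
  have hol': "deriv f holomorphic_on ball 0 1" using hol by (intro holomorphic_deriv) auto
  have "simply_connected (ball (0::complex) 1)" by (simp add: convex_imp_simply_connected)
  then obtain L where L: "L holomorphic_on ball 0 1" "\<And>u. norm u < 1 \<Longrightarrow> deriv f u = exp (L u)"
    using hol' univalent_deriv_nonzero[OF hol inj] simply_connected_eq_holomorphic_log[of "ball (0::complex) 1"]
    by auto
  have L': "norm (deriv L u * (1 - (norm u)\<^sup>2) - 2 * cnj u) \<le> 4" if u: "norm u < 1" for u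
  proof -
    have "(L has_field_derivative deriv L u) (at u)" using holomorphic_derivI[OF L(1)] u by simp
    then have d: "((\<lambda>u. exp (L u)) has_field_derivative deriv L u * deriv f u) (at u)"
      using L(2)[OF u] by (auto intro!: derivative_eq_intros)
    have ev: "eventually (\<lambda>u. deriv f u = exp (L u)) (nhds u)"
      using eventually_nhds_in_open[of "ball 0 1" u] L(2) u by (auto elim!: eventually_mono)
    have "deriv (deriv f) u = deriv L u * deriv f u"
      unfolding deriv_cong_ev[OF ev refl] by (rule DERIV_imp_deriv[OF d])
    then have "norm (deriv f u * (deriv L u * (1 - (norm u)\<^sup>2) - 2 * cnj u)) \<le> norm (deriv f u) * 4"
      using koebe_transform_bound[OF hol inj u] by (simp add: algebra_simps)
    then show ?thesis using univalent_deriv_nonzero[OF hol inj u] by (simp add: norm_mult)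
  qed
  define v where "v = (\<lambda>t. Re (L (of_real t * e)) + (3 * ln (1 - t) - ln (1 + t)))"
  have "v r \<le> v 0"
  proof (rule DERIV_nonpos_imp_nonincreasing[where f = v])
    show "0 \<le> r" using r by simp
    fix t assume t: "0 \<le> t" "t \<le> r"
    then have t1: "t < 1" using r by simp
    have te: "norm (of_real t * e) = t" using t e by (simp add: norm_mult)
    have "(L has_field_derivative deriv L (of_real t * e)) (at (of_real t * e))"
      using holomorphic_derivI[OF L(1), of "of_real t * e"] te t1 by simp
    moreover have "((\<lambda>u. u * e) has_field_derivative e) (at (of_real t))"
      by (auto intro!: derivative_eq_intros)
    ultimately have "((\<lambda>u. L (u * e)) has_field_derivative deriv L (of_real t * e) * e) (at (of_real t))"
      by (rule DERIV_chain2)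
    from has_vector_derivative_real_field[OF this, of UNIV]
    have "((\<lambda>t. L (of_real t * e)) has_vector_derivative deriv L (of_real t * e) * e) (at t)" .
    from has_field_derivative_Re[OF this]
    have d: "((\<lambda>t. Re (L (of_real t * e))) has_field_derivative Re (deriv L (of_real t * e) * e)) (at t)" .
    have "((\<lambda>t. 3 * ln (1 - t) - ln (1 + t)) has_real_derivative - 3 / (1 - t) - 1 / (1 + t)) (at t)"
      using t t1 by (auto intro!: derivative_eq_intros simp: field_simps)
    from DERIV_add[OF d this]
    have dv: "(v has_real_derivative Re (deriv L (of_real t * e) * e) + (- 3 / (1 - t) - 1 / (1 + t))) (at t)"
      unfolding v_def .
    define X where "X = deriv L (of_real t * e)"
    have Re_lin: "Re (of_real a * Y - of_real b) = a * Re Y - b" for a b Y by simp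
    have "Re (X * e) * (1 - t\<^sup>2) - 2 * t = Re (of_real (1 - t\<^sup>2) * (X * e) - of_real (2 * t))"
      unfolding Re_lin by (simp only: mult.commute)
    also have "of_real (1 - t\<^sup>2) * (X * e) - of_real (2 * t) = of_real (1 - t\<^sup>2) * (X * e) - of_real (2 * t) * (e * cnj e)"
      unfolding ee by simp
    also have "\<dots> = e * (X * of_real (1 - t\<^sup>2) - 2 * cnj (of_real t * e))"
      by (simp add: algebra_simps)
    also have "Re \<dots> \<le> norm \<dots>" by (rule complex_Re_le_cmod)
    also have "\<dots> \<le> 4" using L'[of "of_real t * e"] e te t1 by (simp only: norm_mult X_def) simp
    finally have "Re (X * e) * (1 - t\<^sup>2) \<le> 4 + 2 * t" by linarith
    moreover have "1 - t\<^sup>2 > 0" using t t1 by (simp add: power_less_one_iff)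
    ultimately have "Re (X * e) \<le> (4 + 2 * t) / (1 - t\<^sup>2)"
      by (simp only: pos_le_divide_eq)
    also have "\<dots> = 3 / (1 - t) + 1 / (1 + t)"
      using t t1 \<open>1 - t\<^sup>2 > 0\<close> by (simp add: divide_simps) (simp add: power2_eq_square algebra_simps)
    finally show "\<exists>y. (v has_real_derivative y) (at t) \<and> y \<le> 0" using dv by (intro exI conjI) (auto simp: X_def simp del: times_complex.sel)
  qed
  then have "Re (L z) \<le> Re (L 0) + ln (1 + r) - ln ((1 - r) ^ 3)"
    using r e(2) by (simp add: v_def ln_realpow)
  also have "\<dots> = Re (L 0) + ln ((1 + r) / (1 - r) ^ 3)" using r by (simp add: ln_div)
  finally have "exp (Re (L z)) \<le> exp (Re (L 0) + ln ((1 + r) / (1 - r) ^ 3))" by simp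
  also have "\<dots> = exp (Re (L 0)) * ((1 + r) / (1 - r) ^ 3)" using r by (simp add: exp_add)
  finally have "exp (Re (L z)) \<le> exp (Re (L 0)) * ((1 + r) / (1 - r) ^ 3)" .
  then show ?thesis using L(2)[OF z] L(2)[of 0] by (simp add: r_def)
qed simp

section \<open>The Bohr inequality for harmonic mappings\<close>

text \<open>Frontier points are omitted values since the image is open, so the quarter theorem
  applies to each. The frontier must also be shown nonempty, because \<open>infdist\<close> to the
  empty set is 0 by convention; Liouville's theorem for the inverse map excludes that case.\<close>

lemma infdist_frontier_univalent:
  assumes hol: "f holomorphic_on ball 0 1" and inj: "inj_on f (ball 0 1)"
  shows "norm (deriv f 0) / 4 \<le> infdist (f 0) (frontier (f ` ball 0 1))"
proof -
  have op: "open (f ` ball 0 1)" by (rule univalent_image_simply_connected(1)[OF hol inj])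
  have "f ` ball 0 1 \<noteq> UNIV"
  proof
    assume U: "f ` ball 0 1 = UNIV"
    obtain g where g: "g holomorphic_on (f ` ball 0 1)" "\<And>z. z \<in> ball 0 1 \<Longrightarrow> g (f z) = z"
      using holomorphic_has_inverse[OF hol open_ball inj] by metis
    have "range g \<subseteq> ball 0 1"
    proof safe
      fix u :: complex
      obtain z where "z \<in> ball 0 1" "u = f z" using U by blast
      then show "g u \<in> ball 0 1" using g(2) by simp
    qed
    then have "bounded (range g)" by (rule bounded_subset[OF bounded_ball])
    with g(1) U have "g constant_on UNIV" by (intro Liouville_theorem) auto
    then have "g (f 0) = g (f (1 / 2))" unfolding constant_on_def by (metis UNIV_I)
    then show False using g(2)[of 0] g(2)[of "1/2"] by simp
  qed
  then have ne: "frontier (f ` ball 0 1) \<noteq> {}" by (simp add: frontier_eq_empty)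
  have "norm (deriv f 0) / 4 \<le> dist (f 0) w" if "w \<in> frontier (f ` ball 0 1)" for w
  proof (rule koebe_quarter[OF hol inj])
    show "w \<notin> f ` ball 0 1" using that op by (simp add: frontier_def interior_open)
  qed
  then show ?thesis unfolding infdist_notempty[OF ne] by (intro cINF_greatest ne) auto
qed

text \<open>In g' = \<omega> h' the coefficient of h' of index n - i carries the factor n - i + 1,
  at most the n + 1 on the left. After division, g is dominated by a Cauchy product of \<omega> and
  h, and Bohr's inequality bounds the majorant of \<omega> by k.\<close>

lemma dilatation_majorant:
  assumes h: "h holomorphic_on ball 0 1" and g: "g holomorphic_on ball 0 1"
    and h0: "\<And>z. norm z < 1 \<Longrightarrow> deriv h z \<noteq> 0"
    and k: "\<And>z. norm z < 1 \<Longrightarrow> norm (dilatation h g z) \<le> k" and r: "0 \<le> r" "r \<le> 1 / 3"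
  shows "(\<Sum>n. norm (taylor g (n + 1)) * r ^ (n + 1)) \<le> k * (\<Sum>n. norm (taylor h (n + 1)) * r ^ (n + 1))"
proof -
  have h': "deriv h holomorphic_on ball 0 1" and g': "deriv g holomorphic_on ball 0 1"
    using h g by (auto intro: holomorphic_deriv)
  have \<omega>: "dilatation h g holomorphic_on ball 0 1"
    unfolding dilatation_def using h0 by (intro holomorphic_intros h' g') auto
  have r1: "r < 1" using r by simp
  have s: "summable (\<lambda>n. norm (norm (taylor (dilatation h g) n) * r ^ n))"
    "summable (\<lambda>n. norm (norm (taylor h (n + 1)) * r ^ (n + 1)))"
    "summable (\<lambda>n. norm (taylor g (n + 1)) * r ^ (n + 1))"
    using taylor_abs_summable[OF \<omega> r(1) r1]
      summable_ignore_initial_segment[OF taylor_abs_summable[OF h r(1) r1], of 1]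
      summable_ignore_initial_segment[OF taylor_abs_summable[OF g r(1) r1], of 1] r(1) by auto
  have coeff: "norm (taylor g (n + 1)) \<le> (\<Sum>i\<le>n. norm (taylor (dilatation h g) i) * norm (taylor h (n - i + 1)))" for n
  proof -
    have "of_nat (Suc n) * taylor g (Suc n) = taylor (deriv g) n"
      by (rule taylor_deriv[OF g zero_less_one, symmetric])
    also have "\<dots> = taylor (\<lambda>z. dilatation h g z * deriv h z) n"
      by (rule taylor_cong[of 1]) (use h0 in \<open>auto simp: dilatation_def\<close>)
    also have "\<dots> = (\<Sum>i\<le>n. taylor (dilatation h g) i * (of_nat (Suc (n - i)) * taylor h (Suc (n - i))))"
      unfolding taylor_mult[OF \<omega> h' zero_less_one] taylor_deriv[OF h zero_less_one] ..
    finally have "real (Suc n) * norm (taylor g (Suc n)) =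
        norm (\<Sum>i\<le>n. taylor (dilatation h g) i * (of_nat (Suc (n - i)) * taylor h (Suc (n - i))))"
      by (metis norm_mult norm_of_nat)
    also have "\<dots> \<le> (\<Sum>i\<le>n. norm (taylor (dilatation h g) i) * (real (Suc (n - i)) * norm (taylor h (Suc (n - i)))))"
      by (rule order.trans[OF norm_sum]) (simp add: norm_mult del: of_nat_Suc)
    also have "\<dots> \<le> (\<Sum>i\<le>n. norm (taylor (dilatation h g) i) * (real (Suc n) * norm (taylor h (Suc (n - i)))))"
      by (intro sum_mono mult_left_mono mult_right_mono) auto
    also have "\<dots> = real (Suc n) * (\<Sum>i\<le>n. norm (taylor (dilatation h g) i) * norm (taylor h (n - i + 1)))"
      by (simp add: sum_distrib_left mult_ac del: of_nat_Suc)
    finally show ?thesis by (simp del: of_nat_Suc)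
  qed
  have "(\<Sum>n. norm (taylor g (n + 1)) * r ^ (n + 1)) \<le>
      (\<Sum>n. \<Sum>i\<le>n. (norm (taylor (dilatation h g) i) * r ^ i) * (norm (taylor h (n - i + 1)) * r ^ (n - i + 1)))"
  proof (rule suminf_le[OF _ s(3) summable_Cauchy_product[OF s(1,2)]])
    fix n
    have "norm (taylor g (n + 1)) * r ^ (n + 1) \<le>
        (\<Sum>i\<le>n. norm (taylor (dilatation h g) i) * norm (taylor h (n - i + 1))) * r ^ (n + 1)"
      using r by (intro mult_right_mono coeff) auto
    also have "\<dots> = (\<Sum>i\<le>n. (norm (taylor (dilatation h g) i) * r ^ i) * (norm (taylor h (n - i + 1)) * r ^ (n - i + 1)))"
      unfolding sum_distrib_right
    proof (intro sum.cong refl)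
      fix i assume "i \<in> {..n}"
      then have "n + 1 = i + (n - i + 1)" by simp
      then have "r ^ (n + 1) = r ^ i * r ^ (n - i + 1)" by (metis power_add)
      then show "norm (taylor (dilatation h g) i) * norm (taylor h (n - i + 1)) * r ^ (n + 1) =
        norm (taylor (dilatation h g) i) * r ^ i * (norm (taylor h (n - i + 1)) * r ^ (n - i + 1))"
        by (simp only: mult_ac)
    qed
    finally show "norm (taylor g (n + 1)) * r ^ (n + 1) \<le> \<dots>" .
  qed
  also have "\<dots> = majorant (dilatation h g) r * (\<Sum>n. norm (taylor h (n + 1)) * r ^ (n + 1))"
    unfolding majorant_def by (rule Cauchy_product[OF s(1,2), symmetric])
  also have "\<dots> \<le> k * (\<Sum>n. norm (taylor h (n + 1)) * r ^ (n + 1))"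
    using s(2) r by (intro mult_right_mono bohr[OF \<omega> k] suminf_nonneg) auto
  finally show ?thesis .
qed

text \<open>\<open>koebe\<close> grows at least as fast as the identity, so shrinking its argument
  gains at least the amount of the shrinking.\<close>

lemma koebe_minus_id_mono:
  fixes x y :: real
  assumes "0 \<le> x" "x \<le> y" "y < 1"
  shows "koebe x - x \<le> koebe y - y"
proof -
  have e: "koebe u - u = u * (1 / (1 - u)\<^sup>2 - 1)" for u :: real by (simp add: koebe_def right_diff_distrib)
  have "1 / (1 - x)\<^sup>2 \<le> 1 / (1 - y)\<^sup>2" using assms by (intro frac_le power_mono) auto
  moreover have "1 \<le> 1 / (1 - x)\<^sup>2" using assms by (simp add: power_le_one)
  ultimately show ?thesis unfolding e using assms by (intro mult_mono) auto
qed

text \<open>Regrouped, the polynomial is the strictly decreasing (1 - u)^3 minus nonnegative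
  multiples of products of u (1 - u), u (2 - u) and u (1 + u), all nondecreasing on
  [0, 1/3].\<close>

lemma radius_poly_strict_antimono:
  assumes K: "K \<ge> 1" and x: "0 \<le> x" "x < y" "y \<le> 1 / 3"
  shows "radius_poly K y < radius_poly K x"
proof -
  define c where "c = 2 * K / (K + 1)"
  have c: "c \<ge> 0" using K by (simp add: c_def)
  have "0 \<le> (y - x) * (1 - x - y)" "0 \<le> (y - x) * (2 - x - y)" using x by auto
  then have a: "x * (1 - x) \<le> y * (1 - y)" and b: "x * (2 - x) \<le> y * (2 - y)"
    by (auto simp: algebra_simps)
  have 1: "(1 - y) ^ 3 < (1 - x) ^ 3" using x by (intro power_strict_mono) auto
  have 2: "(x * (1 - x)) * (x * (2 - x)) \<le> (y * (1 - y)) * (y * (2 - y))"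
    using x by (intro mult_mono[OF a b] mult_nonneg_nonneg) auto
  have 3: "c * (x * (1 - x)) \<le> c * (y * (1 - y))" using a c by (intro mult_left_mono)
  have 4: "x * (1 + x) \<le> y * (1 + y)" using x by (intro mult_mono) auto
  have e: "radius_poly K u = (1 - u) ^ 3 - 4 * ((u * (1 - u)) * (u * (2 - u))) - 4 * (c * (u * (1 - u))) - 4 * (u * (1 + u))" for u
    unfolding radius_poly_def c_def[symmetric] by (simp add: power2_eq_square algebra_simps)
  show ?thesis unfolding e using 1 2 3 4 by linarith
qed

text \<open>The origin of the radius equation. The left side is the Bohr sum of the Koebe function
  at r, with r \<open>koebe'(r)\<close> = r (1 + r) / (1 - r)^3 and constant dilatation k; it is at
  most 1/4 exactly when \<open>radius_poly\<close> is nonnegative. The coefficient 2 K / (K + 1) is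
  1 + k.\<close>

lemma bohr_bracket:
  fixes r k :: real
  assumes r: "r < 1" and K: "K \<ge> 1" and k: "k = (K - 1) / (K + 1)"
  shows "2 * koebe r - r + r * (1 + r) / (1 - r) ^ 3 + k * koebe r = (1 - radius_poly K r / (1 - r) ^ 3) / 4"
proof -
  have k': "2 * K / (K + 1) = 1 + k" using K by (simp add: k field_simps)
  define A where "A = (r ^ 2 * (2 - r) + (1 + k) * r) * (1 - r)"
  have "radius_poly K r = (1 - r) ^ 3 - 4 * A - 4 * (r * (1 + r))"
    unfolding radius_poly_def k' A_def by simp
  then have "(1 - radius_poly K r / (1 - r) ^ 3) / 4 = A / (1 - r) ^ 3 + r * (1 + r) / (1 - r) ^ 3"
    using r by (simp add: diff_divide_distrib add_divide_distrib)
  then have "(1 - radius_poly K r / (1 - r) ^ 3) / 4 = (r ^ 2 * (2 - r) + (1 + k) * r) * (1 - r) / (1 - r) ^ 3 + r * (1 + r) / (1 - r) ^ 3"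
    unfolding A_def .
  also have "(r ^ 2 * (2 - r) + (1 + k) * r) * (1 - r) / (1 - r) ^ 3 = (r ^ 2 * (2 - r) + (1 + k) * r) / (1 - r)\<^sup>2"
    using r by (simp add: power3_eq_cube power2_eq_square)
  also have "r ^ 2 * (2 - r) / (1 - r)\<^sup>2 = koebe r - r"
    using r by (simp add: koebe_def field_simps) (simp add: power2_eq_square algebra_simps)
  then have "(r ^ 2 * (2 - r) + (1 + k) * r) / (1 - r)\<^sup>2 = koebe r - r + (1 + k) * koebe r"
    by (simp add: add_divide_distrib koebe_def)
  finally show ?thesis unfolding distrib_right mult_1_left by linarith
qed

text \<open>Each of the four terms is compared with D = |\<phi>'(0)| times its value for the Koebe
  function; D / 4 is finally absorbed by the quarter theorem. Only the tail of h carries an excess,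
  2 (1 - t) r^2 / (1 - r) with t = |w'(0)|, and \<open>x_le\<close> provides the same amount as a
  drop from r to x = |w(z)|.\<close>

lemma bohr_inequality:
  assumes K: "K \<ge> 1" and adm: "admissible K f h g a b \<phi>" and z: "norm z \<le> 1 / 10"
    and P: "radius_poly K (norm z) \<ge> 0"
  shows "bohr_sum h a b z \<le> norm (\<phi> 0) + infdist (\<phi> 0) (frontier (\<phi> ` unit_disc))"
proof -
  define r where "r = norm z"
  define k where "k = (K - 1) / (K + 1)"
  have r: "0 \<le> r" "r \<le> 1 / 10" using z by (auto simp: r_def)
  have k: "0 \<le> k" using K by (simp add: k_def)
  have h: "h holomorphic_on ball 0 1" and g: "g holomorphic_on ball 0 1"
    and h0: "\<And>z. norm z < 1 \<Longrightarrow> deriv h z \<noteq> 0"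
    and \<omega>: "\<And>z. norm z < 1 \<Longrightarrow> norm (dilatation h g z) \<le> k"
    and ha: "\<And>z. norm z < 1 \<Longrightarrow> (\<lambda>n. a n * z ^ n) sums h z"
    and gb: "\<And>z. norm z < 1 \<Longrightarrow> (\<lambda>n. b (n + 1) * z ^ (n + 1)) sums g z"
    and \<phi>: "\<phi> holomorphic_on ball 0 1" and inj: "inj_on \<phi> (ball 0 1)"
    using adm by (auto simp: admissible_def quasiconformal_harmonic_def
        sense_preserving_harmonic_def harmonic_decomposition_def k_def)
  obtain w where w: "w holomorphic_on ball 0 1" "\<And>z. norm z < 1 \<Longrightarrow> norm (w z) < 1" "w 0 = 0"
    "\<And>z. norm z < 1 \<Longrightarrow> h z = \<phi> (w z)"
    using adm by (auto simp: admissible_def subordinate_def image_subset_iff)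
  have ta: "a n = taylor h n" for n using taylor_unique[OF zero_less_one ha] by simp
  have tb: "b (n + 1) = taylor g (n + 1)" for n
  proof -
    \<comment> \<open>The index shift inserts 0 as the constant coefficient, since the given series
      determines \<open>b\<close> only from 1 on.\<close>
    have "taylor g m = (case m of 0 \<Rightarrow> 0 | Suc n \<Rightarrow> b (Suc n))" for m
    proof (rule taylor_unique[OF zero_less_one])
      fix z :: complex assume "norm z < 1"
      with gb[of z] sums_Suc[of "\<lambda>m. (case m of 0 \<Rightarrow> 0 | Suc n \<Rightarrow> b (Suc n)) * z ^ m" "g z"]
      show "(\<lambda>m. (case m of 0 \<Rightarrow> 0 | Suc n \<Rightarrow> b (Suc n)) * z ^ m) sums g z" by simp
    qed
    then show ?thesis by simp
  qed
  define D where "D = norm (deriv \<phi> 0)"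
  define t where "t = norm (deriv w 0)"
  have D: "0 \<le> D" by (simp add: D_def)
  have t: "0 \<le> t" "t \<le> 1" using Schwarz_Lemma(2)[OF w(1,3,2), of 0] by (auto simp: t_def)
  define x where "x = norm (w z)"
  have z1: "norm z < 1" using z by simp
  have xr: "x \<le> r" unfolding x_def r_def by (rule Schwarz_Lemma(1)[OF w(1,3,2) z1])
  have x0: "0 \<le> x" by (simp add: x_def)
  define \<psi> where "\<psi> = (\<lambda>u. \<phi> u - \<phi> 0)"
  have \<psi>: "\<psi> holomorphic_on ball 0 1" unfolding \<psi>_def by (intro holomorphic_intros \<phi>)
  have t\<psi>: "taylor \<psi> n = taylor \<phi> n" if "n > 0" for n
    unfolding \<psi>_def using taylor_diff[OF \<phi>, of "\<lambda>_. \<phi> 0" n] that by (simp add: taylor_const)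
  have maj: "majorant \<psi> \<rho> \<le> D * koebe \<rho>" if "0 \<le> \<rho>" "\<rho> \<le> 1 / 10" for \<rho>
    unfolding \<psi>_def D_def by (rule majorant_univalent[OF \<phi> inj that])

  have x_le: "x \<le> r - 2 * (1 - t) * (r\<^sup>2 / (1 - r))"
  proof -
    have "x \<le> majorant w r" unfolding x_def r_def by (rule norm_le_majorant[OF w(1) z1])
    obtain v where v: "v holomorphic_on ball 0 1" "\<And>z. norm z < 1 \<Longrightarrow> w z = z * v z" "v 0 = deriv w 0"
      "\<And>z. norm z < 1 \<Longrightarrow> norm (v z) \<le> 1"
      using schwarz_factor[OF w(1,3,2)] by metis
    have "x = r * norm (v z)" unfolding x_def r_def v(2)[OF z1] by (simp add: norm_mult)
    also have "norm (v z) \<le> majorant v r" unfolding r_def by (rule norm_le_majorant[OF v(1) z1])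
    also have "majorant v r = t + (\<Sum>n. norm (taylor v (Suc n)) * r ^ Suc n)"
      using majorant_split[OF v(1) r(1)] r by (simp add: v(3) t_def)
    also have "\<dots> \<le> t + 2 * (1 - t) * (r / (1 - r))"
      using bohr_tail[OF v(1,4) r(1)] r by (simp add: v(3) t_def)
    finally have "x \<le> r * (t + 2 * (1 - t) * (r / (1 - r)))" using r by (simp add: mult_left_mono)
    \<comment> \<open>The drop r (1 - t) (1 - 2 r / (1 - r)) of x below r is split into the excess
      to be paid and a surplus, which is nonnegative for r \<le> 1/5.\<close>
    also have "\<dots> = r - 2 * (1 - t) * (r\<^sup>2 / (1 - r)) - r * (1 - t) * ((1 - 5 * r) / (1 - r))"
    proof -
      define y where "y = r / (1 - r)"
      have y: "(1 - 5 * r) / (1 - r) = 1 - 4 * y" "r\<^sup>2 / (1 - r) = r * y"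
        using r by (auto simp: y_def field_simps power2_eq_square)
      show ?thesis unfolding y y_def[symmetric] by (simp add: algebra_simps)
    qed
    also have "\<dots> \<le> r - 2 * (1 - t) * (r\<^sup>2 / (1 - r))"
      using r t by simp
    finally show ?thesis .
  qed

  have T1: "norm (h z) \<le> norm (\<phi> 0) + D * koebe x"
  proof -
    have "h z = \<phi> 0 + \<psi> (w z)" using w(4)[OF z1] by (simp add: \<psi>_def)
    then have "norm (h z) \<le> norm (\<phi> 0) + norm (\<psi> (w z))" by (simp add: norm_triangle_ineq)
    also have "norm (\<psi> (w z)) \<le> majorant \<psi> x"
      unfolding x_def by (rule norm_le_majorant[OF \<psi> w(2)[OF z1]])
    also have "\<dots> \<le> D * koebe x" using x0 xr r by (intro maj) auto
    finally show ?thesis by simp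
  qed

  have T2: "norm (deriv h z) * r \<le> D * (r * (1 + r) / (1 - r) ^ 3)"
  proof -
    have "(w has_field_derivative deriv w z) (at z)" using holomorphic_derivI[OF w(1)] z1 by simp
    moreover have "(\<phi> has_field_derivative deriv \<phi> (w z)) (at (w z))"
      using holomorphic_derivI[OF \<phi>] w(2)[OF z1] by simp
    ultimately have d: "((\<lambda>u. \<phi> (w u)) has_field_derivative deriv \<phi> (w z) * deriv w z) (at z)"
      by (intro DERIV_chain2)
    have ev: "eventually (\<lambda>u. h u = \<phi> (w u)) (nhds z)"
      using eventually_nhds_in_open[of "ball 0 1" z] w(4) z1 by (auto elim!: eventually_mono)
    have dh: "deriv h z = deriv \<phi> (w z) * deriv w z"
      unfolding deriv_cong_ev[OF ev refl] by (rule DERIV_imp_deriv[OF d])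
    have p: "0 < 1 - x" "0 < 1 - r" "0 < 1 + r" "0 < 1 - r\<^sup>2"
      using r xr power_strict_mono[of r 1 2] by auto
    have dw: "norm (deriv w z) \<le> (1 - x\<^sup>2) / (1 - r\<^sup>2)"
      using schwarz_pick_deriv[OF w(1,2) z1] p by (simp add: x_def r_def pos_le_divide_eq)
    have d\<phi>: "norm (deriv \<phi> (w z)) \<le> D * ((1 + x) / (1 - x) ^ 3)"
      unfolding D_def x_def by (rule koebe_distortion[OF \<phi> inj w(2)[OF z1]])
    \<comment> \<open>Distortion at w(z) times Schwarz-Pick at z. The product increases with x, and
      at x = r it is the derivative of the Koebe function.\<close>
    have "norm (deriv h z) \<le> (D * ((1 + x) / (1 - x) ^ 3)) * ((1 - x\<^sup>2) / (1 - r\<^sup>2))"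
      unfolding dh norm_mult by (rule mult_mono[OF d\<phi> dw]) (use D x0 p in auto)
    also have "\<dots> = D * (((1 + x) / (1 - x))\<^sup>2 / (1 - r\<^sup>2))"
    proof -
      have "(1 + x) / (1 - x) ^ 3 * (1 - x\<^sup>2) = ((1 + x) / (1 - x))\<^sup>2"
      proof -
        have "1 - x\<^sup>2 = (1 - x) * (1 + x)" by (simp add: power2_eq_square algebra_simps)
        then show ?thesis using p(1) by (simp add: power3_eq_cube power2_eq_square)
      qed
      then show ?thesis by (metis mult.assoc times_divide_eq_right)
    qed
    also have "\<dots> \<le> D * (((1 + r) / (1 - r))\<^sup>2 / (1 - r\<^sup>2))"
      using p xr x0 D by (intro mult_left_mono divide_right_mono power_mono frac_le) auto
    also have "((1 + r) / (1 - r))\<^sup>2 / (1 - r\<^sup>2) = (1 + r) / (1 - r) ^ 3"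
    proof -
      have "1 - r\<^sup>2 = (1 - r) * (1 + r)" by (simp add: power2_eq_square algebra_simps)
      then show ?thesis using p by (simp add: power3_eq_cube power2_eq_square)
    qed
    finally have "norm (deriv h z) * r \<le> D * ((1 + r) / (1 - r) ^ 3) * r" using r by (intro mult_right_mono)
    then show ?thesis by (simp add: mult_ac)
  qed

  have r3: "r \<le> 1 / 3" "r < 1" using r by auto
  have h\<phi>: "taylor h n = taylor (\<lambda>z. \<phi> (w z)) n" for n
    by (rule taylor_cong[OF zero_less_one]) (rule w(4))

  have T3: "(\<Sum>n. norm (taylor h (n + 2)) * r ^ (n + 2)) \<le> D * (2 * (1 - t) * (r\<^sup>2 / (1 - r)) + (koebe r - r))"
  proof -
    have "(\<Sum>n. norm (taylor h (n + 2)) * r ^ (n + 2)) \<le> D * (2 * (1 - t) * (r\<^sup>2 / (1 - r)))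
        + (\<Sum>n. norm (taylor \<phi> (n + 2)) * r ^ (n + 2))"
      unfolding h\<phi> D_def t_def by (rule majorant_compose_tail[OF \<phi> w(1,3,2) r(1) r3(1)])
    also have "(\<Sum>n. norm (taylor \<phi> (n + 2)) * r ^ (n + 2)) = (\<Sum>n. norm (taylor \<psi> (n + 2)) * r ^ (n + 2))"
      by (simp add: t\<psi>)
    also have "\<dots> = majorant \<psi> r - (\<Sum>n<2. norm (taylor \<psi> n) * r ^ n)"
      unfolding majorant_def by (rule suminf_minus_initial_segment[OF taylor_abs_summable[OF \<psi> r(1) r3(2)]])
    also have "(\<Sum>n<2. norm (taylor \<psi> n) * r ^ n) = D * r"
      using t\<psi>[of 1] taylor_1[of \<phi>] by (simp add: numeral_2_eq_2 taylor_0 \<psi>_def D_def)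
    also have "majorant \<psi> r \<le> D * koebe r" by (rule maj[OF r])
    finally show ?thesis by (simp add: algebra_simps)
  qed

  have T4: "(\<Sum>n. norm (taylor g (n + 1)) * r ^ (n + 1)) \<le> k * (D * koebe r)"
  proof -
    have "(\<Sum>n. norm (taylor g (n + 1)) * r ^ (n + 1)) \<le> k * (\<Sum>n. norm (taylor h (n + 1)) * r ^ (n + 1))"
      by (rule dilatation_majorant[OF h g h0 \<omega> r(1) r3(1)])
    also have "(\<Sum>n. norm (taylor h (n + 1)) * r ^ (n + 1)) \<le> D * koebe r"
    proof -
      have \<psi>w: "(\<lambda>z. \<psi> (w z)) holomorphic_on ball 0 1"
        by (rule holomorphic_on_compose_disc[OF \<psi> w(1,2)])
      have hw: "(\<lambda>z. \<phi> (w z)) holomorphic_on ball 0 1"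
        by (rule holomorphic_on_compose_disc[OF \<phi> w(1,2)])
      have "taylor (\<lambda>z. \<psi> (w z)) (n + 1) = taylor h (n + 1)" for n
        unfolding h\<phi> \<psi>_def using taylor_diff[OF hw, of "\<lambda>_. \<phi> 0"] by (simp add: taylor_const)
      then have "(\<Sum>n. norm (taylor h (n + 1)) * r ^ (n + 1)) = majorant (\<lambda>z. \<psi> (w z)) r"
        using majorant_split[OF \<psi>w r(1) r3(2)] by (simp add: w(3) \<psi>_def)
      also have "\<dots> \<le> majorant \<psi> r" by (rule majorant_compose[OF \<psi> w(1,3,2) r(1) r3(1)])
      also have "\<dots> \<le> D * koebe r" by (rule maj[OF r])
      finally show ?thesis .
    qed
    finally show ?thesis using k by (simp add: mult_left_mono)
  qed

  have "bohr_sum h a b z \<le> (norm (\<phi> 0) + D * koebe x) + D * (r * (1 + r) / (1 - r) ^ 3)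
      + D * (2 * (1 - t) * (r\<^sup>2 / (1 - r)) + (koebe r - r)) + k * (D * koebe r)"
    unfolding bohr_sum_def r_def[symmetric] ta tb using T1 T2 T3 T4 by (intro add_mono)
  also have "\<dots> = norm (\<phi> 0) + D * ((koebe x + 2 * (1 - t) * (r\<^sup>2 / (1 - r))) + (koebe r - r)
      + r * (1 + r) / (1 - r) ^ 3 + k * koebe r)"
    by (simp add: algebra_simps)
  also have "\<dots> \<le> norm (\<phi> 0) + D * (koebe r + (koebe r - r) + r * (1 + r) / (1 - r) ^ 3 + k * koebe r)"
  proof (intro add_left_mono mult_left_mono D add_right_mono)
    have "koebe x - x \<le> koebe r - r" using koebe_minus_id_mono[OF x0 xr r3(2)] .
    then show "koebe x + 2 * (1 - t) * (r\<^sup>2 / (1 - r)) \<le> koebe r" using x_le by linarith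
  qed
  also have "koebe r + (koebe r - r) + r * (1 + r) / (1 - r) ^ 3 + k * koebe r = (1 - radius_poly K r / (1 - r) ^ 3) / 4"
    using bohr_bracket[OF r3(2) K k_def] by simp
  also have "D * ((1 - radius_poly K r / (1 - r) ^ 3) / 4) \<le> D * (1 / 4)"
    using P r3 D by (intro mult_left_mono) (auto simp: r_def intro!: divide_nonneg_nonneg)
  also have "D * (1 / 4) \<le> infdist (\<phi> 0) (frontier (\<phi> ` unit_disc))"
    using infdist_frontier_univalent[OF \<phi> inj] by (simp add: D_def)
  finally show ?thesis by simp
qed

section \<open>The Koebe function as extremal map\<close>

lemma koebe_sums:
  assumes "norm (z::'a::{real_normed_field,banach}) < 1"
  shows "(\<lambda>n. of_nat n * z ^ n) sums koebe z"
proof -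
  from sums_mult[OF geometric_deriv_sums[OF assms], of z]
  have "(\<lambda>n. of_nat (Suc n) * z ^ Suc n) sums koebe z"
    by (simp add: koebe_def mult_ac del: of_nat_Suc)
  from sums_Suc[OF this] show ?thesis by simp
qed

lemma koebe_has_derivative:
  assumes "z \<noteq> (1::complex)"
  shows "(koebe has_field_derivative (1 + z) / (1 - z) ^ 3) (at z)"
proof -
  have nz: "1 - z \<noteq> 0" using assms by simp
  have "((\<lambda>z. z / (1 - z)\<^sup>2) has_field_derivative
      (1 * (1 - z)\<^sup>2 - z * (2 * (1 - z) * (- 1))) / ((1 - z)\<^sup>2 * (1 - z)\<^sup>2)) (at z)"
    using nz by (auto intro!: derivative_eq_intros)
  also have "1 * (1 - z)\<^sup>2 - z * (2 * (1 - z) * (- 1)) = (1 - z) * (1 + z)"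
    by (simp add: power2_eq_square algebra_simps)
  also have "(1 - z)\<^sup>2 * (1 - z)\<^sup>2 = (1 - z) * (1 - z) ^ 3" by (simp add: eval_nat_numeral)
  finally show ?thesis using nz by (simp add: koebe_def[abs_def])
qed

lemma koebe_injective: "inj_on (koebe :: complex \<Rightarrow> complex) (ball 0 1)"
proof (rule inj_onI)
  fix z w :: complex assume z: "z \<in> ball 0 1" "w \<in> ball 0 1" "koebe z = koebe w"
  then have "1 - z \<noteq> 0" "1 - w \<noteq> 0" by (auto intro!: one_plus_nonzero)
  then have "z * (1 - w)\<^sup>2 = w * (1 - z)\<^sup>2" using z by (simp add: koebe_def frac_eq_eq)
  then have "(z - w) * (1 - z * w) = 0" by (simp add: power2_eq_square algebra_simps)
  moreover have "1 - z * w \<noteq> 0" using z by (intro one_plus_nonzero norm_mult_lt_1) auto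
  ultimately show "z = w" by simp
qed

text \<open>The value - 1/4 is omitted, since taking it amounts to (1 + z)^2 = 0, but it is the
  limit along the negative radius as z tends to - 1.\<close>

lemma koebe_infdist: "infdist (koebe 0) (frontier (koebe ` unit_disc)) \<le> 1 / 4"
proof -
  have "- 1 / 4 \<notin> koebe ` unit_disc"
  proof
    assume "- 1 / 4 \<in> koebe ` unit_disc"
    then obtain z :: complex where z: "norm z < 1" "z / (1 - z)\<^sup>2 = - 1 / 4" by (auto simp: koebe_def)
    then have "1 - z \<noteq> 0" by (auto intro!: one_plus_nonzero)
    then have "z = - 1 / 4 * (1 - z)\<^sup>2" using z(2) by (simp only: divide_eq_eq) simp
    moreover have "(1 + z)\<^sup>2 = (1 - z)\<^sup>2 + 4 * z" by (simp add: power2_eq_square algebra_simps)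
    ultimately have "(1 + z)\<^sup>2 = 0" by (simp add: field_simps)
    then show False using one_plus_nonzero(1)[OF z(1)] by simp
  qed
  moreover have "- 1 / 4 \<in> closure (koebe ` unit_disc :: complex set)"
  proof (rule Lim_in_closed_set)
    show "((\<lambda>t. koebe (of_real (- t) :: complex)) \<longlongrightarrow> - 1 / 4) (at_left 1)"
    proof -
      have "((\<lambda>t. koebe (of_real (- t) :: complex)) \<longlongrightarrow> of_real (- 1) / (1 - of_real (- 1))\<^sup>2) (at_left 1)"
        unfolding koebe_def by (intro tendsto_intros) auto
      then show ?thesis by simp
    qed
    have "koebe (of_real (- t)) \<in> closure (koebe ` unit_disc :: complex set)" if "t \<in> {0<..<1}" for t :: real
      using that by (intro subsetD[OF closure_subset] imageI) auto
    then show "eventually (\<lambda>t. koebe (of_real (- t)) \<in> closure (koebe ` unit_disc :: complex set)) (at_left 1)"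
      using eventually_at_left_real[of 0 "1::real"] by (auto elim!: eventually_mono)
  qed auto
  ultimately have "- 1 / 4 \<in> frontier (koebe ` unit_disc :: complex set)"
    using interior_subset unfolding frontier_def by blast
  from infdist_le[OF this, of "koebe 0"] show ?thesis by (simp add: koebe_def dist_norm norm_divide)
qed

text \<open>The extremal harmonic map: constant dilatation k meets the quasiconformality bound with
  equality, and the Koebe function is subordinate to itself through the identity.\<close>

lemma koebe_admissible:
  assumes K: "K \<ge> 1" and k: "k = (K - 1) / (K + 1)"
  shows "admissible K (\<lambda>z. koebe z + cnj (of_real k * koebe z)) koebe (\<lambda>z. of_real k * koebe z)
    (\<lambda>n. of_nat n) (\<lambda>n. of_real k * of_nat n) koebe"
proof -
  have d: "deriv koebe z = (1 + z) / (1 - z) ^ 3" and dk: "deriv (\<lambda>z. of_real k * koebe z) z = of_real k * ((1 + z) / (1 - z) ^ 3)"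
    and nz: "(1 + z) / (1 - z) ^ 3 \<noteq> 0" if "norm z < 1" for z :: complex
  proof -
    have z: "z \<noteq> 1" "1 + z \<noteq> 0" "1 - z \<noteq> 0" using that by (auto intro!: one_plus_nonzero)
    show "deriv koebe z = (1 + z) / (1 - z) ^ 3" by (rule DERIV_imp_deriv[OF koebe_has_derivative[OF z(1)]])
    show "deriv (\<lambda>z. of_real k * koebe z) z = of_real k * ((1 + z) / (1 - z) ^ 3)"
      by (rule DERIV_imp_deriv[OF DERIV_cmult[OF koebe_has_derivative[OF z(1)]]])
    show "(1 + z) / (1 - z) ^ 3 \<noteq> 0" using z by simp
  qed
  have hol: "(koebe :: complex \<Rightarrow> complex) holomorphic_on unit_disc"
    unfolding koebe_def[abs_def] by (intro holomorphic_intros) (auto dest: one_plus_nonzero)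
  have k01: "0 \<le> k" "k < 1" using K by (auto simp: k field_simps)
  have dil: "norm (dilatation koebe (\<lambda>z. of_real k * koebe z) z) = k" if "norm z < 1" for z
    unfolding dilatation_def d[OF that] dk[OF that] using nz[OF that] k01 by simp
  have "subordinate koebe koebe"
    unfolding subordinate_def by (intro exI[of _ "\<lambda>z. z"]) auto
  moreover have "(\<lambda>n. of_real k * of_nat (n + 1) * z ^ (n + 1)) sums (of_real k * koebe z)" if "norm z < 1" for z :: complex
  proof -
    have "(\<lambda>n. of_real k * (of_nat n * z ^ n)) sums (of_real k * koebe z)"
      by (rule sums_mult[OF koebe_sums[OF that]])
    from sums_split_initial_segment[OF this, of 1] show ?thesis by (simp add: mult.assoc)
  qed
  ultimately show ?thesis
    unfolding admissible_def quasiconformal_harmonic_def sense_preserving_harmonic_def harmonic_decomposition_def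
    using hol koebe_injective koebe_sums[where 'a=complex] dil d nz k01
    by (auto simp: k[symmetric] intro!: holomorphic_intros)
qed

text \<open>All coefficients are nonnegative and the point lies on the positive radius, so absolute
  values disappear and \<open>bohr_bracket\<close> gives the sum exactly.\<close>

lemma koebe_bohr_sum:
  assumes r: "0 < r" "r < 1" and K: "K \<ge> 1" and k: "k = (K - 1) / (K + 1)"
  shows "bohr_sum koebe (\<lambda>n. of_nat n) (\<lambda>n. of_real k * of_nat n) (of_real r) = (1 - radius_poly K r / (1 - r) ^ 3) / 4"
proof -
  have k0: "0 \<le> k" using K by (simp add: k)
  have kr: "koebe r \<ge> 0" using r by (simp add: koebe_def)
  have 1: "norm (koebe (of_real r :: complex)) = koebe r"
  proof -
    have "koebe (of_real r :: complex) = of_real (koebe r)" by (simp add: koebe_def)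
    then show ?thesis using kr by (simp only: norm_of_real abs_of_nonneg)
  qed
  have 2: "norm (deriv koebe (of_real r :: complex)) = (1 + r) / (1 - r) ^ 3"
  proof -
    have "deriv koebe (of_real r :: complex) = (1 + of_real r) / (1 - of_real r) ^ 3"
      using r by (intro DERIV_imp_deriv koebe_has_derivative) simp
    also have "\<dots> = of_real ((1 + r) / (1 - r) ^ 3)" by simp
    finally show ?thesis using r by (simp only: norm_of_real abs_of_nonneg) simp
  qed
  have s: "(\<lambda>n. real n * r ^ n) sums koebe r" using koebe_sums[of r] r by simp
  have 3: "(\<Sum>n. norm (of_nat (n + 2) :: complex) * r ^ (n + 2)) = koebe r - r"
    using sums_unique[OF sums_split_initial_segment[OF s, of 2]]
    by (simp only: norm_of_nat) (simp add: numeral_2_eq_2)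
  have 4: "(\<Sum>n. norm (of_real k * of_nat (n + 1) :: complex) * r ^ (n + 1)) = k * koebe r"
  proof -
    have "norm (of_real k * of_nat (n + 1) :: complex) * r ^ (n + 1) = k * (real (n + 1) * r ^ (n + 1))" for n
      unfolding norm_mult norm_of_real norm_of_nat using k0 by simp
    then have "(\<Sum>n. norm (of_real k * of_nat (n + 1) :: complex) * r ^ (n + 1)) = (\<Sum>n. k * (real (n + 1) * r ^ (n + 1)))"
      by (simp only:)
    also have "\<dots> = k * (koebe r - (\<Sum>n<1. real n * r ^ n))"
      by (intro sums_unique[symmetric] sums_mult sums_split_initial_segment[OF s])
    finally show ?thesis by simp
  qed
  have "bohr_sum koebe (\<lambda>n. of_nat n) (\<lambda>n. of_real k * of_nat n) (of_real r) =
      koebe r + (1 + r) / (1 - r) ^ 3 * r + (koebe r - r) + k * koebe r"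
    unfolding bohr_sum_def norm_of_real abs_of_pos[OF r(1)] 1 2 3 4 ..
  also have "\<dots> = (1 - radius_poly K r / (1 - r) ^ 3) / 4"
    using bohr_bracket[OF r(2) K k] by (simp add: mult_ac)
  finally show ?thesis .
qed

section \<open>The radius and its sharpness\<close>

theorem theorem4p4:
  fixes K :: real
  assumes "K \<ge> 1"
  shows "\<exists>r0. 0 < r0 \<and> r0 < 1/3 \<and> radius_poly K r0 = 0 \<and>
    (\<forall>r. 0 < r \<and> r < 1/3 \<and> radius_poly K r = 0 \<longrightarrow> r = r0) \<and>
    (\<forall>f h g a b \<phi> z. admissible K f h g a b \<phi> \<and> norm z \<le> r0 \<longrightarrow>
       bohr_sum h a b z \<le> norm (\<phi> 0) + infdist (\<phi> 0) (frontier (\<phi> ` unit_disc))) \<and>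
    (\<forall>R>r0. \<not> (\<forall>f h g a b \<phi>. \<forall>z\<in>unit_disc. admissible K f h g a b \<phi> \<and> norm z \<le> R \<longrightarrow>
       bohr_sum h a b z \<le> norm (\<phi> 0) + infdist (\<phi> 0) (frontier (\<phi> ` unit_disc))))"
proof -
  define c where "c = 2 * K / (K + 1)"
  have "1 \<le> c" using assms by (simp add: c_def field_simps)
  \<comment> \<open>For c = 1 the value is 0.729 - 0.4284 - 0.44, and it decreases as c grows. The
    root thus lies in the range where \<open>majorant_univalent\<close> holds.\<close>
  then have neg: "radius_poly K (1 / 10) < 0"
    unfolding radius_poly_def c_def[symmetric] by (simp add: power2_eq_square power3_eq_cube)
  have pos: "radius_poly K 0 > 0" by (simp add: radius_poly_def)
  have "continuous_on {0..1/10} (radius_poly K)"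
    unfolding radius_poly_def by (intro continuous_intros)
  then obtain r0 where r0: "0 \<le> r0" "r0 \<le> 1 / 10" "radius_poly K r0 = 0"
    using IVT2'[of "radius_poly K" "1/10" 0 0] neg pos by auto
  have r0': "0 < r0" "r0 < 1 / 3" using r0 pos by (auto simp: order_less_le)
  note mono = radius_poly_strict_antimono[OF assms]
  show ?thesis
  proof (intro exI[of _ r0] conjI allI impI)
    fix r assume "0 < r \<and> r < 1 / 3 \<and> radius_poly K r = 0"
    then show "r = r0" using mono[of r r0] mono[of r0 r] r0 r0' by (cases r r0 rule: linorder_cases) auto
  next
    fix f h g a b \<phi> and z :: complex assume "admissible K f h g a b \<phi> \<and> norm z \<le> r0"
    moreover from this have "radius_poly K (norm z) \<ge> 0"
      using mono[of "norm z" r0] r0 r0' by (cases "norm z = r0") auto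
    ultimately show "bohr_sum h a b z \<le> norm (\<phi> 0) + infdist (\<phi> 0) (frontier (\<phi> ` unit_disc))"
      using r0 by (intro bohr_inequality[OF assms]) auto
  next
    fix R assume R: "r0 < R"
    \<comment> \<open>The minimum with 1/3 keeps r where \<open>radius_poly\<close> is strictly
      decreasing, however large R is.\<close>
    obtain r where r: "r0 < r" "r < min R (1 / 3)" using R r0' dense[of r0 "min R (1/3)"] by auto
    define k where "k = (K - 1) / (K + 1)"
    have "radius_poly K r < 0" using mono[of r0 r] r r0 r0' by auto
    then have "radius_poly K r / (1 - r) ^ 3 < 0" using r by (intro divide_neg_pos) auto
    then have big: "bohr_sum koebe (\<lambda>n. of_nat n) (\<lambda>n. of_real k * of_nat n) (of_real r) > 1 / 4"
      using koebe_bohr_sum[of r K k] assms r r0' by (simp add: k_def)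
    have small: "norm (koebe 0 :: complex) + infdist (koebe 0) (frontier (koebe ` unit_disc :: complex set)) \<le> 1 / 4"
      using koebe_infdist by (simp add: koebe_def)
    have z: "(of_real r :: complex) \<in> unit_disc" "norm (of_real r :: complex) \<le> R" using r r0' by auto
    show "\<not> (\<forall>f h g a b \<phi>. \<forall>z\<in>unit_disc. admissible K f h g a b \<phi> \<and> norm z \<le> R \<longrightarrow>
       bohr_sum h a b z \<le> norm (\<phi> 0) + infdist (\<phi> 0) (frontier (\<phi> ` unit_disc)))" (is "\<not> ?H")
    proof
      assume ?H
      from this[rule_format, OF z(1) conjI[OF koebe_admissible[OF assms k_def] z(2)]]
      show False using big small by linarith
    qed
  qed (use r0 r0' in auto)
qed

end
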